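(* Let $U\subset(0,\infty)$ be nonempty and $1<p<\infty$. Then there is a constant $c_p>0$ (independent of $U$) such that $$\|\mathcal H^U\|_{L^p\to L^p}\ge c_p\sqrt{\log(\mathfrak N(U))}.$$
   Context: Fix $b>1$ and nonzero reals $c_+,c_-$; $\gamma_b(t)=c_+t^b$ for $t>0$, $\gamma_b(t)=c_-(-t)^b$ for $t<0$. For $u\in\mathbb R$, $H^{(u)}f(x)=\mathrm{p.v.}\int f(x_1-t,x_2-u\gamma_b(t))\frac{dt}t$, and $\mathcal H^Uf=\sup_{u\in U}|H^{(u)}f|$; $\|\mathcal H^U\|_{L^p\to L^p}=\sup\{\|\mathcal H^Uf\|_p:\|f\|_p\le1\}$ (possibly $+\infty$). $\mathfrak N(U)=1+\#\{n\in\mathbb Z:[2^n,2^{n+1}]\cap U\ne\emptyset\}$. *)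

theory Defs
  imports "HOL-Analysis.Analysis"
begin

text \<open>The curve gamma_b(t) = c_+ t^b (t>0), c_- (-t)^b (t<0); value 0 at t=0 is irrelevant.\<close>
definition gammab :: "real \<Rightarrow> real \<Rightarrow> real \<Rightarrow> real \<Rightarrow> real" where
  "gammab b cp cm t = (if t > 0 then cp * t powr b else if t < 0 then cm * (- t) powr b else 0)"

definition Htrunc :: "real \<Rightarrow> real \<Rightarrow> real \<Rightarrow> real \<Rightarrow> (real \<times> real \<Rightarrow> real)
    \<Rightarrow> real \<Rightarrow> real \<Rightarrow> real \<times> real \<Rightarrow> real" where
  "Htrunc b cp cm u f eps R x =
     (LINT t : {t. eps < \<bar>t\<bar> \<and> \<bar>t\<bar> < R} | lborel.
        f (fst x - t, snd x - u * gammab b cp cm t) / t)"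

definition Hpv :: "real \<Rightarrow> real \<Rightarrow> real \<Rightarrow> real \<Rightarrow> (real \<times> real \<Rightarrow> real) \<Rightarrow> real \<times> real \<Rightarrow> real" where
  "Hpv b cp cm u f x =
     (if \<exists>L. ((\<lambda>(eps, R). Htrunc b cp cm u f eps R x) \<longlongrightarrow> L) (at_right 0 \<times>\<^sub>F at_top)
      then THE L. ((\<lambda>(eps, R). Htrunc b cp cm u f eps R x) \<longlongrightarrow> L) (at_right 0 \<times>\<^sub>F at_top)
      else 0)"

definition HU :: "real \<Rightarrow> real \<Rightarrow> real \<Rightarrow> real set \<Rightarrow> (real \<times> real \<Rightarrow> real) \<Rightarrow> real \<times> real \<Rightarrow> ennreal" where
  "HU b cp cm U f x = (SUP u\<in>U. ennreal \<bar>Hpv b cp cm u f x\<bar>)"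

text \<open>Real powers of extended nonnegative reals (for positive exponents).\<close>
definition epowr :: "ennreal \<Rightarrow> real \<Rightarrow> ennreal" where
  "epowr y a = (if y = \<infinity> then \<infinity> else ennreal (enn2real y powr a))"

definition Lpnorm :: "real \<Rightarrow> (real \<times> real \<Rightarrow> ennreal) \<Rightarrow> ennreal" where
  "Lpnorm p g = epowr (\<integral>\<^sup>+ x. epowr (g x) p \<partial>lborel) (1 / p)"

definition HUnorm :: "real \<Rightarrow> real \<Rightarrow> real \<Rightarrow> real set \<Rightarrow> real \<Rightarrow> ennreal" where
  "HUnorm b cp cm U p =
     (SUP f \<in> {f :: real \<times> real \<Rightarrow> real. f \<in> borel_measurable lborel \<and>
                  Lpnorm p (\<lambda>x. ennreal \<bar>f x\<bar>) \<le> 1}.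
        Lpnorm p (HU b cp cm U f))"

text \<open>Dyadic scales met by U; N(U) = 1 + card of this set.\<close>
definition dyadic_scales :: "real set \<Rightarrow> int set" where
  "dyadic_scales U = {n. {2 powr n .. 2 powr (n + 1)} \<inter> U \<noteq> {}}"

end

theory Submission
  imports Defs "HOL-Probability.Sinc_Integral"
begin

text \<open>
  On a modulated indicator \<open>1\<^sub>E(x) cos (n x\<^sub>1 + \<sigma> n\<^sup>b x\<^sub>2)\<close> the operator \<open>H\<^sup>(\<^sup>u\<^sup>)\<close> acts, as \<open>n \<rightarrow> \<infinity>\<close>
  and pointwise off the boundary of \<open>E\<close>, as multiplication of the phase by a symbol that depends only on
  \<open>\<sigma> u\<close>. The symbol has one limit as \<open>\<sigma> u \<rightarrow> 0\<close> (the Hilbert transform in \<open>x\<^sub>1\<close>) and a different one as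
  \<open>\<sigma> u \<rightarrow> \<infinity>\<close>. Take \<open>2\<^sup>L\<close> well separated elements of \<open>U\<close> as the leaves of a binary tree and give every node a
  \<open>\<sigma>\<close> that separates the leaves on its left from those on its right. The set \<open>E\<close> of a node is split
  between its children according to which of the two limit values is larger at the point. Then at every
  point \<open>x\<close> the operator of the leaf reached by \<open>x\<close> collects the larger value at each of the \<open>L\<close> levels,
  so the maximal function is of size \<open>L\<close>, whereas the sum of the blocks is almost a martingale with
  bounded differences and has \<open>L\<^sup>p\<close> norm \<open>O(\<surd>L)\<close>. This is the mechanism by which rearranged Haar series
  diverge.
\<close>

section \<open>Oscillatory integrals\<close>

text \<open>The two limit values must differ. For small \<open>\<sigma> u\<close> the value at phase
  \<theta> is \<open>pi * sin \<theta>\<close>; for large \<open>\<sigma> u\<close> the coefficient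
  of \<open>sin \<theta>\<close> is at most \<open>pi / b\<close>, because s = t^b turns dt/t into
  ds/(b s). So b > 1 forces a gap. Its amplitude r measures the gain: the larger value exceeds the
  average of the two by half of |r| |cos|, which has positive mean, at every level.

  The frequencies are picked one level at a time, each after all earlier ones are fixed. Every
  requirement on a level then holds for all large n by a qualitative limit theorem; no rates and no
  L^p bounds for the operators enter.

  The size O(sqrt L) comes from exponential moments at s = 1 / sqrt L with both signs, which serve
  all p together. On the other side a mean over the unit square is bounded below, and convexity
  passes to the p-norm. Depth L consumes 2^L leaves, hence the root of the logarithm. If there are
  too few scales for a tree, a single u suffices: the modulus lets H and -H act as two
  leaves.\<close>

lemma oscillatory_integral_bound:
  fixes \<alpha> \<beta> \<delta> a R b c :: real
  assumes b: "1 \<le> b" and a: "0 < a" "a \<le> R" and c: "0 < c"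
    and w0: "0 < \<bar>\<alpha>\<bar> * a + b * \<bar>\<beta>\<bar> * a powr b"
    and low: "\<And>t. t \<in> {a..R} \<Longrightarrow>
       c * (\<bar>\<alpha>\<bar> * t + b * \<bar>\<beta>\<bar> * t powr b) \<le> \<bar>\<alpha> * t + b * \<beta> * t powr b\<bar>"
  shows "\<bar>integral {a..R} (\<lambda>t. cos (\<alpha> * t + \<beta> * t powr b + \<delta>) / t)\<bar>
           \<le> (2 / c + b / c\<^sup>2) / (\<bar>\<alpha>\<bar> * a + b * \<bar>\<beta>\<bar> * a powr b)"
proof -
  define w where "w = (\<lambda>t. \<bar>\<alpha>\<bar> * t + b * \<bar>\<beta>\<bar> * t powr b)"
  define v where "v = (\<lambda>t. \<alpha> * t + b * \<beta> * t powr b)"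
  define v' where "v' = (\<lambda>t. \<alpha> + b * \<beta> * (b * t powr (b - 1)))"
  define \<phi> where "\<phi> = (\<lambda>t. \<alpha> * t + \<beta> * t powr b + \<delta>)"
  have pw: "t powr b = t * t powr (b - 1)" if "t > 0" for t :: real
    using that powr_mult_base[of t "b - 1"] by simp
  \<comment> \<open>Linear growth of \<open>w\<close> makes the remainder of the integration by
    parts decay like \<open>1 / t\<^sup>2\<close>, so that the bound does not depend on R.\<close>
  have wgrow: "w a * t / a \<le> w t" if "t \<in> {a..R}" for t
  proof -
    have "a powr (b - 1) \<le> t powr (b - 1)"
      using that a b by (intro powr_mono2) auto
    then have "b * \<bar>\<beta>\<bar> * a powr (b - 1) * t \<le> b * \<bar>\<beta>\<bar> * t powr (b - 1) * t"
      using that a b by (intro mult_right_mono mult_left_mono) auto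
    moreover have "w a * t / a = \<bar>\<alpha>\<bar> * t + b * \<bar>\<beta>\<bar> * a powr (b - 1) * t"
      using a by (simp add: w_def pw field_simps)
    moreover have "w t = \<bar>\<alpha>\<bar> * t + b * \<bar>\<beta>\<bar> * t powr (b - 1) * t"
      using that a by (simp add: w_def pw field_simps)
    ultimately show ?thesis by linarith
  qed
  have wpos: "w t > 0" if "t \<in> {a..R}" for t
  proof -
    have "0 < w a * t / a" using w0 that a by (simp add: w_def)
    with wgrow[OF that] show ?thesis by linarith
  qed
  have vlow: "c * w t \<le> \<bar>v t\<bar>" if "t \<in> {a..R}" for t
    using low[OF that] by (simp add: w_def v_def)
  have vnz: "v t \<noteq> 0" if "t \<in> {a..R}" for t
    using vlow[OF that] mult_pos_pos[OF c wpos[OF that]] by auto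
  have v'up: "\<bar>v' t\<bar> \<le> b * w t / t" if "t \<in> {a..R}" for t
  proof -
    have t: "t > 0" using that a by auto
    have "\<bar>v' t\<bar> \<le> \<bar>\<alpha>\<bar> + \<bar>b * \<beta> * (b * t powr (b - 1))\<bar>" by (simp add: v'_def)
    also have "\<dots> = \<bar>\<alpha>\<bar> + b * (b * \<bar>\<beta>\<bar> * t powr (b - 1))" using b by (simp add: abs_mult)
    also have "\<dots> \<le> b * \<bar>\<alpha>\<bar> + b * (b * \<bar>\<beta>\<bar> * t powr (b - 1))"
      using b mult_right_mono[of 1 b "\<bar>\<alpha>\<bar>"] by simp
    also have "\<dots> = b * w t / t" using t by (simp add: w_def pw field_simps)
    finally show ?thesis .
  qed
  \<comment> \<open>Integration by parts. Since \<open>v t\<close> is t times the derivative of the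
    phase, \<open>cos (\<phi> t) / t\<close> is the derivative of \<open>F\<close> up to the
    remainder \<open>e\<close>.\<close>
  define F where "F = (\<lambda>t. sin (\<phi> t) / v t)"
  define e where "e = (\<lambda>t. sin (\<phi> t) * v' t / (v t)\<^sup>2)"
  have dF: "(F has_vector_derivative (cos (\<phi> t) / t - e t)) (at t within {a..R})" if "t \<in> {a..R}" for t
  proof -
    have t: "t > 0" using that a by auto
    have "(F has_real_derivative (cos (\<phi> t) * (\<alpha> + \<beta> * (b * t powr (b - 1))) * v t - sin (\<phi> t) * v' t) / (v t * v t)) (at t)"
      unfolding F_def \<phi>_def v_def v'_def using t vnz[OF that, unfolded v_def]
      by (auto intro!: derivative_eq_intros simp: algebra_simps)
    moreover have "\<alpha> + \<beta> * (b * t powr (b - 1)) = v t / t"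
      using t by (simp add: v_def pw field_simps)
    then have "(cos (\<phi> t) * (\<alpha> + \<beta> * (b * t powr (b - 1))) * v t - sin (\<phi> t) * v' t) / (v t * v t)
        = cos (\<phi> t) / t - e t"
      using t vnz[OF that] by (simp add: e_def diff_divide_distrib power2_eq_square)
    ultimately show ?thesis
      using has_field_derivative_at_within has_real_derivative_iff_has_vector_derivative by metis
  qed
  have I1: "((\<lambda>t. cos (\<phi> t) / t - e t) has_integral F R - F a) {a..R}"
    by (rule fundamental_theorem_of_calculus) (use a dF in auto)
  have tnz: "t \<noteq> 0" if "t \<in> {a..R}" for t using that a by auto
  have ce: "continuous_on {a..R} e"
    unfolding e_def \<phi>_def v_def v'_def using tnz vnz[unfolded v_def]
    by (intro continuous_intros) auto
  then have ie: "e integrable_on {a..R}" by (rule integrable_continuous_real)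
  have "((\<lambda>t. (cos (\<phi> t) / t - e t) + e t) has_integral F R - F a + integral {a..R} e) {a..R}"
    by (intro has_integral_add I1 integrable_integral ie)
  then have eq: "integral {a..R} (\<lambda>t. cos (\<phi> t) / t) = F R - F a + integral {a..R} e"
    by (simp add: integral_unique)
  have Fb: "\<bar>F t\<bar> \<le> (1 / c) / w a" if "t \<in> {a..R}" for t
  proof -
    have "w a * a \<le> w a * t" using that w0 by (intro mult_left_mono) (auto simp: w_def)
    then have "w a \<le> w a * t / a" using a by (simp add: pos_le_divide_eq)
    then have "c * w a \<le> \<bar>v t\<bar>" using wgrow[OF that] vlow[OF that] c
      by (meson mult_left_mono less_imp_le order_trans)
    moreover have "c * w a > 0" using c w0 by (simp add: w_def)
    ultimately have "1 / \<bar>v t\<bar> \<le> 1 / (c * w a)" by (intro divide_left_mono) auto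
    moreover have "\<bar>F t\<bar> \<le> 1 / \<bar>v t\<bar>" unfolding F_def by (simp add: divide_right_mono)
    ultimately show ?thesis by simp
  qed
  define g where "g = (\<lambda>t. (b / c\<^sup>2 * (a / w a)) * (1 / t\<^sup>2))"
  have eb: "norm (e t) \<le> g t" if "t \<in> {a..R}" for t
  proof -
    have t: "t > 0" using that a by auto
    have wa: "w a > 0" using w0 by (simp add: w_def)
    have "\<bar>e t\<bar> = \<bar>sin (\<phi> t)\<bar> * \<bar>v' t\<bar> / (v t)\<^sup>2"
      by (simp add: e_def abs_mult)
    also have "\<dots> \<le> 1 * \<bar>v' t\<bar> / (v t)\<^sup>2"
      by (intro divide_right_mono mult_right_mono) auto
    also have "\<dots> \<le> (b * w t / t) / (c * w t)\<^sup>2"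
    proof (intro frac_le)
      show "(c * w t)\<^sup>2 \<le> (v t)\<^sup>2" 
        using vlow[OF that] c wpos[OF that] by (subst power2_abs[of "v t", symmetric], intro power_mono) auto
    qed (use v'up[OF that] t b c wpos[OF that] in auto)
    also have "\<dots> = (b / c\<^sup>2) * (1 / (t * w t))"
      using wpos[OF that] by (simp add: power2_eq_square)
    also have "\<dots> \<le> (b / c\<^sup>2) * (1 / (t * (w a * t / a)))"
      using wgrow[OF that] t b c wpos[OF that] wa a
      by (intro mult_left_mono divide_left_mono mult_pos_pos) auto
    also have "\<dots> = g t" by (simp add: g_def power2_eq_square)
    finally show ?thesis by simp
  qed
  have I2: "(g has_integral (b / c\<^sup>2 * (a / w a)) * ((- (1 / R)) - (- (1 / a)))) {a..R}"
    unfolding g_def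
  proof (rule has_integral_mult_right, rule fundamental_theorem_of_calculus[where f = "\<lambda>t. - (1 / t)"])
    fix t assume "t \<in> {a..R}"
    then have t: "t \<noteq> 0" using a by auto
    have "((\<lambda>t. - (1 / t)) has_real_derivative 1 / t\<^sup>2) (at t)"
      using t by (auto intro!: derivative_eq_intros simp: power2_eq_square)
    then show "((\<lambda>t. - (1 / t)) has_vector_derivative 1 / t\<^sup>2) (at t within {a..R})"
      using has_field_derivative_at_within has_real_derivative_iff_has_vector_derivative by metis
  qed (use a in auto)
  have "norm (integral {a..R} e) \<le> integral {a..R} g"
    by (rule integral_norm_bound_integral) (use ie I2 eb in auto)
  also have "\<dots> = (b / c\<^sup>2 * (a / w a)) * ((- (1 / R)) - (- (1 / a)))" using I2 by (rule integral_unique)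
  also have "\<dots> \<le> (b / c\<^sup>2 * (a / w a)) * (1 / a)"
    using a b c w0 by (intro mult_left_mono) (auto simp: w_def)
  also have "\<dots> = (b / c\<^sup>2) / w a" using a by simp
  finally have "\<bar>integral {a..R} e\<bar> \<le> (b / c\<^sup>2) / w a" by simp
  moreover have "\<bar>F R\<bar> \<le> (1 / c) / w a" "\<bar>F a\<bar> \<le> (1 / c) / w a" using Fb a by auto
  ultimately have "\<bar>integral {a..R} (\<lambda>t. cos (\<phi> t) / t)\<bar> \<le> (1 / c) / w a + (1 / c) / w a + (b / c\<^sup>2) / w a"
    unfolding eq by linarith
  also have "\<dots> = (2 / c + b / c\<^sup>2) / w a" by (simp add: add_divide_distrib)
  finally show ?thesis by (simp add: \<phi>_def w_def)
qed


text \<open>Used for the window around a stationary point after it is cut down to the interval of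
  integration: clamping both ends does not let their ratio exceed the factor m.\<close>

lemma clamp_mult_le:
  fixes m a R z :: real
  assumes "1 \<le> m" "0 \<le> a" "a \<le> R"
  shows "max a (min R (m * z)) \<le> m * max a (min R z)"
proof -
  let ?p = "max a (min R z)"
  have p: "?p \<le> m * ?p" using assms mult_right_mono[of 1 m ?p] by auto
  have "min R (m * z) \<le> m * ?p"
  proof (cases "z \<le> R")
    case True
    have "m * z \<le> m * ?p" using True assms by (intro mult_left_mono) auto
    then show ?thesis by linarith
  next
    case False
    then show ?thesis using p by linarith
  qed
  then show ?thesis using p by auto
qed

text \<open>The bound is uniform in all parameters: near the only possible stationary point
  \<open>\<tau>\<^sub>0\<close> the integral over \<open>[\<tau>\<^sub>0 / \<mu>, \<tau>\<^sub>0 \<mu>]\<close> is trivially at most \<open>2 ln \<mu>\<close>, and away from it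
  the first-derivative estimate applies.\<close>
lemma oscillatory_tail_small:
  fixes b \<epsilon> :: real
  assumes b: "1 < b" and \<epsilon>: "0 < \<epsilon>"
  obtains W where "0 < W"
    and "\<forall>\<alpha> \<beta> \<delta> a R. 0 < a \<and> a \<le> R \<and> W \<le> \<bar>\<alpha>\<bar> * a + b * \<bar>\<beta>\<bar> * a powr b \<longrightarrow>
           \<bar>integral {a..R} (\<lambda>t. cos (\<alpha> * t + \<beta> * t powr b + \<delta>) / t)\<bar> \<le> \<epsilon>"
proof -
  \<comment> \<open>With this width the window around the stationary point contributes at most
    \<open>2 * ln \<mu> = \<epsilon> / 2\<close>, and \<open>W\<close> is chosen so that each of the
    two outer pieces contributes at most \<open>\<epsilon> / 4\<close>.\<close>
  define \<mu> where "\<mu> = exp (\<epsilon> / 4)"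
  define \<rho> where "\<rho> = \<mu> powr (b - 1)"
  \<comment> \<open>If one of two nonnegative numbers is at least \<rho> times the other, their
    difference is at least c times their sum. This supplies the lower bound on the phase derivative
    outside the window.\<close>
  define c where "c = (\<rho> - 1) / (\<rho> + 1)"
  define C where "C = 2 / c + b / c\<^sup>2"
  define W where "W = 4 * C / \<epsilon>"
  have \<mu>: "1 < \<mu>" using \<epsilon> by (simp add: \<mu>_def)
  have \<rho>: "1 < \<rho>" using \<mu> b by (simp add: \<rho>_def gr_one_powr)
  have c: "0 < c" "c \<le> 1" using \<rho> by (auto simp: c_def field_simps)
  have C: "0 < C" using c b by (simp add: C_def add_pos_pos)
  have W: "0 < W" using C \<epsilon> by (simp add: W_def)
  have "\<bar>integral {a..R} (\<lambda>t. cos (\<alpha> * t + \<beta> * t powr b + \<delta>) / t)\<bar> \<le> \<epsilon>"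
    if a: "0 < a" "a \<le> R" and Wa: "W \<le> \<bar>\<alpha>\<bar> * a + b * \<bar>\<beta>\<bar> * a powr b" for \<alpha> \<beta> \<delta> a R
  proof -
    define w where "w = (\<lambda>t. \<bar>\<alpha>\<bar> * t + b * \<bar>\<beta>\<bar> * t powr b)"
    define h where "h = (\<lambda>t. cos (\<alpha> * t + \<beta> * t powr b + \<delta>) / t)"
    have piece: "\<bar>integral {p..q} h\<bar> \<le> \<epsilon> / 4"
      if pq: "a \<le> p" "p \<le> q" and low: "\<And>t. t \<in> {p..q} \<Longrightarrow> c * w t \<le> \<bar>\<alpha> * t + b * \<beta> * t powr b\<bar>" for p q
    proof -
      have "w a \<le> w p" unfolding w_def using pq a b
        by (intro add_mono mult_left_mono powr_mono2) auto
      then have wp: "W \<le> w p" using Wa by (simp add: w_def)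
      have "\<bar>integral {p..q} h\<bar> \<le> C / w p"
        unfolding h_def w_def C_def
        by (rule oscillatory_integral_bound) (use pq a b c W wp low in \<open>auto simp: w_def\<close>)
      also have "\<dots> \<le> C / W" using wp W C by (intro divide_left_mono) auto
      also have "\<dots> = \<epsilon> / 4" using C \<epsilon> by (simp add: W_def)
      finally show ?thesis .
    qed
    have hc: "continuous_on {p..q} h" if "a \<le> p" for p q
      unfolding h_def using that a by (intro continuous_intros) auto
    show ?thesis
    proof (cases "0 \<le> \<alpha> * \<beta>")
      case True
      have "\<bar>integral {a..R} h\<bar> \<le> \<epsilon> / 4"
      proof (rule piece)
        fix t assume "t \<in> {a..R}"
        then have t: "0 < t" using a by auto
        have "\<bar>\<alpha> * t + b * \<beta> * t powr b\<bar> = w t"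
        proof -
          have "0 \<le> (\<alpha> * t) * (b * \<beta> * t powr b)"
            using True t b mult_nonneg_nonneg[OF True, of "t * b * t powr b"] by (simp add: ac_simps)
          then have "\<bar>\<alpha> * t + b * \<beta> * t powr b\<bar> = \<bar>\<alpha> * t\<bar> + \<bar>b * \<beta> * t powr b\<bar>"
            by (auto simp: zero_le_mult_iff)
          then show ?thesis using t b by (simp add: w_def abs_mult)
        qed
        moreover have "c * w t \<le> 1 * w t" using c t b by (intro mult_right_mono) (auto simp: w_def)
        ultimately show "c * w t \<le> \<bar>\<alpha> * t + b * \<beta> * t powr b\<bar>" by simp
      qed (use a in auto)
      then show ?thesis using \<epsilon> by (simp add: h_def)
    next
      case False
      then have ab: "\<alpha> \<noteq> 0" "\<beta> \<noteq> 0" by auto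
      \<comment> \<open>For coefficients of opposite sign the two terms of the phase derivative
        balance where \<open>t powr (b - 1) = r\<close>, that is at t = \<tau>. Moving away from
        \<tau> by the factor \<mu> unbalances them by the factor \<rho>.\<close>
      define r where "r = \<bar>\<alpha>\<bar> / (b * \<bar>\<beta>\<bar>)"
      define \<tau> where "\<tau> = r powr (1 / (b - 1))"
      have r: "0 < r" using ab b by (simp add: r_def)
      have \<tau>: "0 < \<tau>" "\<tau> powr (b - 1) = r" using r b by (auto simp: \<tau>_def powr_powr)
      have pw: "t powr b = t * t powr (b - 1)" if "t > 0" for t :: real
        using that powr_mult_base[of t "b - 1"] by simp
      have v: "\<bar>\<alpha> * t + b * \<beta> * t powr b\<bar> = \<bar>\<bar>\<alpha>\<bar> * t - b * \<bar>\<beta>\<bar> * t powr b\<bar>" if "t > 0" for t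
      proof (cases "\<alpha> > 0")
        case True
        then have "\<beta> < 0" using False by (simp add: not_le mult_less_0_iff)
        then show ?thesis using True by simp
      next
        case F: False
        then have "\<alpha> < 0" "\<beta> > 0" using False ab by (auto simp: not_le mult_less_0_iff)
        then show ?thesis by simp
      qed
      have gap: "c * (X + Y) \<le> \<bar>X - Y\<bar>" if "0 \<le> X" "0 \<le> Y" "\<rho> * Y \<le> X \<or> \<rho> * X \<le> Y" for X Y
      proof -
        have "(\<rho> - 1) * (X + Y) \<le> (\<rho> + 1) * \<bar>X - Y\<bar>"
          using that(3)
        proof
          assume "\<rho> * Y \<le> X"
          moreover have "Y \<le> \<rho> * Y" using \<rho> that by (simp add: mult_le_cancel_right1)
          ultimately show ?thesis by (simp add: algebra_simps)
        next
          assume "\<rho> * X \<le> Y"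
          moreover have "X \<le> \<rho> * X" using \<rho> that by (simp add: mult_le_cancel_right1)
          ultimately show ?thesis by (simp add: algebra_simps)
        qed
        then show ?thesis using \<rho> by (simp add: c_def field_simps)
      qed
      have left: "c * w t \<le> \<bar>\<alpha> * t + b * \<beta> * t powr b\<bar>" if t: "0 < t" "t \<le> \<tau> / \<mu>" for t
      proof -
        have "t powr (b - 1) \<le> (\<tau> / \<mu>) powr (b - 1)" using t b by (intro powr_mono2) auto
        also have "\<dots> = r / \<rho>" using \<tau> \<mu> by (simp add: powr_divide \<rho>_def)
        finally have "\<rho> * t powr (b - 1) \<le> r" using \<rho> by (simp add: field_simps)
        then have "\<rho> * (b * \<bar>\<beta>\<bar> * t powr b) \<le> \<bar>\<alpha>\<bar> * t"
          using t ab b by (simp add: pw r_def field_simps)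
        then show ?thesis unfolding v[OF t(1)] w_def using t b by (intro gap) auto
      qed
      have right: "c * w t \<le> \<bar>\<alpha> * t + b * \<beta> * t powr b\<bar>" if t: "\<tau> * \<mu> \<le> t" for t
      proof -
        have t0: "0 < t" using t \<tau> \<mu> by (smt (verit) mult_pos_pos)
        have "r * \<rho> = (\<tau> * \<mu>) powr (b - 1)" using \<tau> \<mu> by (simp add: powr_mult \<rho>_def)
        also have "\<dots> \<le> t powr (b - 1)" using t b \<tau> \<mu> by (intro powr_mono2) auto
        finally have "r * \<rho> \<le> t powr (b - 1)" .
        then have "\<rho> * (\<bar>\<alpha>\<bar> * t) \<le> b * \<bar>\<beta>\<bar> * t powr b"
          using t0 ab b by (simp add: pw r_def field_simps)
        then show ?thesis unfolding v[OF t0] w_def using t0 b by (intro gap) auto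
      qed
      \<comment> \<open>The window is clamped to \<open>{a..R}\<close>, so one formula covers a
        stationary point inside or outside the interval. An outer piece that disappears is the
        degenerate case \<open>p = a\<close> or \<open>q = R\<close>.\<close>
      define p where "p = max a (min R (\<tau> / \<mu>))"
      define q where "q = max a (min R (\<tau> * \<mu>))"
      have "\<tau> / \<mu> \<le> \<tau> * \<mu>"
      proof -
        have "\<tau> \<le> \<tau> * (\<mu> * \<mu>)" using \<tau> \<mu> by (simp add: mult_le_cancel_left1 less_1_mult less_imp_le)
        then show ?thesis using \<mu> by (simp add: pos_divide_le_eq mult.assoc)
      qed
      then have pq: "a \<le> p" "p \<le> q" "q \<le> R" using a by (auto simp: p_def q_def)
      have "q \<le> \<mu>\<^sup>2 * p"
        using clamp_mult_le[of "\<mu>\<^sup>2" a R "\<tau> / \<mu>"] a \<mu> one_le_power[of \<mu> 2]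
        by (simp add: p_def q_def power2_eq_square mult.commute)
      have "integral {a..R} h = integral {a..p} h + integral {p..q} h + integral {q..R} h"
        using pq a hc Henstock_Kurzweil_Integration.integral_combine[of a p R h]
          Henstock_Kurzweil_Integration.integral_combine[of p q R h]
        by (simp add: integrable_continuous_real)
      moreover have "\<bar>integral {a..p} h\<bar> \<le> \<epsilon> / 4"
      proof (cases "p = a")
        case False
        then have "p \<le> \<tau> / \<mu>" by (auto simp: p_def max_def split: if_splits)
        then show ?thesis using pq a by (intro piece left) auto
      qed (use \<epsilon> in auto)
      moreover have "\<bar>integral {q..R} h\<bar> \<le> \<epsilon> / 4"
      proof (cases "q = R")
        case False
        then have "\<tau> * \<mu> \<le> q" using pq by (auto simp: q_def max_def min_def split: if_splits)
        then show ?thesis using pq a by (intro piece right) auto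
      qed (use \<epsilon> in auto)
      moreover have "\<bar>integral {p..q} h\<bar> \<le> \<epsilon> / 2"
      proof -
        have I: "((\<lambda>t. 1 / t) has_integral ln q - ln p) {p..q}"
        proof (rule fundamental_theorem_of_calculus)
          fix t assume "t \<in> {p..q}"
          then have "t > 0" using pq a by auto
          then have "(ln has_real_derivative 1 / t) (at t)"
            by (auto intro!: derivative_eq_intros)
          then show "(ln has_vector_derivative 1 / t) (at t within {p..q})"
            using has_field_derivative_at_within has_real_derivative_iff_has_vector_derivative by metis
        qed (use pq in auto)
        have "norm (integral {p..q} h) \<le> integral {p..q} (\<lambda>t. 1 / t)"
        proof (rule integral_norm_bound_integral)
          show "h integrable_on {p..q}" using hc pq by (intro integrable_continuous_real) auto
          show "(\<lambda>t. 1 / t) integrable_on {p..q}" using I by auto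
          fix t assume "t \<in> {p..q}"
          then have "t > 0" using pq a by auto
          then show "norm (h t) \<le> 1 / t" by (simp add: h_def divide_right_mono)
        qed
        also have "\<dots> = ln q - ln p" using I by (rule integral_unique)
        also have "\<dots> \<le> ln (\<mu>\<^sup>2 * p) - ln p"
          using \<open>q \<le> \<mu>\<^sup>2 * p\<close> pq a by simp
        also have "\<dots> = 2 * ln \<mu>" using pq a \<mu> by (simp add: ln_mult ln_realpow)
        also have "\<dots> = \<epsilon> / 2" by (simp add: \<mu>_def)
        finally show ?thesis by simp
      qed
      ultimately show ?thesis unfolding h_def[symmetric] by linarith
    qed
  qed
  with W show ?thesis by (intro that) auto
qed

section \<open>The symbol as an integral folded onto the positive half-line\<close>

lemma abs_cos_diff_le: "\<bar>cos x - cos y\<bar> \<le> \<bar>x - y :: real\<bar>"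
proof -
  have "\<bar>cos x - cos y\<bar> = 2 * (\<bar>sin ((x + y) / 2)\<bar> * \<bar>sin ((y - x) / 2)\<bar>)"
    by (simp add: cos_diff_cos abs_mult)
  also have "\<dots> \<le> 2 * (1 * \<bar>(y - x) / 2\<bar>)"
    by (intro mult_left_mono mult_mono abs_sin_x_le_abs_x) auto
  finally show ?thesis by simp
qed

lemma set_integrable_bounded:
  fixes f :: "real \<Rightarrow> real"
  assumes f: "f \<in> borel_measurable borel" and A: "A \<in> sets borel" "A \<subseteq> {a..c}"
    and bd: "\<And>x. x \<in> A \<Longrightarrow> \<bar>f x\<bar> \<le> C"
  shows "set_integrable lborel A f"
proof (rule set_integrable_bound[where f = "\<lambda>_. C"])
  have "set_integrable lborel {a..c} (\<lambda>_. C)"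
    by (intro borel_integrable_atLeastAtMost') auto
  then show "set_integrable lborel A (\<lambda>_. C)"
    by (rule set_integrable_subset) (use A in auto)
  show "set_borel_measurable lborel A f"
    using f A by (simp add: set_borel_measurable_def)
  show "AE x in lborel. x \<in> A \<longrightarrow> norm (f x) \<le> norm C"
    using bd by (auto intro!: AE_I2) (meson abs_ge_self order_trans)
qed

text \<open>The integrand of the principal value of a modulated cosine after the half-line t < 0 is
  folded onto t > 0: index 1 belongs to the branch t > 0, index 2 to the branch t < 0, and \<theta>
  is the phase at the base point. The numerator is O(t) at 0, so no truncation is required.\<close>

definition osc_diff :: "real \<Rightarrow> real \<Rightarrow> real \<Rightarrow> real \<Rightarrow> real \<Rightarrow> real \<Rightarrow> real \<Rightarrow> real" where
  "osc_diff b \<theta> \<alpha>\<^sub>1 \<beta>\<^sub>1 \<alpha>\<^sub>2 \<beta>\<^sub>2 t =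
     (cos (\<theta> - \<alpha>\<^sub>1 * t - \<beta>\<^sub>1 * t powr b) - cos (\<theta> - \<alpha>\<^sub>2 * t - \<beta>\<^sub>2 * t powr b)) / t"

lemma borel_measurable_osc_diff [measurable]:
  "osc_diff b \<theta> \<alpha>\<^sub>1 \<beta>\<^sub>1 \<alpha>\<^sub>2 \<beta>\<^sub>2 \<in> borel_measurable borel"
  unfolding osc_diff_def by measurable

lemma powr_le_scaled:
  fixes t S b :: real
  assumes "1 \<le> b" "0 \<le> t" "t \<le> S"
  shows "t powr b \<le> S powr (b - 1) * t"
proof (cases "t = 0")
  case False
  then have "t powr b = t powr (b - 1) * t"
    using assms powr_mult_base[of t "b - 1"] by (simp add: mult.commute)
  also have "\<dots> \<le> S powr (b - 1) * t"
    using assms by (intro mult_right_mono powr_mono2) auto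
  finally show ?thesis .
qed simp

lemma osc_diff_bounded:
  assumes b: "1 \<le> b" and t: "0 \<le> t" "t \<le> R"
  shows "\<bar>osc_diff b \<theta> \<alpha>\<^sub>1 \<beta>\<^sub>1 \<alpha>\<^sub>2 \<beta>\<^sub>2 t\<bar> \<le> \<bar>\<alpha>\<^sub>1 - \<alpha>\<^sub>2\<bar> + \<bar>\<beta>\<^sub>1 - \<beta>\<^sub>2\<bar> * R powr (b - 1)"
proof (cases "t = 0")
  case False
  then have t0: "0 < t" using t by simp
  have "\<bar>cos (\<theta> - \<alpha>\<^sub>1 * t - \<beta>\<^sub>1 * t powr b) - cos (\<theta> - \<alpha>\<^sub>2 * t - \<beta>\<^sub>2 * t powr b)\<bar>
      \<le> \<bar>(\<theta> - \<alpha>\<^sub>1 * t - \<beta>\<^sub>1 * t powr b) - (\<theta> - \<alpha>\<^sub>2 * t - \<beta>\<^sub>2 * t powr b)\<bar>"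
    by (rule abs_cos_diff_le)
  also have "\<dots> = \<bar>(\<alpha>\<^sub>1 - \<alpha>\<^sub>2) * t + (\<beta>\<^sub>1 - \<beta>\<^sub>2) * t powr b\<bar>"
    by (simp add: algebra_simps)
  also have "\<dots> \<le> \<bar>(\<alpha>\<^sub>1 - \<alpha>\<^sub>2) * t\<bar> + \<bar>(\<beta>\<^sub>1 - \<beta>\<^sub>2) * t powr b\<bar>"
    by (rule abs_triangle_ineq)
  also have "\<dots> = \<bar>\<alpha>\<^sub>1 - \<alpha>\<^sub>2\<bar> * t + \<bar>\<beta>\<^sub>1 - \<beta>\<^sub>2\<bar> * t powr b" using t by (simp add: abs_mult)
  also have "\<dots> \<le> \<bar>\<alpha>\<^sub>1 - \<alpha>\<^sub>2\<bar> * t + \<bar>\<beta>\<^sub>1 - \<beta>\<^sub>2\<bar> * (R powr (b - 1) * t)"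
    using b t by (intro add_left_mono mult_left_mono powr_le_scaled) auto
  finally show ?thesis using t0 by (simp add: osc_diff_def field_simps)
qed (simp add: osc_diff_def)

lemma osc_diff_integrable:
  assumes "1 \<le> b"
  shows "osc_diff b \<theta> \<alpha>\<^sub>1 \<beta>\<^sub>1 \<alpha>\<^sub>2 \<beta>\<^sub>2 integrable_on {0..R}"
  by (rule set_borel_integral_eq_integral(1), rule set_integrable_bounded[where a = 0 and c = R])
     (use osc_diff_bounded[OF assms] in auto)

text \<open>Away from 0 the cancellation between the branches is dispensable, and the oscillatory
  estimate applies to each cosine by itself.\<close>

lemma osc_diff_tail:
  assumes b: "1 < b" and SR: "0 < S" "S \<le> R"
    and tail: "\<forall>\<alpha> \<beta> \<delta> a R. 0 < a \<and> a \<le> R \<and> W \<le> \<bar>\<alpha>\<bar> * a + b * \<bar>\<beta>\<bar> * a powr b \<longrightarrow>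
           \<bar>integral {a..R} (\<lambda>t. cos (\<alpha> * t + \<beta> * t powr b + \<delta>) / t)\<bar> \<le> \<epsilon>"
    and W1: "W \<le> \<bar>\<alpha>\<^sub>1\<bar> * S + b * \<bar>\<beta>\<^sub>1\<bar> * S powr b"
    and W2: "W \<le> \<bar>\<alpha>\<^sub>2\<bar> * S + b * \<bar>\<beta>\<^sub>2\<bar> * S powr b"
  shows "\<bar>integral {0..R} (osc_diff b \<theta> \<alpha>\<^sub>1 \<beta>\<^sub>1 \<alpha>\<^sub>2 \<beta>\<^sub>2) - integral {0..S} (osc_diff b \<theta> \<alpha>\<^sub>1 \<beta>\<^sub>1 \<alpha>\<^sub>2 \<beta>\<^sub>2)\<bar> \<le> 2 * \<epsilon>"
proof -
  let ?f = "\<lambda>\<alpha> \<beta> t. cos ((- \<alpha>) * t + (- \<beta>) * t powr b + \<theta>) / t"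
  have i: "?f \<alpha> \<beta> integrable_on {S..R}" for \<alpha> \<beta>
    using SR by (intro integrable_continuous_real continuous_intros) auto
  have "integral {0..R} (osc_diff b \<theta> \<alpha>\<^sub>1 \<beta>\<^sub>1 \<alpha>\<^sub>2 \<beta>\<^sub>2) - integral {0..S} (osc_diff b \<theta> \<alpha>\<^sub>1 \<beta>\<^sub>1 \<alpha>\<^sub>2 \<beta>\<^sub>2)
      = integral {S..R} (osc_diff b \<theta> \<alpha>\<^sub>1 \<beta>\<^sub>1 \<alpha>\<^sub>2 \<beta>\<^sub>2)"
    using Henstock_Kurzweil_Integration.integral_combine[OF _ SR(2) osc_diff_integrable[of b \<theta> \<alpha>\<^sub>1 \<beta>\<^sub>1 \<alpha>\<^sub>2 \<beta>\<^sub>2 R]] SR b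
    by simp
  also have "\<dots> = integral {S..R} (\<lambda>t. ?f \<alpha>\<^sub>1 \<beta>\<^sub>1 t - ?f \<alpha>\<^sub>2 \<beta>\<^sub>2 t)"
    by (rule integral_cong) (simp add: osc_diff_def diff_divide_distrib algebra_simps)
  also have "\<dots> = integral {S..R} (?f \<alpha>\<^sub>1 \<beta>\<^sub>1) - integral {S..R} (?f \<alpha>\<^sub>2 \<beta>\<^sub>2)"
    by (rule integral_diff) (rule i)+
  finally have "\<bar>integral {0..R} (osc_diff b \<theta> \<alpha>\<^sub>1 \<beta>\<^sub>1 \<alpha>\<^sub>2 \<beta>\<^sub>2) - integral {0..S} (osc_diff b \<theta> \<alpha>\<^sub>1 \<beta>\<^sub>1 \<alpha>\<^sub>2 \<beta>\<^sub>2)\<bar>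
      \<le> \<bar>integral {S..R} (?f \<alpha>\<^sub>1 \<beta>\<^sub>1)\<bar> + \<bar>integral {S..R} (?f \<alpha>\<^sub>2 \<beta>\<^sub>2)\<bar>" by linarith
  also have "\<dots> \<le> \<epsilon> + \<epsilon>"
    using W1 W2 SR by (intro add_mono tail[rule_format]) auto
  finally show ?thesis by simp
qed

lemma osc_diff_perturb:
  assumes b: "1 \<le> b" and S: "0 < S"
  shows "\<bar>integral {0..S} (osc_diff b \<theta> \<alpha>\<^sub>1 \<beta>\<^sub>1 \<alpha>\<^sub>2 \<beta>\<^sub>2) - integral {0..S} (osc_diff b \<theta> \<alpha>\<^sub>1' \<beta>\<^sub>1' \<alpha>\<^sub>2' \<beta>\<^sub>2')\<bar>
           \<le> (\<bar>\<alpha>\<^sub>1 - \<alpha>\<^sub>1'\<bar> + \<bar>\<alpha>\<^sub>2 - \<alpha>\<^sub>2'\<bar>) * S + (\<bar>\<beta>\<^sub>1 - \<beta>\<^sub>1'\<bar> + \<bar>\<beta>\<^sub>2 - \<beta>\<^sub>2'\<bar>) * S powr b"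
proof -
  let ?B = "\<bar>\<alpha>\<^sub>1 - \<alpha>\<^sub>1'\<bar> + \<bar>\<alpha>\<^sub>2 - \<alpha>\<^sub>2'\<bar> + (\<bar>\<beta>\<^sub>1 - \<beta>\<^sub>1'\<bar> + \<bar>\<beta>\<^sub>2 - \<beta>\<^sub>2'\<bar>) * S powr (b - 1)"
  let ?d = "\<lambda>t. osc_diff b \<theta> \<alpha>\<^sub>1 \<beta>\<^sub>1 \<alpha>\<^sub>2 \<beta>\<^sub>2 t - osc_diff b \<theta> \<alpha>\<^sub>1' \<beta>\<^sub>1' \<alpha>\<^sub>2' \<beta>\<^sub>2' t"
  have i: "osc_diff b \<theta> a1 b1 a2 b2 integrable_on {0..S}" for a1 b1 a2 b2
    using b by (rule osc_diff_integrable)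
  have "norm (integral {0..S} ?d) \<le> integral {0..S} (\<lambda>t. ?B)"
  proof (rule integral_norm_bound_integral)
    show "?d integrable_on {0..S}" by (intro integrable_diff i)
    fix t assume "t \<in> {0..S}"
    then have t: "0 \<le> t" "t \<le> S" by auto
    \<comment> \<open>The four cosines are regrouped so that each is paired with its own
      perturbation; the earlier pointwise bound then sees only the changes of the
      coefficients.\<close>
    have "?d t = osc_diff b \<theta> \<alpha>\<^sub>1 \<beta>\<^sub>1 \<alpha>\<^sub>1' \<beta>\<^sub>1' t - osc_diff b \<theta> \<alpha>\<^sub>2 \<beta>\<^sub>2 \<alpha>\<^sub>2' \<beta>\<^sub>2' t"
      by (simp add: osc_diff_def diff_divide_distrib)
    also have "\<bar>\<dots>\<bar> \<le> (\<bar>\<alpha>\<^sub>1 - \<alpha>\<^sub>1'\<bar> + \<bar>\<beta>\<^sub>1 - \<beta>\<^sub>1'\<bar> * S powr (b - 1)) + (\<bar>\<alpha>\<^sub>2 - \<alpha>\<^sub>2'\<bar> + \<bar>\<beta>\<^sub>2 - \<beta>\<^sub>2'\<bar> * S powr (b - 1))"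
      using osc_diff_bounded[OF b t, of \<theta> \<alpha>\<^sub>1 \<beta>\<^sub>1 \<alpha>\<^sub>1' \<beta>\<^sub>1'] osc_diff_bounded[OF b t, of \<theta> \<alpha>\<^sub>2 \<beta>\<^sub>2 \<alpha>\<^sub>2' \<beta>\<^sub>2']
      by linarith
    also have "\<dots> = ?B" by (simp add: algebra_simps)
    finally show "norm (?d t) \<le> ?B" by simp
  qed auto
  also have "\<dots> = ?B * S" using S by simp
  also have "\<dots> = (\<bar>\<alpha>\<^sub>1 - \<alpha>\<^sub>1'\<bar> + \<bar>\<alpha>\<^sub>2 - \<alpha>\<^sub>2'\<bar>) * S + (\<bar>\<beta>\<^sub>1 - \<beta>\<^sub>1'\<bar> + \<bar>\<beta>\<^sub>2 - \<beta>\<^sub>2'\<bar>) * (S * S powr (b - 1))"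
    by (simp add: algebra_simps)
  also have "S * S powr (b - 1) = S powr b" using S powr_mult_base[of S "b - 1"] by simp
  finally show ?thesis using i by (simp add: integral_diff)
qed

text \<open>dt/t is invariant under dilations, which act on the linear and the power coefficients by
  r and \<open>r powr b\<close>. This serves twice: to remove the frequency n of a block, and to
  normalise a large curve coefficient.\<close>

lemma osc_diff_scale:
  assumes b: "1 \<le> b" and r: "0 < r" and S: "0 \<le> S"
  shows "integral {0..r * S} (osc_diff b \<theta> \<alpha>\<^sub>1 \<beta>\<^sub>1 \<alpha>\<^sub>2 \<beta>\<^sub>2)
       = integral {0..S} (osc_diff b \<theta> (r * \<alpha>\<^sub>1) (r powr b * \<beta>\<^sub>1) (r * \<alpha>\<^sub>2) (r powr b * \<beta>\<^sub>2))"
proof -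
  let ?f = "osc_diff b \<theta> \<alpha>\<^sub>1 \<beta>\<^sub>1 \<alpha>\<^sub>2 \<beta>\<^sub>2"
  have im: "(\<lambda>x. x / r) ` {0..r * S} = {0..S}"
  proof (intro equalityI subsetI)
    fix y assume "y \<in> {0..S}"
    then have "y = (r * y) / r" "r * y \<in> {0..r * S}" using r by auto
    then show "y \<in> (\<lambda>x. x / r) ` {0..r * S}" by blast
  qed (use r in \<open>auto simp: field_simps\<close>)
  have "((\<lambda>x. ?f (r * x)) has_integral (1 / \<bar>r\<bar>) *\<^sub>R integral {0..r * S} ?f) {0..S}"
    using has_integral_stretch_real[OF integrable_integral[OF osc_diff_integrable[OF b]], of r \<theta> \<alpha>\<^sub>1 \<beta>\<^sub>1 \<alpha>\<^sub>2 \<beta>\<^sub>2 "r * S"] r im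
    by simp
  from has_integral_mult_right[OF this, of r]
  have "((\<lambda>x. r * ?f (r * x)) has_integral integral {0..r * S} ?f) {0..S}"
    using r by simp
  moreover have "integral {0..S} (\<lambda>x. r * ?f (r * x))
    = integral {0..S} (osc_diff b \<theta> (r * \<alpha>\<^sub>1) (r powr b * \<beta>\<^sub>1) (r * \<alpha>\<^sub>2) (r powr b * \<beta>\<^sub>2))"
    using r by (intro integral_cong) (auto simp: osc_diff_def powr_mult ac_simps)
  ultimately show ?thesis by (metis integral_unique)
qed

text \<open>The substitution s = c t^b turns dt/t into ds/(b s). The factor 1/b that results is the
  one that separates the two limit symbols.\<close>

lemma integral_sin_powr_over:
  fixes b c S :: real
  assumes b: "0 < b" and S: "0 \<le> S"
  shows "((\<lambda>t. sin (c * t powr b) / t) has_integral Si (c * S powr b) / b) {0..S}"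
proof -
  have Si0: "Si 0 = 0" by (simp add: Si_def zero_ereal_def)
  \<comment> \<open>At t = 0 the quotient is 0 by convention and need not be a derivative there,
    hence the interior form of the fundamental theorem.\<close>
  have "((\<lambda>t. sin (c * t powr b) / t) has_integral Si (c * S powr b) / b - Si (c * 0 powr b) / b) {0..S}"
  proof (rule fundamental_theorem_of_calculus_interior[OF S])
    have "continuous_on {0..S} (\<lambda>t. c * t powr b)"
      using b by (intro continuous_intros continuous_on_powr') auto
    then have "continuous_on {0..S} (\<lambda>t. Si (c * t powr b))"
      by (rule continuous_on_compose2[of UNIV Si, rotated])
         (auto intro: isCont_Si continuous_at_imp_continuous_on)
    then show "continuous_on {0..S} (\<lambda>t. Si (c * t powr b) / b)"
      by (intro continuous_intros) (use b in auto)
    fix t assume "t \<in> {0<..<S}"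
    then have t: "0 < t" by simp
    have "((\<lambda>t. c * t powr b) has_real_derivative c * (b * t powr (b - 1))) (at t)"
      using t by (auto intro!: derivative_eq_intros)
    from DERIV_chain2[OF DERIV_Si this]
    have "((\<lambda>t. Si (c * t powr b) / b) has_real_derivative sinc (c * t powr b) * (c * (b * t powr (b - 1))) / b) (at t)"
      by (rule DERIV_cdivide)
    also have "sinc (c * t powr b) * (c * (b * t powr (b - 1))) / b = sin (c * t powr b) / t"
      using t b powr_mult_base[of t "b - 1"] by (cases "c = 0") (auto simp: field_simps)
    finally show "((\<lambda>t. Si (c * t powr b) / b) has_vector_derivative sin (c * t powr b) / t) (at t)"
      by (simp add: has_real_derivative_iff_has_vector_derivative)
  qed
  then show ?thesis using b Si0 by simp
qed

text \<open>The phase \<theta> enters through a two-dimensional space of functions, so convergence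
  at the phases 0 and \<open>pi / 2\<close> is convergence uniformly in \<theta>.\<close>

lemma osc_diff_linear:
  assumes "1 \<le> b"
  shows "integral {0..R} (osc_diff b \<theta> \<alpha>\<^sub>1 \<beta>\<^sub>1 \<alpha>\<^sub>2 \<beta>\<^sub>2)
    = cos \<theta> * integral {0..R} (osc_diff b 0 \<alpha>\<^sub>1 \<beta>\<^sub>1 \<alpha>\<^sub>2 \<beta>\<^sub>2)
    + sin \<theta> * integral {0..R} (osc_diff b (pi / 2) \<alpha>\<^sub>1 \<beta>\<^sub>1 \<alpha>\<^sub>2 \<beta>\<^sub>2)"
proof -
  have c: "cos (\<theta> - x - y) = cos \<theta> * cos (0 - x - y) + sin \<theta> * cos (pi / 2 - x - y)" for x y :: real
    using cos_diff[of \<theta> "x + y"] cos_diff[of "pi / 2" "x + y"] cos_minus[of "x + y"]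
    by (simp add: diff_diff_eq del: cos_minus)
  have d: "(p * x + q * y - (p * x' + q * y')) / t = p * ((x - x') / t) + q * ((y - y') / t)" for p q x y x' y' t :: real
    by (simp add: diff_divide_distrib add_divide_distrib right_diff_distrib)
  have "osc_diff b \<theta> \<alpha>\<^sub>1 \<beta>\<^sub>1 \<alpha>\<^sub>2 \<beta>\<^sub>2 = (\<lambda>t. cos \<theta> * osc_diff b 0 \<alpha>\<^sub>1 \<beta>\<^sub>1 \<alpha>\<^sub>2 \<beta>\<^sub>2 t + sin \<theta> * osc_diff b (pi / 2) \<alpha>\<^sub>1 \<beta>\<^sub>1 \<alpha>\<^sub>2 \<beta>\<^sub>2 t)"
    unfolding osc_diff_def c[of "_ * _"] d ..
  then show ?thesis
    using integral_unique[OF has_integral_add[OF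
        has_integral_mult_right[OF integrable_integral[OF osc_diff_integrable[OF assms]]]
        has_integral_mult_right[OF integrable_integral[OF osc_diff_integrable[OF assms]]]]]
    by simp
qed

text \<open>At \<kappa> = 0 the integral up to S is \<open>2 * sin \<theta> * Si S\<close>, close to
  \<open>pi * sin \<theta>\<close>. The cutoff S can be fixed before \<kappa>: the linear
  coefficients 1 and -1 already make the tail beyond S small whatever the curve coefficients are,
  and on \<open>{0..S}\<close> the latter cost only a multiple of \<kappa>.\<close>

lemma osc_diff_small_limit:
  fixes b cp cm \<epsilon> :: real
  assumes b: "1 < b" and \<epsilon>: "0 < \<epsilon>"
  shows "\<exists>\<kappa>\<^sub>0>0. \<forall>\<kappa>. 0 \<le> \<kappa> \<and> \<kappa> \<le> \<kappa>\<^sub>0 \<longrightarrow>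
     (\<forall>\<^sub>F R in at_top. \<forall>\<theta>. \<bar>integral {0..R} (osc_diff b \<theta> 1 (\<kappa> * cp) (- 1) (\<kappa> * cm)) - pi * sin \<theta>\<bar> \<le> \<epsilon>)"
proof -
  have "0 < \<epsilon> / 8" using \<epsilon> by simp
  then obtain W where W: "0 < W" and
    tail: "\<forall>\<alpha> \<beta> \<delta> a R. 0 < a \<and> a \<le> R \<and> W \<le> \<bar>\<alpha>\<bar> * a + b * \<bar>\<beta>\<bar> * a powr b \<longrightarrow>
           \<bar>integral {a..R} (\<lambda>t. cos (\<alpha> * t + \<beta> * t powr b + \<delta>) / t)\<bar> \<le> \<epsilon> / 8" by (rule oscillatory_tail_small[OF b])
  have "eventually (\<lambda>S. dist (Si S) (pi / 2) < \<epsilon> / 8) at_top"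
    by (intro tendstoD[OF Si_at_top]) (use \<epsilon> in simp)
  then have "eventually (\<lambda>S. dist (Si S) (pi / 2) < \<epsilon> / 8 \<and> W \<le> S) at_top"
    by (intro eventually_conj eventually_ge_at_top)
  then obtain S where S: "\<bar>Si S - pi / 2\<bar> < \<epsilon> / 8" "W \<le> S"
    by (metis (no_types, lifting) dist_real_def eventually_happens' trivial_limit_at_top_linorder)
  have S0: "0 < S" using S W by simp
  have main: "integral {0..S} (osc_diff b \<theta> 1 0 (- 1) 0) = 2 * sin \<theta> * Si S" for \<theta>
  proof -
    have "integral {0..S} (osc_diff b \<theta> 1 0 (- 1) 0) = integral {0..S} (\<lambda>t. (2 * sin \<theta>) * (sin (1 * t powr 1) / t))"
      by (rule integral_cong) (auto simp: osc_diff_def cos_diff cos_add)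
    also have "\<dots> = (2 * sin \<theta>) * (Si (1 * S powr 1) / 1)"
      using integral_sin_powr_over[of 1 S 1] S0 by (intro integral_unique has_integral_mult_right) auto
    finally show ?thesis using S0 by simp
  qed
  define D where "D = (\<bar>cp\<bar> + \<bar>cm\<bar>) * S powr b + 1"
  have D: "0 < D" by (simp add: D_def add_nonneg_pos)
  have "\<bar>integral {0..R} (osc_diff b \<theta> 1 (\<kappa> * cp) (- 1) (\<kappa> * cm)) - pi * sin \<theta>\<bar> \<le> \<epsilon>"
    if \<kappa>: "0 \<le> \<kappa>" "\<kappa> \<le> (\<epsilon> / 4) / D" and R: "S \<le> R" for \<kappa> R \<theta>
  proof -
    have Wl: "W \<le> \<bar>\<alpha>\<bar> * S + b * \<bar>\<beta>\<bar> * S powr b" if "\<bar>\<alpha>\<bar> = 1" for \<alpha> \<beta> :: real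
    proof -
      have "0 \<le> b * \<bar>\<beta>\<bar> * S powr b" using b by simp
      then show ?thesis using S that by simp
    qed
    have t: "\<bar>integral {0..R} (osc_diff b \<theta> 1 (\<kappa> * cp) (- 1) (\<kappa> * cm)) - integral {0..S} (osc_diff b \<theta> 1 (\<kappa> * cp) (- 1) (\<kappa> * cm))\<bar> \<le> 2 * (\<epsilon> / 8)"
      by (rule osc_diff_tail[OF b S0 R tail]) (use Wl[of 1] Wl[of "- 1"] in auto)
    have "\<bar>integral {0..S} (osc_diff b \<theta> 1 (\<kappa> * cp) (- 1) (\<kappa> * cm)) - integral {0..S} (osc_diff b \<theta> 1 0 (- 1) 0)\<bar>
        \<le> (\<bar>1 - 1\<bar> + \<bar>- 1 - - 1\<bar>) * S + (\<bar>\<kappa> * cp - 0\<bar> + \<bar>\<kappa> * cm - 0\<bar>) * S powr b"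
      by (rule osc_diff_perturb) (use b S0 in auto)
    also have "\<dots> = \<kappa> * ((\<bar>cp\<bar> + \<bar>cm\<bar>) * S powr b)"
      using \<kappa> by (simp add: abs_mult algebra_simps)
    also have "\<dots> \<le> \<kappa> * D" using \<kappa> by (intro mult_left_mono) (auto simp: D_def)
    also have "\<dots> \<le> \<epsilon> / 4" using \<kappa> D by (simp add: field_simps)
    finally have p: "\<bar>integral {0..S} (osc_diff b \<theta> 1 (\<kappa> * cp) (- 1) (\<kappa> * cm)) - 2 * sin \<theta> * Si S\<bar> \<le> \<epsilon> / 4"
      by (simp only: main)
    have "\<bar>2 * sin \<theta> * Si S - pi * sin \<theta>\<bar> = 2 * (\<bar>sin \<theta>\<bar> * \<bar>Si S - pi / 2\<bar>)"
    proof -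
      have "2 * sin \<theta> * Si S - pi * sin \<theta> = 2 * (sin \<theta> * (Si S - pi / 2))"
        by (simp add: algebra_simps)
      then show ?thesis by (simp add: abs_mult)
    qed
    also have "\<dots> \<le> 2 * (1 * (\<epsilon> / 8))" using S by (intro mult_left_mono mult_mono) auto
    finally show ?thesis using t p \<epsilon> by linarith
  qed
  then have "\<forall>\<^sub>F R in at_top. \<forall>\<theta>. \<bar>integral {0..R} (osc_diff b \<theta> 1 (\<kappa> * cp) (- 1) (\<kappa> * cm)) - pi * sin \<theta>\<bar> \<le> \<epsilon>"
    if "0 \<le> \<kappa>" "\<kappa> \<le> (\<epsilon> / 4) / D" for \<kappa>
    using that by (intro eventually_mono[OF eventually_ge_at_top[of S]]) blast
  then show ?thesis using D \<epsilon> by (intro exI[of _ "(\<epsilon> / 4) / D"]) auto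
qed

lemma Si_scaled_limit:
  fixes b c :: real
  assumes "0 < b" "c \<noteq> 0"
  shows "(\<lambda>n. Si (c * real n powr b)) \<longlonglongrightarrow> sgn c * (pi / 2)"
proof -
  have "(\<lambda>n. sgn c * Si (\<bar>c\<bar> * real n powr b)) \<longlonglongrightarrow> sgn c * (pi / 2)"
  proof (intro tendsto_mult tendsto_const filterlim_compose[OF Si_at_top])
    have "filterlim (\<lambda>n. real n powr b) at_top sequentially"
      by (rule filterlim_compose[OF real_powr_at_top filterlim_real_sequentially]) (use assms in auto)
    then show "filterlim (\<lambda>n. \<bar>c\<bar> * real n powr b) at_top sequentially"
      using assms by (intro filterlim_tendsto_pos_mult_at_top[OF tendsto_const]) auto
  qed
  moreover have "sgn c * Si (\<bar>c\<bar> * real n powr b) = Si (c * real n powr b)" for n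
  proof (cases "c > 0")
    case False
    then have "\<bar>c\<bar> = - c" "sgn c = - 1" using assms by auto
    then show ?thesis using Si_neg[of "- c * real n powr b"] False by (simp add: mult_nonpos_nonneg)
  qed auto
  ultimately show ?thesis by simp
qed


text \<open>Dilating by \<open>\<kappa> powr (- (1 / b))\<close> restores the curve coefficients to
  \<open>cp\<close>, \<open>cm\<close> and makes the linear ones small, so the limit is the integral
  with pure power phases. Its cosine part \<open>A\<^sub>1\<close> is obtained from the Cauchy
  criterion. Its sine part is explicit, a difference of two values of sign times
  \<open>pi / (2 * b)\<close>, whence the bound \<open>pi / b\<close>.\<close>

lemma osc_diff_large_limit:
  fixes b cp cm :: real
  assumes b: "1 < b" and cp: "cp \<noteq> 0" and cm: "cm \<noteq> 0"
  shows "\<exists>A\<^sub>1 A\<^sub>2. \<bar>A\<^sub>2\<bar> \<le> pi / b \<and> (\<forall>\<epsilon>>0. \<exists>\<kappa>\<^sub>1>0. \<forall>\<kappa>\<ge>\<kappa>\<^sub>1.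
     (\<forall>\<^sub>F R in at_top. \<forall>\<theta>. \<bar>integral {0..R} (osc_diff b \<theta> 1 (\<kappa> * cp) (- 1) (\<kappa> * cm)) - (A\<^sub>1 * cos \<theta> + A\<^sub>2 * sin \<theta>)\<bar> \<le> \<epsilon>))"
proof -
  define \<Psi> where "\<Psi> = (\<lambda>\<theta> R. integral {0..R} (osc_diff b \<theta> 0 cp 0 cm))"
  have b1: "1 \<le> b" using b by simp
  have big: "\<forall>\<^sub>F n in sequentially. W \<le> \<bar>0\<bar> * real n + b * \<bar>c\<bar> * real n powr b" if "c \<noteq> 0" for c W :: real
  proof -
    have "filterlim (\<lambda>n. real n powr b) at_top sequentially"
      by (rule filterlim_compose[OF real_powr_at_top filterlim_real_sequentially]) (use b in auto)
    then have "filterlim (\<lambda>n. (b * \<bar>c\<bar>) * real n powr b) at_top sequentially"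
      using that b by (intro filterlim_tendsto_pos_mult_at_top[OF tendsto_const]) auto
    then show ?thesis by (simp add: filterlim_at_top)
  qed
  have "Cauchy (\<lambda>n. \<Psi> 0 (real n))"
  proof (rule CauchyI')
    fix e :: real assume "0 < e"
    then have "0 < e / 4" by simp
    then obtain W where W: "0 < W" and
    tail: "\<forall>\<alpha> \<beta> \<delta> a R. 0 < a \<and> a \<le> R \<and> W \<le> \<bar>\<alpha>\<bar> * a + b * \<bar>\<beta>\<bar> * a powr b \<longrightarrow>
           \<bar>integral {a..R} (\<lambda>t. cos (\<alpha> * t + \<beta> * t powr b + \<delta>) / t)\<bar> \<le> e / 4" by (rule oscillatory_tail_small[OF b])
    have "\<forall>\<^sub>F n in sequentially. W \<le> \<bar>0\<bar> * real n + b * \<bar>cp\<bar> * real n powr b \<and> W \<le> \<bar>0\<bar> * real n + b * \<bar>cm\<bar> * real n powr b \<and> 1 \<le> n"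
      by (intro eventually_conj big cp cm eventually_ge_at_top)
    then obtain N where N: "\<And>n. N \<le> n \<Longrightarrow> W \<le> \<bar>0\<bar> * real n + b * \<bar>cp\<bar> * real n powr b \<and> W \<le> \<bar>0\<bar> * real n + b * \<bar>cm\<bar> * real n powr b \<and> 1 \<le> n"
      by (auto simp: eventually_sequentially)
    have "dist (\<Psi> 0 (real m)) (\<Psi> 0 (real n)) < e" if "N \<le> m" "m < n" for m n
    proof -
      have "\<bar>\<Psi> 0 (real n) - \<Psi> 0 (real m)\<bar> \<le> 2 * (e / 4)"
        unfolding \<Psi>_def by (rule osc_diff_tail[OF b _ _ tail]) (use that N[of m] in auto)
      then show ?thesis using \<open>0 < e\<close> by (simp add: dist_real_def abs_minus_commute)
    qed
    then show "\<exists>M. \<forall>m\<ge>M. \<forall>n>m. dist (\<Psi> 0 (real m)) (\<Psi> 0 (real n)) < e"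
      by blast
  qed
  then obtain A\<^sub>1 where A1: "(\<lambda>n. \<Psi> 0 (real n)) \<longlonglongrightarrow> A\<^sub>1"
    using Cauchy_convergent_iff convergent_def by blast
  have \<Psi>s: "\<Psi> (pi / 2) (real n) = (Si (cp * real n powr b) - Si (cm * real n powr b)) / b" for n
  proof -
    have c: "cos (pi / 2 - 0 * x - y) = sin y" for x y :: real by (simp add: cos_diff)
    have "osc_diff b (pi / 2) 0 cp 0 cm = (\<lambda>t. sin (cp * t powr b) / t - sin (cm * t powr b) / t)"
      unfolding osc_diff_def c by (simp add: diff_divide_distrib)
    moreover have "((\<lambda>t. sin (cp * t powr b) / t - sin (cm * t powr b) / t) has_integral
        Si (cp * real n powr b) / b - Si (cm * real n powr b) / b) {0..real n}"
      using b by (intro has_integral_diff integral_sin_powr_over) auto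
    ultimately show ?thesis by (simp add: \<Psi>_def integral_unique diff_divide_distrib)
  qed
  define A\<^sub>2 where "A\<^sub>2 = (sgn cp * (pi / 2) - sgn cm * (pi / 2)) / b"
  have A2: "(\<lambda>n. \<Psi> (pi / 2) (real n)) \<longlonglongrightarrow> A\<^sub>2"
    unfolding \<Psi>s A\<^sub>2_def using b cp cm by (intro tendsto_intros Si_scaled_limit) auto
  have A2b: "\<bar>A\<^sub>2\<bar> \<le> pi / b"
  proof -
    have "\<bar>sgn cp * (pi / 2) - sgn cm * (pi / 2)\<bar> \<le> pi"
      using cp cm pi_gt_zero by (auto simp: sgn_if)
    then show ?thesis using b by (simp add: A\<^sub>2_def divide_right_mono)
  qed
  have "\<exists>\<kappa>\<^sub>1>0. \<forall>\<kappa>\<ge>\<kappa>\<^sub>1. (\<forall>\<^sub>F R in at_top. \<forall>\<theta>. \<bar>integral {0..R} (osc_diff b \<theta> 1 (\<kappa> * cp) (- 1) (\<kappa> * cm)) - (A\<^sub>1 * cos \<theta> + A\<^sub>2 * sin \<theta>)\<bar> \<le> \<epsilon>)"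
    if \<epsilon>: "0 < \<epsilon>" for \<epsilon>
  proof -
    have "0 < \<epsilon> / 8" using \<epsilon> by simp
    then obtain W where W: "0 < W" and
    tail: "\<forall>\<alpha> \<beta> \<delta> a R. 0 < a \<and> a \<le> R \<and> W \<le> \<bar>\<alpha>\<bar> * a + b * \<bar>\<beta>\<bar> * a powr b \<longrightarrow>
           \<bar>integral {a..R} (\<lambda>t. cos (\<alpha> * t + \<beta> * t powr b + \<delta>) / t)\<bar> \<le> \<epsilon> / 8" by (rule oscillatory_tail_small[OF b])
    have "\<forall>\<^sub>F n in sequentially. (W \<le> \<bar>0\<bar> * real n + b * \<bar>cp\<bar> * real n powr b \<and> W \<le> \<bar>0\<bar> * real n + b * \<bar>cm\<bar> * real n powr b)
       \<and> 1 \<le> n \<and> dist (\<Psi> 0 (real n)) A\<^sub>1 < \<epsilon> / 8 \<and> dist (\<Psi> (pi / 2) (real n)) A\<^sub>2 < \<epsilon> / 8"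
      using \<epsilon> by (intro eventually_conj big cp cm eventually_ge_at_top tendstoD[OF A1] tendstoD[OF A2]) auto
    then obtain N where N: "W \<le> b * \<bar>cp\<bar> * real N powr b" "W \<le> b * \<bar>cm\<bar> * real N powr b" "1 \<le> N"
       "\<bar>\<Psi> 0 (real N) - A\<^sub>1\<bar> < \<epsilon> / 8" "\<bar>\<Psi> (pi / 2) (real N) - A\<^sub>2\<bar> < \<epsilon> / 8"
      by (auto simp: eventually_sequentially dist_real_def)
    define S where "S = real N"
    have S: "1 \<le> S" using N by (simp add: S_def)
    \<comment> \<open>This threshold makes \<open>r * S\<close> at most
      \<open>\<epsilon> / 8\<close>; dropping both linear terms on \<open>{0..r * S}\<close> then
      costs at most \<open>\<epsilon> / 4\<close>.\<close>
    define \<kappa>\<^sub>1 where "\<kappa>\<^sub>1 = max 1 ((8 * S / \<epsilon>) powr b)"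
    have "\<bar>integral {0..R} (osc_diff b \<theta> 1 (\<kappa> * cp) (- 1) (\<kappa> * cm)) - (A\<^sub>1 * cos \<theta> + A\<^sub>2 * sin \<theta>)\<bar> \<le> \<epsilon>"
      if \<kappa>: "\<kappa>\<^sub>1 \<le> \<kappa>" and R: "S \<le> R" for \<kappa> R \<theta>
    proof -
      have \<kappa>1: "1 \<le> \<kappa>" "(8 * S / \<epsilon>) powr b \<le> \<kappa>" using \<kappa> by (auto simp: \<kappa>\<^sub>1_def)
      define r where "r = \<kappa> powr (- (1 / b))"
      have r0: "0 < r" using \<kappa>1 by (simp add: r_def)
      have rb: "r powr b * \<kappa> = 1" unfolding r_def powr_powr using \<kappa>1 b by (simp add: powr_neg_one)
      have r1: "r \<le> 1" unfolding r_def using \<kappa>1 b powr_mono[of "- (1 / b)" 0 \<kappa>] by simp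
      have "8 * S / \<epsilon> = ((8 * S / \<epsilon>) powr b) powr (1 / b)" using S \<epsilon> b by (simp add: powr_powr)
      also have "\<dots> \<le> \<kappa> powr (1 / b)" using \<kappa>1 b by (intro powr_mono2) auto
      also have "\<dots> = 1 / r" using \<kappa>1 by (simp add: r_def powr_minus_divide)
      finally have rS: "r * S \<le> \<epsilon> / 8" using r0 \<epsilon> by (simp add: field_simps)
      have "r * S \<le> 1 * S" using r1 S by (intro mult_right_mono) auto
      with R have "r * S \<le> R" by linarith
      moreover have "0 < r * S" using r0 S by simp
      ultimately have rSR: "0 < r * S" "r * S \<le> R" by auto
      \<comment> \<open>The power part of the tail condition is invariant under the dilation: the
        coefficient \<kappa> at the cutoff \<open>r * S\<close> has the same effect as the
        coefficient 1 at S.\<close>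
      have Sw: "\<kappa> * (r * S) powr b = S powr b" 
      proof -
        have "\<kappa> * (r * S) powr b = (r powr b * \<kappa>) * S powr b" using r0 S by (simp add: powr_mult)
        then show ?thesis by (simp add: rb)
      qed
      have Wl: "W \<le> \<bar>\<alpha>\<bar> * (r * S) + b * \<bar>\<kappa> * c\<bar> * (r * S) powr b" if "W \<le> b * \<bar>c\<bar> * S powr b" for c \<alpha>
      proof -
        have "b * \<bar>\<kappa> * c\<bar> * (r * S) powr b = b * \<bar>c\<bar> * (\<kappa> * (r * S) powr b)" using \<kappa>1 by (simp add: abs_mult)
        also have "\<dots> = b * \<bar>c\<bar> * S powr b" unfolding Sw ..
        finally have "W \<le> b * \<bar>\<kappa> * c\<bar> * (r * S) powr b" using that by linarith
        moreover have "0 \<le> \<bar>\<alpha>\<bar> * (r * S)" using rSR by simp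
        ultimately show ?thesis by linarith
      qed
      have t: "\<bar>integral {0..R} (osc_diff b \<theta> 1 (\<kappa> * cp) (- 1) (\<kappa> * cm)) - integral {0..r * S} (osc_diff b \<theta> 1 (\<kappa> * cp) (- 1) (\<kappa> * cm))\<bar> \<le> 2 * (\<epsilon> / 8)"
        by (rule osc_diff_tail[OF b rSR tail]) (use Wl[of cp 1] Wl[of cm "- 1"] N in \<open>auto simp: S_def\<close>)
      have "\<bar>integral {0..r * S} (osc_diff b \<theta> 1 (\<kappa> * cp) (- 1) (\<kappa> * cm)) - integral {0..r * S} (osc_diff b \<theta> 0 (\<kappa> * cp) 0 (\<kappa> * cm))\<bar>
          \<le> (\<bar>1 - 0\<bar> + \<bar>- 1 - 0\<bar>) * (r * S) + (\<bar>\<kappa> * cp - \<kappa> * cp\<bar> + \<bar>\<kappa> * cm - \<kappa> * cm\<bar>) * (r * S) powr b"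
        by (rule osc_diff_perturb[OF b1 rSR(1)])
      also have "\<dots> \<le> \<epsilon> / 4" using rS by simp
      also have "integral {0..r * S} (osc_diff b \<theta> 0 (\<kappa> * cp) 0 (\<kappa> * cm)) = \<Psi> \<theta> S"
        unfolding \<Psi>_def using osc_diff_scale[OF b1 r0, of S \<theta> 0 "\<kappa> * cp" 0 "\<kappa> * cm"] S rb
        by (simp add: mult.assoc[symmetric])
      finally have p: "\<bar>integral {0..r * S} (osc_diff b \<theta> 1 (\<kappa> * cp) (- 1) (\<kappa> * cm)) - \<Psi> \<theta> S\<bar> \<le> \<epsilon> / 4" .
      have "\<Psi> \<theta> S = cos \<theta> * \<Psi> 0 S + sin \<theta> * \<Psi> (pi / 2) S"
        unfolding \<Psi>_def by (rule osc_diff_linear[OF b1])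
      then have "\<Psi> \<theta> S - (A\<^sub>1 * cos \<theta> + A\<^sub>2 * sin \<theta>) = cos \<theta> * (\<Psi> 0 S - A\<^sub>1) + sin \<theta> * (\<Psi> (pi / 2) S - A\<^sub>2)"
        by (simp add: algebra_simps)
      also have "\<bar>\<dots>\<bar> \<le> \<bar>cos \<theta>\<bar> * \<bar>\<Psi> 0 S - A\<^sub>1\<bar> + \<bar>sin \<theta>\<bar> * \<bar>\<Psi> (pi / 2) S - A\<^sub>2\<bar>"
        unfolding abs_mult[symmetric] by (rule abs_triangle_ineq)
      also have "\<dots> \<le> 1 * (\<epsilon> / 8) + 1 * (\<epsilon> / 8)"
        using N by (intro add_mono mult_mono) (auto simp: S_def)
      finally show ?thesis using t p by linarith
    qed
    then have "\<forall>\<^sub>F R in at_top. \<forall>\<theta>. \<bar>integral {0..R} (osc_diff b \<theta> 1 (\<kappa> * cp) (- 1) (\<kappa> * cm)) - (A\<^sub>1 * cos \<theta> + A\<^sub>2 * sin \<theta>)\<bar> \<le> \<epsilon>"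
      if "\<kappa>\<^sub>1 \<le> \<kappa>" for \<kappa>
      using that by (intro eventually_mono[OF eventually_ge_at_top[of S]]) blast
    then show ?thesis by (intro exI[of _ \<kappa>\<^sub>1]) (auto simp: \<kappa>\<^sub>1_def)
  qed
  then show ?thesis using A2b by blast
qed

section \<open>Riemann--Lebesgue lemmas\<close>

text \<open>Dynkin's argument. The lower orthants are an intersection-stable generator, complements
  use the integral over the whole space, and in a countable disjoint union the common majorant
  \<open>w\<close> lets the limit pass through the series.\<close>

lemma weakly_null_on_sets:
  fixes k :: "nat \<Rightarrow> 'a::ordered_euclidean_space \<Rightarrow> real"
  assumes k [measurable]: "\<And>n. k n \<in> borel_measurable borel"
    and w: "integrable lborel w" and kw: "\<And>n x. \<bar>k n x\<bar> \<le> w x"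
    and base: "\<And>a. (\<lambda>n. LINT x:{..a}|lborel. k n x) \<longlonglongrightarrow> 0"
    and all: "(\<lambda>n. LINT x|lborel. k n x) \<longlonglongrightarrow> 0"
    and A: "A \<in> sets borel"
  shows "(\<lambda>n. LINT x:A|lborel. k n x) \<longlonglongrightarrow> 0"
proof -
  have w0: "0 \<le> w x" for x using kw[of 0 x] by linarith
  have ik: "integrable lborel (k n)" for n
    by (rule Bochner_Integration.integrable_bound[OF w]) (use kw w0 in \<open>auto intro!: AE_I2\<close>)
  have sk: "set_integrable lborel B (k n)" "set_integrable lborel B w" if "B \<in> sets borel" for B n
    unfolding set_integrable_def
    using that ik w integrable_mult_indicator[of B lborel "k n"] integrable_mult_indicator[of B lborel w] by auto
  have sb: "sets (borel :: 'a measure) = sigma_sets UNIV (range (\<lambda>a::'a. {..a}))"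
    by (subst borel_eq_atMost) (simp add: sets_measure_of)
  have "Int_stable (range (\<lambda>a::'a. {..a}))"
  proof (rule Int_stableI_image)
    fix a b :: 'a
    have "{..a} \<inter> {..b} = {..inf a b}" by auto
    then show "\<exists>c\<in>UNIV. {..a} \<inter> {..b} = {..c}" by blast
  qed
  moreover have "range (\<lambda>a::'a. {..a}) \<subseteq> Pow UNIV" by simp
  moreover have "A \<in> sigma_sets UNIV (range (\<lambda>a::'a. {..a}))" using A sb by simp
  ultimately show ?thesis
  proof (induction rule: sigma_sets_induct_disjoint[of "range (\<lambda>a::'a. {..a})" UNIV])
    case (basic B)
    then show ?case using base by auto
  next
    case empty
    show ?case by (simp add: set_lebesgue_integral_def)
  next
    case (compl B)
    have B: "B \<in> sets borel" using compl sb by simp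
    have "(LINT x:UNIV - B|lborel. k n x) = (LINT x|lborel. k n x) - (LINT x:B|lborel. k n x)" for n
    proof -
      have "(LINT x:UNIV|lborel. k n x) = (LINT x:(UNIV - B) \<union> B|lborel. k n x)"
        by (simp add: Un_absorb2 Compl_eq_Diff_UNIV[symmetric])
      also have "\<dots> = (LINT x:UNIV - B|lborel. k n x) + (LINT x:B|lborel. k n x)"
        using B by (intro set_integral_Un sk) (auto intro: borel_comp)
      finally show ?thesis by (simp add: set_lebesgue_integral_def)
    qed
    then show ?case using tendsto_diff[OF all compl(2)] by simp
  next
    case (union B)
    have B: "B i \<in> sets borel" for i using union sb by auto
    have U: "(\<Union>i. B i) \<in> sets borel" using B by auto
    have dj: "B i \<inter> B j = {}" if "i \<noteq> j" for i j
      using union(1) that by (auto simp: disjoint_family_on_def)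
    have eq: "(LINT x:(\<Union>i. B i)|lborel. k n x) = (\<Sum>i. LINT x:B i|lborel. k n x)" for n
      by (rule lebesgue_integral_countable_add) (use B dj sk U in auto)
    have "summable (\<lambda>i. LINT x:B i|lborel. w x)"
    proof (rule summableI_nonneg_bounded)
      show "0 \<le> (LINT x:B i|lborel. w x)" for i
        unfolding set_lebesgue_integral_def using w0 by (intro integral_nonneg_AE) auto
      fix m
      have "(\<Sum>i<m. LINT x:B i|lborel. w x) = (LINT x:(\<Union>i<m. B i)|lborel. w x)"
        by (rule set_integral_finite_Union[symmetric]) (use B dj sk in \<open>auto simp: disjoint_family_on_def\<close>)
      also have "\<dots> \<le> (LINT x|lborel. w x)"
        unfolding set_lebesgue_integral_def using w0 w B
        by (intro integral_mono integrable_mult_indicator) (auto simp: indicator_def)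
      finally show "(\<Sum>i<m. LINT x:B i|lborel. w x) \<le> (LINT x|lborel. w x)" .
    qed
    moreover have "norm (LINT x:B i|lborel. k n x) \<le> (LINT x:B i|lborel. w x)" for i n
      unfolding set_lebesgue_integral_def
      by (rule Bochner_Integration.integral_norm_bound_integral)
         (use sk[OF B[of i]] kw in \<open>auto simp: set_integrable_def indicator_def\<close>)
    ultimately have "(\<lambda>n. \<Sum>i. LINT x:B i|lborel. k n x) \<longlonglongrightarrow> (\<Sum>i. 0)"
      using union(3)
      by (intro tannerys_theorem[where M = "\<lambda>i. LINT x:B i|lborel. w x", THEN conjunct2, THEN conjunct2])
         (auto intro!: always_eventually)
    then show ?case by (simp add: eq)
  qed
qed

text \<open>Approximation in L^1: from indicators to linear combinations to limits. Since the
  kernels are bounded by 1, replacing h by an approximation changes every integral by at most the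
  L^1 distance, uniformly in n.\<close>

lemma weakly_null_on_functions:
  fixes k :: "nat \<Rightarrow> 'a::ordered_euclidean_space \<Rightarrow> real" and h :: "'a \<Rightarrow> real"
  assumes k [measurable]: "\<And>n. k n \<in> borel_measurable borel"
    and w: "integrable lborel w" and kw: "\<And>n x. \<bar>k n x\<bar> \<le> w x" and w1: "\<And>x. w x \<le> 1"
    and base: "\<And>a. (\<lambda>n. LINT x:{..a}|lborel. k n x) \<longlonglongrightarrow> 0"
    and all: "(\<lambda>n. LINT x|lborel. k n x) \<longlonglongrightarrow> 0"
    and h: "integrable lborel h"
  shows "(\<lambda>n. LINT x|lborel. h x * k n x) \<longlonglongrightarrow> 0"
  using h
proof (induction rule: integrable_induct)
  have k1: "\<bar>k n x\<bar> \<le> 1" for n x using kw[of n x] w1[of x] by linarith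
  have ig: "integrable lborel (\<lambda>x. g x * k n x)" if "integrable lborel g" for g :: "'a \<Rightarrow> real" and n
    by (rule Bochner_Integration.integrable_bound[OF that])
       (use that k1 in \<open>auto simp: abs_mult mult_left_le intro!: AE_I2\<close>)
  {
    case (base A c)
    have "(\<lambda>n. c * (LINT x:A|lborel. k n x)) \<longlonglongrightarrow> c * 0"
      using base by (intro tendsto_mult tendsto_const weakly_null_on_sets[OF k w kw assms(5) all]) auto
    moreover have "c * (LINT x:A|lborel. k n x) = (LINT x|lborel. (indicator A x *\<^sub>R c) * k n x)" for n
      unfolding set_lebesgue_integral_def by (subst integral_mult_right_zero[symmetric]) (simp add: ac_simps)
    ultimately show ?case by simp
  next
    case (add f g)
    then have "(LINT x|lborel. (f x + g x) * k n x) = (LINT x|lborel. f x * k n x) + (LINT x|lborel. g x * k n x)" for n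
      by (simp add: distrib_right ig)
    then show ?case using tendsto_add[OF add(3,4)] by simp
  next
    case (lim f s)
    have "(\<lambda>i. LINT x|lborel. \<bar>s i x - f x\<bar>) \<longlonglongrightarrow> (LINT x|(lborel::'a measure). 0)"
    proof (rule integral_dominated_convergence[where w = "\<lambda>x. 3 * \<bar>f x\<bar>"])
      show "AE x in lborel. (\<lambda>i. \<bar>s i x - f x\<bar>) \<longlonglongrightarrow> 0"
        using lim(2) by (auto intro!: AE_I2 tendsto_rabs_zero LIM_zero)
      show "AE x in lborel. norm \<bar>s i x - f x\<bar> \<le> 3 * \<bar>f x\<bar>" for i
      proof (rule AE_I2)
        fix x
        have "norm (s i x) \<le> 2 * norm (f x)" using lim(3)[of x i] by simp
        then show "norm \<bar>s i x - f x\<bar> \<le> 3 * \<bar>f x\<bar>" by simp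
      qed
    qed (use lim in \<open>auto intro!: integrable_abs\<close>)
    then have L1: "(\<lambda>i. LINT x|lborel. \<bar>s i x - f x\<bar>) \<longlonglongrightarrow> 0" by simp
    show ?case
    proof (rule LIMSEQ_I)
      fix r :: real assume r: "0 < r"
      then obtain i where i: "(LINT x|lborel. \<bar>s i x - f x\<bar>) < r / 2"
        using LIMSEQ_D[OF L1, of "r / 2"] by (auto dest!: spec[of _ "_::nat"] simp: abs_less_iff)
      obtain N where N: "\<And>n. N \<le> n \<Longrightarrow> \<bar>LINT x|lborel. s i x * k n x\<bar> < r / 2"
        using LIMSEQ_D[OF lim(5), of "r / 2" i] r by auto
      have "norm ((LINT x|lborel. f x * k n x) - 0) < r" if "N \<le> n" for n
      proof -
        have "(LINT x|lborel. s i x * k n x) - (LINT x|lborel. f x * k n x) = (LINT x|lborel. (s i x - f x) * k n x)"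
          using lim by (simp add: left_diff_distrib ig)
        also have "\<bar>\<dots>\<bar> \<le> (LINT x|lborel. \<bar>s i x - f x\<bar>)"
          unfolding real_norm_def[symmetric]
        proof (rule Bochner_Integration.integral_norm_bound_integral)
          show "integrable lborel (\<lambda>x. (s i x - f x) * k n x)" using lim by (intro ig) auto
          show "integrable lborel (\<lambda>x. norm (s i x - f x))" using lim by auto
          show "norm ((s i x - f x) * k n x) \<le> norm (s i x - f x)" for x
            using k1[of n x] by (simp add: abs_mult mult_left_le)
        qed
        finally show ?thesis using N[OF that] i by simp
      qed
      then show "\<exists>no. \<forall>n\<ge>no. norm ((LINT x|lborel. f x * k n x) - 0) < r" by blast
    qed
  }
qed

lemma integral_cos_affine_bound:
  fixes \<mu> c m :: real
  assumes "0 < \<mu>" "0 \<le> m"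
  shows "\<bar>integral {0..m} (\<lambda>x. cos (\<mu> * x + c))\<bar> \<le> 2 / \<mu>"
proof -
  have "((\<lambda>x. cos (\<mu> * x + c)) has_integral sin (\<mu> * m + c) / \<mu> - sin (\<mu> * 0 + c) / \<mu>) {0..m}"
  proof (rule fundamental_theorem_of_calculus[OF assms(2)])
    fix x assume "x \<in> {0..m}"
    have "((\<lambda>x. sin (\<mu> * x + c) / \<mu>) has_real_derivative cos (\<mu> * x + c)) (at x)"
      using assms by (auto intro!: derivative_eq_intros)
    then show "((\<lambda>x. sin (\<mu> * x + c) / \<mu>) has_vector_derivative cos (\<mu> * x + c)) (at x within {0..m})"
      using has_field_derivative_at_within has_real_derivative_iff_has_vector_derivative by metis
  qed
  then have "integral {0..m} (\<lambda>x. cos (\<mu> * x + c)) = sin (\<mu> * m + c) / \<mu> - sin (\<mu> * 0 + c) / \<mu>"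
    by (rule integral_unique)
  also have "\<bar>\<dots>\<bar> \<le> \<bar>sin (\<mu> * m + c)\<bar> / \<mu> + \<bar>sin (\<mu> * 0 + c)\<bar> / \<mu>"
    using assms by (intro order_trans[OF abs_triangle_ineq4]) simp
  also have "\<dots> \<le> 1 / \<mu> + 1 / \<mu>"
    using assms by (intro add_mono divide_right_mono) auto
  finally show ?thesis by simp
qed

text \<open>The common support of all test functions. Its measure 1 lets moments and Jensen-type
  arguments run without constants, its openness gives local constancy of cells, and a shift of the
  first coordinate by at least 1 leads out of it, which ends all integrals at t = 1.\<close>

definition usq :: "(real \<times> real) set" where "usq = {0<..<1} \<times> {0<..<1}"

lemma usq_props: "open usq" "usq \<in> sets borel" "emeasure lborel usq = 1" "measure lborel usq = 1"
proof -
  show o: "open usq" unfolding usq_def by (intro open_Times) auto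
  then show "usq \<in> sets borel" by auto
  have "emeasure (lborel \<Otimes>\<^sub>M lborel) ({0<..<1::real} \<times> {0<..<1::real}) = 1"
    by (subst lborel.emeasure_pair_measure_Times) auto
  then show "emeasure lborel usq = 1" unfolding usq_def by (simp add: lborel_prod)
  then show "measure lborel usq = 1" by (simp add: measure_def)
qed

lemma integrable_bounded_usq:
  fixes g :: "real \<times> real \<Rightarrow> real"
  assumes [measurable]: "g \<in> borel_measurable borel" and "\<And>x. x \<in> usq \<Longrightarrow> \<bar>g x\<bar> \<le> B"
  shows "integrable lborel (\<lambda>x. indicator usq x * g x)"
proof (rule integrableI_bounded_set[where A = usq and B = B])
  show "AE x in lborel. x \<in> usq \<longrightarrow> norm (indicator usq x * g x) \<le> B" using assms by auto
qed (use usq_props in auto)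

text \<open>Only the first frequency has to grow. Integrating in the first variable gives at most
  \<open>2 / \<mu> n\<close> on a box, whatever \<open>\<nu> n * snd x + \<delta> n\<close> is, so
  the second frequency and the shift may depend on n arbitrarily.\<close>

lemma riemann_lebesgue_usq:
  fixes h :: "real \<times> real \<Rightarrow> real"
  assumes h: "h \<in> borel_measurable borel" "\<And>x. x \<in> usq \<Longrightarrow> \<bar>h x\<bar> \<le> B"
    and \<mu>: "filterlim \<mu> at_top sequentially"
  shows "(\<lambda>n. LINT x|lborel. indicator usq x * (h x * cos (\<mu> n * fst x + \<nu> n * snd x + \<delta> n))) \<longlonglongrightarrow> 0"
proof -
  define k where "k = (\<lambda>n x. indicator usq x * cos (\<mu> n * fst x + \<nu> n * snd x + \<delta> n))"
  have [measurable]: "usq \<in> sets borel" by (rule usq_props)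
  have km: "k n \<in> borel_measurable borel" for n
    unfolding k_def
    by (rule borel_measurable_times) (auto intro!: borel_measurable_continuous_onI continuous_intros)
  have set1: "\<bar>LINT x:{0<..<1} \<inter> {..a}|lborel. cos (m * x + c)\<bar> \<le> 2 / m" if "0 < m" for a m c :: real
  proof -
    define e where "e = max 0 (min 1 a)"
    have "(LINT x:{0<..<1} \<inter> {..a}|lborel. cos (m * x + c)) = (LINT x:{0..e}|lborel. cos (m * x + c))"
    proof (rule set_integral_cong_set)
      show "AE x in lborel. (x \<in> {0..e}) = (x \<in> {0<..<1} \<inter> {..a})"
        using AE_lborel_singleton[of 0] AE_lborel_singleton[of e] AE_lborel_singleton[of 1]
        by eventually_elim (auto simp: e_def)
    qed (auto simp: set_borel_measurable_def)
    also have "\<dots> = integral {0..e} (\<lambda>x. cos (m * x + c))"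
      by (intro set_borel_integral_eq_integral borel_integrable_atLeastAtMost' continuous_intros)
    finally show ?thesis using integral_cos_affine_bound[OF that, of e c] by (simp add: e_def)
  qed
  have box: "\<bar>LINT x|lborel. indicator ({0<..<1} \<inter> {..a1}) (fst x) * indicator ({0<..<1} \<inter> {..a2}) (snd x)
        * cos (m * fst x + v * snd x + c)\<bar> \<le> 2 / m" if m: "0 < m" for m v c a1 a2 :: real
  proof -
    let ?I = "{0<..<1} \<inter> {..a1}" and ?J = "{0<..<1} \<inter> {..a2}"
    let ?f = "\<lambda>x y :: real. indicator ?I x * indicator ?J y * cos (m * x + v * y + c)"
    have [measurable]: "case_prod ?f \<in> borel_measurable (lborel \<Otimes>\<^sub>M lborel)" by measurable
    have "integrable (lborel \<Otimes>\<^sub>M lborel) (case_prod ?f)"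
    proof (rule integrableI_bounded_set[where A = usq and B = 1])
      show "emeasure (lborel \<Otimes>\<^sub>M lborel) usq < \<infinity>" "usq \<in> sets (lborel \<Otimes>\<^sub>M lborel)"
        unfolding lborel_prod using usq_props(2,3) by simp_all
    qed (auto simp: usq_def indicator_def)
    then have "(LINT x|lborel. case_prod ?f x) = (LINT y|lborel. LINT x|lborel. ?f x y)"
      by (simp add: lborel_pair.integral_snd lborel_prod)
    also have "\<dots> = (LINT y|lborel. indicator ?J y * (LINT x:?I|lborel. cos (m * x + (v * y + c))))"
      unfolding set_lebesgue_integral_def
      by (intro Bochner_Integration.integral_cong refl, subst integral_mult_right_zero[symmetric])
         (simp add: ac_simps)
    also have "\<bar>\<dots>\<bar> \<le> (LINT y|lborel. indicator {0<..<1::real} y * (2 / m))"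
      unfolding real_norm_def[symmetric]
    proof (rule order_trans[OF integral_norm_bound integral_mono'])
      show "0 \<le> indicator {0<..<1::real} y * (2 / m)" for y using m by simp
      show "integrable lborel (\<lambda>y. indicator {0<..<1::real} y * (2 / m))"
        by (intro integrable_mult_left) simp
      show "norm (indicator ?J y * (LINT x:?I|lborel. cos (m * x + (v * y + c)))) \<le> indicator {0<..<1::real} y * (2 / m)" for y
        using set1[OF m, of a1 "v * y + c"] m by (auto simp: indicator_def)
    qed
    also have "\<dots> = 2 / m" by simp
    finally show ?thesis by (simp add: case_prod_beta)
  qed
  have lim0: "(\<lambda>n. 2 / \<mu> n) \<longlonglongrightarrow> 0"
    by (intro tendsto_divide_0[OF tendsto_const] filterlim_at_top_imp_at_infinity \<mu>)
  have ev: "\<forall>\<^sub>F n in sequentially. 0 < \<mu> n" using \<mu> by (simp add: filterlim_at_top_dense)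
  have base: "(\<lambda>n. LINT x:{..a}|lborel. k n x) \<longlonglongrightarrow> 0" for a
  proof (rule Lim_null_comparison[OF _ lim0])
    have eq: "(LINT x:{..a}|lborel. k n x) = (LINT x|lborel. indicator ({0<..<1} \<inter> {..fst a}) (fst x)
        * indicator ({0<..<1} \<inter> {..snd a}) (snd x) * cos (\<mu> n * fst x + \<nu> n * snd x + \<delta> n))" for n
      unfolding set_lebesgue_integral_def k_def
      by (intro Bochner_Integration.integral_cong refl) (auto simp: indicator_def usq_def less_eq_prod_def)
    show "\<forall>\<^sub>F n in sequentially. norm (LINT x:{..a}|lborel. k n x) \<le> 2 / \<mu> n"
      using ev by eventually_elim (unfold eq real_norm_def, rule box)
  qed
  have all: "(\<lambda>n. LINT x|lborel. k n x) \<longlonglongrightarrow> 0"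
  proof -
    have "(LINT x|lborel. k n x) = (LINT x:{..(1, 1)}|lborel. k n x)" for n
      unfolding set_lebesgue_integral_def k_def
      by (intro Bochner_Integration.integral_cong refl) (auto simp: indicator_def usq_def less_eq_prod_def)
    then show ?thesis using base[of "(1, 1)"] by simp
  qed
  have "(\<lambda>n. LINT x|lborel. (indicator usq x * h x) * k n x) \<longlonglongrightarrow> 0"
  proof (rule weakly_null_on_functions[OF km, where w = "indicator usq"])
    show "integrable lborel (indicator usq :: _ \<Rightarrow> real)"
      using integrable_bounded_usq[of "\<lambda>_. 1" 1] by simp
    show "integrable lborel (\<lambda>x. indicator usq x * h x)" by (rule integrable_bounded_usq[OF h])
  qed (use base all in \<open>auto simp: k_def indicator_def\<close>)
  moreover have "(indicator usq x * h x) * k n x = indicator usq x * (h x * cos (\<mu> n * fst x + \<nu> n * snd x + \<delta> n))" for n x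
    by (simp add: k_def indicator_def)
  ultimately show ?thesis by simp
qed

section \<open>Principal values and modulated blocks\<close>

definition curve_diff :: "real \<Rightarrow> real \<Rightarrow> real \<Rightarrow> real \<Rightarrow> (real \<times> real \<Rightarrow> real) \<Rightarrow> real \<times> real \<Rightarrow> real \<Rightarrow> real" where
  "curve_diff b cp cm u f x t =
     f (fst x - t, snd x - u * (cp * t powr b)) - f (fst x + t, snd x - u * (cm * t powr b))"

text \<open>The principal value as one Lebesgue integral. Measurability in the point and finite sums
  are treated in this form; \<open>Hpv_eq_Hint\<close> carries them back to \<open>Hpv\<close>,
  where a missing limit would yield the default 0.\<close>

definition Hint :: "real \<Rightarrow> real \<Rightarrow> real \<Rightarrow> real \<Rightarrow> (real \<times> real \<Rightarrow> real) \<Rightarrow> real \<times> real \<Rightarrow> real" where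
  "Hint b cp cm u f x = (LINT t:{0<..}|lborel. curve_diff b cp cm u f x t / t)"

text \<open>Conditions at a single point x under which the principal value is an absolutely
  convergent integral over (0,1). They are imposed pointwise because a block with a sharp cutoff
  satisfies them only where the cutoff does not jump at x.\<close>

definition pv_regular :: "real \<Rightarrow> real \<Rightarrow> real \<Rightarrow> real \<Rightarrow> (real \<times> real \<Rightarrow> real) \<Rightarrow> real \<times> real \<Rightarrow> bool" where
  "pv_regular b cp cm u f x \<longleftrightarrow>
     f \<in> borel_measurable borel \<and> (\<exists>B. \<forall>y. \<bar>f y\<bar> \<le> B) \<and>
     (\<exists>C. \<forall>t>0. \<bar>curve_diff b cp cm u f x t\<bar> \<le> C * t) \<and> (\<forall>t\<ge>1. curve_diff b cp cm u f x t = 0)"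

lemma curve_diff_measurable:
  assumes f: "f \<in> borel_measurable borel"
  shows "(\<lambda>(x, t). curve_diff b cp cm u f x t) \<in> borel_measurable (borel \<Otimes>\<^sub>M borel)"
proof -
  have "(\<lambda>z. f (fst (fst z) + c * snd z, snd (fst z) - u * (d * snd z powr b))) \<in> borel_measurable ((borel :: (real \<times> real) measure) \<Otimes>\<^sub>M (borel :: real measure))" for c d
  proof -
    have m: "(\<lambda>z :: (real \<times> real) \<times> real. fst (fst z)) \<in> borel_measurable (borel \<Otimes>\<^sub>M borel)"
       "(\<lambda>z :: (real \<times> real) \<times> real. snd (fst z)) \<in> borel_measurable (borel \<Otimes>\<^sub>M borel)"
      unfolding borel_prod by (intro borel_measurable_continuous_onI continuous_intros)+
    have "(\<lambda>z. (fst (fst z) + c * snd z, snd (fst z) - u * (d * snd z powr b))) \<in> borel_measurable ((borel :: (real \<times> real) measure) \<Otimes>\<^sub>M (borel :: real measure))"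
      using m by (intro borel_measurable_Pair borel_measurable_add borel_measurable_diff borel_measurable_times powr_real_measurable) auto
    from measurable_compose[OF this f] show ?thesis .
  qed
  from borel_measurable_diff[OF this[of "- 1" cp] this[of 1 cm]] show ?thesis
    unfolding curve_diff_def case_prod_beta by simp
qed

lemma curve_diff_measurable_t:
  assumes f: "f \<in> borel_measurable borel"
  shows "curve_diff b cp cm u f x \<in> borel_measurable borel"
  using measurable_compose[OF measurable_Pair1' curve_diff_measurable[OF f], of x]
  by simp

lemma Hint_measurable:
  assumes f: "f \<in> borel_measurable borel"
  shows "Hint b cp cm u f \<in> borel_measurable borel"
proof -
  have "(\<lambda>x. LINT t|lborel. indicator {0<..} t *\<^sub>R (curve_diff b cp cm u f x t / t)) \<in> borel_measurable borel"
  proof (rule lborel.borel_measurable_lebesgue_integral)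
    have c: "(\<lambda>(x, t). curve_diff b cp cm u f x t) \<in> borel_measurable (borel \<Otimes>\<^sub>M lborel)"
      using curve_diff_measurable[OF f] by (simp cong: measurable_cong_sets)
    have "(\<lambda>z. indicator {0<..} (snd z) *\<^sub>R ((\<lambda>(x, t). curve_diff b cp cm u f x t) z / snd z)) \<in> borel_measurable (borel \<Otimes>\<^sub>M lborel)"
      using c by measurable
    then show "(\<lambda>(x, t). indicator {0<..} t *\<^sub>R (curve_diff b cp cm u f x t / t)) \<in> borel_measurable (borel \<Otimes>\<^sub>M lborel)"
      by (simp add: case_prod_beta)
  qed
  then show ?thesis unfolding Hint_def[abs_def] set_lebesgue_integral_def .
qed

lemma Htrunc_eq:
  assumes f: "f \<in> borel_measurable borel" and B: "\<And>y. \<bar>f y\<bar> \<le> B" and e: "0 < eps" "eps < R"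
  shows "Htrunc b cp cm u f eps R x = (LINT t:{eps<..<R}|lborel. curve_diff b cp cm u f x t / t)"
proof -
  define F where "F = (\<lambda>t. f (fst x - t, snd x - u * gammab b cp cm t) / t)"
  have gm: "gammab b cp cm \<in> borel_measurable borel" unfolding gammab_def by measurable
  have "(\<lambda>t. (fst x - t, snd x - u * gammab b cp cm t)) \<in> borel_measurable borel"
    using gm by (intro borel_measurable_Pair borel_measurable_diff borel_measurable_times) auto
  from measurable_compose[OF this f] have Fm [measurable]: "F \<in> borel_measurable borel"
    unfolding F_def by (intro borel_measurable_divide) auto
  have B0: "0 \<le> B" using B[of undefined] by linarith
  have Fb: "\<bar>F t\<bar> \<le> B / eps" if "eps < \<bar>t\<bar>" for t
    unfolding F_def abs_divide using B B0 e that by (intro frac_le) auto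
  have i1: "set_integrable lborel {eps<..<R} F"
    by (rule set_integrable_bounded[where a = eps and c = R and C = "B / eps"]) (use Fb e in auto)
  have i2: "set_integrable lborel {-R<..<-eps} F"
    by (rule set_integrable_bounded[where a = "-R" and c = "-eps" and C = "B / eps"]) (use Fb e in auto)
  have i3: "set_integrable lborel {eps<..<R} (\<lambda>t. F (- t))"
    by (rule set_integrable_bounded[where a = eps and c = R and C = "B / eps"]) (use Fb e in auto)
  have "Htrunc b cp cm u f eps R x = (LINT t:{eps<..<R} \<union> {-R<..<-eps}|lborel. F t)"
    unfolding Htrunc_def F_def by (rule arg_cong[where f = "\<lambda>A. set_lebesgue_integral lborel A _"]) (use e in auto)
  also have "\<dots> = (LINT t:{eps<..<R}|lborel. F t) + (LINT t:{-R<..<-eps}|lborel. F t)"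
    by (rule set_integral_Un[OF _ i1 i2]) (use e in auto)
  also have "(LINT t:{-R<..<-eps}|lborel. F t) = (LINT t:{eps<..<R}|lborel. F (- t))"
    by (subst set_integral_reflect) (rule arg_cong[where f = "\<lambda>A. set_lebesgue_integral lborel A _"], auto)
  also have "(LINT t:{eps<..<R}|lborel. F t) + (LINT t:{eps<..<R}|lborel. F (- t)) = (LINT t:{eps<..<R}|lborel. F t + F (- t))"
    by (rule set_integral_add(2)[OF i1 i3, symmetric])
  also have "\<dots> = (LINT t:{eps<..<R}|lborel. curve_diff b cp cm u f x t / t)"
    by (rule set_lebesgue_integral_cong) (use e in \<open>auto simp: F_def gammab_def curve_diff_def diff_divide_distrib\<close>)
  finally show ?thesis .
qed

lemma pv_regular_tendsto:
  assumes reg: "pv_regular b cp cm u f x"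
  shows "((\<lambda>(eps, R). Htrunc b cp cm u f eps R x) \<longlongrightarrow> Hint b cp cm u f x) (at_right 0 \<times>\<^sub>F at_top)"
proof -
  from reg obtain B C where f: "f \<in> borel_measurable borel" and B: "\<And>y. \<bar>f y\<bar> \<le> B"
    and C: "\<And>t. t > 0 \<Longrightarrow> \<bar>curve_diff b cp cm u f x t\<bar> \<le> C * t"
    and z: "\<And>t. t \<ge> 1 \<Longrightarrow> curve_diff b cp cm u f x t = 0"
    unfolding pv_regular_def by blast
  define q where "q = (\<lambda>t. curve_diff b cp cm u f x t / t)"
  have qm: "q \<in> borel_measurable borel" unfolding q_def using curve_diff_measurable_t[OF f] by measurable
  have qb: "\<bar>q t\<bar> \<le> C" if "t > 0" for t using C[OF that] that by (simp add: q_def field_simps)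
  have C0: "0 \<le> C" using qb[of 1] by linarith
  \<comment> \<open>For R at least 1 the upper truncation loses nothing, as the integrand vanishes
    from 1 on. The lower one loses an interval of length \<open>eps\<close> on which the quotient is
    bounded by C.\<close>
  have key: "\<bar>Htrunc b cp cm u f eps R x - Hint b cp cm u f x\<bar> \<le> C * eps" if e: "0 < eps" "eps < 1" "1 \<le> R" for eps R
  proof -
    have i: "set_integrable lborel A q" if "A \<in> sets borel" "A \<subseteq> {0<..R}" for A
      by (rule set_integrable_bounded[where a = 0 and c = R and C = C]) (use qm qb that in auto)
    have "Hint b cp cm u f x = (LINT t:{0<..eps} \<union> {eps<..<R}|lborel. q t)"
      unfolding Hint_def set_lebesgue_integral_def q_def
      by (intro Bochner_Integration.integral_cong refl) (use e z in \<open>auto simp: indicator_def\<close>)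
    also have "\<dots> = (LINT t:{0<..eps}|lborel. q t) + (LINT t:{eps<..<R}|lborel. q t)"
      by (intro set_integral_Un i) (use e in auto)
    also have "(LINT t:{eps<..<R}|lborel. q t) = Htrunc b cp cm u f eps R x"
      unfolding q_def by (rule Htrunc_eq[OF f B, symmetric]) (use e in auto)
    finally have "\<bar>Htrunc b cp cm u f eps R x - Hint b cp cm u f x\<bar> = \<bar>LINT t:{0<..eps}|lborel. q t\<bar>" by simp
    also have "\<dots> \<le> (LINT t:{0<..eps}|lborel. C)"
      unfolding set_lebesgue_integral_def real_norm_def[symmetric]
    proof (rule Bochner_Integration.integral_norm_bound_integral)
      show "integrable lborel (\<lambda>t. indicat_real {0<..eps} t *\<^sub>R q t)"
        unfolding set_integrable_def[symmetric] by (rule i) (use e in auto)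
      show "integrable lborel (\<lambda>t. indicat_real {0<..eps} t *\<^sub>R C)" using e by simp
    qed (use qb in \<open>auto simp: indicator_def\<close>)
    also have "\<dots> = C * eps" using e by (simp add: set_lebesgue_integral_def)
    finally show ?thesis .
  qed
  show ?thesis
  proof (rule tendstoI)
    fix e :: real assume e: "0 < e"
    define d where "d = min 1 (e / (C + 1))"
    have d: "0 < d" using e C0 by (simp add: d_def)
    have "\<forall>\<^sub>F e in at_right 0. 0 < e \<and> e < d"
      using d by (intro eventually_at_rightI[of 0 d]) auto
    from eventually_prodI[OF this eventually_ge_at_top[of "1::real"]]
    show "\<forall>\<^sub>F z in at_right 0 \<times>\<^sub>F at_top. dist (case z of (eps, R) \<Rightarrow> Htrunc b cp cm u f eps R x) (Hint b cp cm u f x) < e"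
    proof eventually_elim
      case (elim z)
      then have z: "0 < fst z" "fst z < 1" "fst z < e / (C + 1)" "1 \<le> snd z" by (auto simp: d_def)
      have "C * fst z \<le> (C + 1) * fst z" using z by simp
      also have "\<dots> < e" using z C0 by (simp add: field_simps)
      finally show ?case using key[OF z(1,2,4)] by (simp add: case_prod_beta dist_real_def)
    qed
  qed
qed

lemma Hpv_eq_Hint:
  assumes "pv_regular b cp cm u f x"
  shows "Hpv b cp cm u f x = Hint b cp cm u f x"
proof -
  have nb: "(at_right 0 \<times>\<^sub>F at_top :: (real \<times> real) filter) \<noteq> bot"
    by (simp add: prod_filter_eq_bot trivial_limit_at_top_linorder)
  have *: "((\<lambda>(eps, R). Htrunc b cp cm u f eps R x) \<longlongrightarrow> Hint b cp cm u f x) (at_right 0 \<times>\<^sub>F at_top)"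
    by (rule pv_regular_tendsto[OF assms])
  then have "(THE L. ((\<lambda>(eps, R). Htrunc b cp cm u f eps R x) \<longlongrightarrow> L) (at_right 0 \<times>\<^sub>F at_top)) = Hint b cp cm u f x"
    by (intro the_equality) (auto intro: tendsto_unique[OF nb])
  then show ?thesis unfolding Hpv_def using * by auto
qed

lemma curve_diff_sum:
  "curve_diff b cp cm u (\<lambda>y. \<Sum>j\<in>J. f j y) x t = (\<Sum>j\<in>J. curve_diff b cp cm u (f j) x t)"
  by (simp add: curve_diff_def sum_subtractf)

lemma pv_regular_sum:
  assumes "finite J" "\<And>j. j \<in> J \<Longrightarrow> pv_regular b cp cm u (f j) x"
  shows "pv_regular b cp cm u (\<lambda>y. \<Sum>j\<in>J. f j y) x"
proof -
  have "\<exists>B C. (\<forall>y. \<bar>f j y\<bar> \<le> B) \<and> (\<forall>t>0. \<bar>curve_diff b cp cm u (f j) x t\<bar> \<le> C * t)" if "j \<in> J" for j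
    using assms(2)[OF that] by (auto simp: pv_regular_def)
  then obtain B C where BC: "\<And>j y. j \<in> J \<Longrightarrow> \<bar>f j y\<bar> \<le> B j"
     "\<And>j t. j \<in> J \<Longrightarrow> t > 0 \<Longrightarrow> \<bar>curve_diff b cp cm u (f j) x t\<bar> \<le> C j * t"
    by metis
  show ?thesis unfolding pv_regular_def curve_diff_sum
  proof (intro conjI exI allI impI)
    show "(\<lambda>y. \<Sum>j\<in>J. f j y) \<in> borel_measurable borel"
      using assms by (intro borel_measurable_sum) (auto simp: pv_regular_def)
    show "\<bar>\<Sum>j\<in>J. f j y\<bar> \<le> (\<Sum>j\<in>J. B j)" for y
      using BC by (intro order_trans[OF sum_abs] sum_mono) auto
    show "\<bar>\<Sum>j\<in>J. curve_diff b cp cm u (f j) x t\<bar> \<le> (\<Sum>j\<in>J. C j) * t" if "0 < t" for t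
      unfolding sum_distrib_right using BC that by (intro order_trans[OF sum_abs] sum_mono) auto
    show "(\<Sum>j\<in>J. curve_diff b cp cm u (f j) x t) = 0" if "1 \<le> t" for t
      using assms that by (intro sum.neutral) (auto simp: pv_regular_def)
  qed
qed

lemma pv_regular_set_integrable:
  assumes "pv_regular b cp cm u f x"
  shows "set_integrable lborel {0<..} (\<lambda>t. curve_diff b cp cm u f x t / t)"
proof -
  from assms obtain C where f: "f \<in> borel_measurable borel"
    and C: "\<And>t. t > 0 \<Longrightarrow> \<bar>curve_diff b cp cm u f x t\<bar> \<le> C * t"
    and z: "\<And>t. t \<ge> 1 \<Longrightarrow> curve_diff b cp cm u f x t = 0"
    unfolding pv_regular_def by blast
  have [measurable]: "curve_diff b cp cm u f x \<in> borel_measurable borel" by (rule curve_diff_measurable_t[OF f])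
  have "set_integrable lborel {0<..1} (\<lambda>t. curve_diff b cp cm u f x t / t)"
    by (rule set_integrable_bounded[where a = 0 and c = 1 and C = C]) (use C in \<open>auto simp: field_simps\<close>)
  moreover have "(\<lambda>t. indicat_real {0<..1} t *\<^sub>R (curve_diff b cp cm u f x t / t)) = (\<lambda>t. indicat_real {0<..} t *\<^sub>R (curve_diff b cp cm u f x t / t))"
    using z by (auto simp: indicator_def fun_eq_iff)
  ultimately show ?thesis unfolding set_integrable_def by simp
qed

lemma Hint_sum:
  assumes "\<And>j. j \<in> J \<Longrightarrow> pv_regular b cp cm u (f j) x"
  shows "Hint b cp cm u (\<lambda>y. \<Sum>j\<in>J. f j y) x = (\<Sum>j\<in>J. Hint b cp cm u (f j) x)"
  unfolding Hint_def set_lebesgue_integral_def curve_diff_sum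
  using pv_regular_set_integrable[OF assms]
  by (subst Bochner_Integration.integral_sum[symmetric])
     (auto simp: set_integrable_def sum_divide_distrib sum_distrib_left intro!: Bochner_Integration.integral_cong)

lemma curve_diff_cmult: "curve_diff b cp cm u (\<lambda>y. c * f y) x t = c * curve_diff b cp cm u f x t"
  by (simp add: curve_diff_def right_diff_distrib)

lemma pv_regular_cmult:
  assumes "pv_regular b cp cm u f x"
  shows "pv_regular b cp cm u (\<lambda>y. c * f y) x"
proof -
  from assms obtain B C where BC: "\<And>y. \<bar>f y\<bar> \<le> B" "\<And>t. t > 0 \<Longrightarrow> \<bar>curve_diff b cp cm u f x t\<bar> \<le> C * t"
    by (auto simp: pv_regular_def)
  show ?thesis unfolding pv_regular_def curve_diff_cmult
  proof (intro conjI exI allI impI)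
    show "(\<lambda>y. c * f y) \<in> borel_measurable borel" using assms by (auto simp: pv_regular_def)
    show "\<bar>c * f y\<bar> \<le> \<bar>c\<bar> * B" for y using BC by (simp add: abs_mult mult_left_mono)
    show "\<bar>c * curve_diff b cp cm u f x t\<bar> \<le> (\<bar>c\<bar> * C) * t" if "0 < t" for t
      using BC(2)[OF that] by (simp add: abs_mult mult_left_mono mult.assoc)
    show "c * curve_diff b cp cm u f x t = 0" if "1 \<le> t" for t
      using assms that by (auto simp: pv_regular_def)
  qed
qed

lemma Hint_cmult: "Hint b cp cm u (\<lambda>y. c * f y) x = c * Hint b cp cm u f x"
  unfolding Hint_def curve_diff_cmult
  by (simp add: set_lebesgue_integral_def flip: integral_mult_right_zero) (simp add: ac_simps)


section \<open>Asymptotics of one modulated block\<close>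

lemma curve_stays_close:
  fixes x :: "real \<times> real"
  assumes b: "1 < b" and \<delta>: "0 < \<delta>"
  shows "\<exists>d>0. d \<le> 1 \<and> (\<forall>t s. 0 < t \<and> t < d \<and> \<bar>s\<bar> = 1 \<longrightarrow> dist x (fst x + s * t, snd x - u * (c * t powr b)) < \<delta>)"
proof -
  \<comment> \<open>For t below 1 one has \<open>t powr b \<le> t\<close>, so the curve moves at
    most \<open>(1 + \<bar>u * c\<bar>) * t\<close> from x.\<close>
  define d where "d = min 1 (\<delta> / (1 + \<bar>u * c\<bar>))"
  have d: "0 < d" "d \<le> 1" using \<delta> by (auto simp: d_def intro: add_pos_nonneg)
  have "dist x (fst x + s * t, snd x - u * (c * t powr b)) < \<delta>" if t: "0 < t" "t < d" and s: "\<bar>s\<bar> = 1" for t s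
  proof -
    have "t powr b \<le> 1 powr (b - 1) * t" using t d b by (intro powr_le_scaled) auto
    then have tb: "t powr b \<le> t" by simp
    have "dist x (fst x + s * t, snd x - u * (c * t powr b)) \<le> \<bar>s * t\<bar> + \<bar>u * (c * t powr b)\<bar>"
      using sqrt_sum_squares_le_sum_abs[of "s * t" "u * (c * t powr b)"]
      by (simp add: dist_prod_def dist_real_def)
    also have "\<dots> = t + \<bar>u * c\<bar> * t powr b" using t s by (simp add: abs_mult)
    also have "\<dots> \<le> t + \<bar>u * c\<bar> * t" using tb by (intro add_left_mono mult_left_mono) auto
    also have "\<dots> = (1 + \<bar>u * c\<bar>) * t" by (simp add: algebra_simps)
    also have "\<dots> < (1 + \<bar>u * c\<bar>) * (\<delta> / (1 + \<bar>u * c\<bar>))"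
      using t by (intro mult_strict_left_mono) (auto simp: d_def intro: add_pos_nonneg)
    also have "\<dots> = \<delta>" by (simp add: add_nonneg_eq_0_iff)
    finally show ?thesis .
  qed
  with d show ?thesis by blast
qed

text \<open>The power \<open>n powr b\<close> in the second frequency matches the homogeneity of the
  curve: after the dilation by n the frequency disappears from the phase along the curve, and what
  remains besides the phase at the base point involves only \<open>\<sigma> * u\<close>.\<close>

definition block :: "real \<Rightarrow> (real \<times> real) set \<Rightarrow> real \<Rightarrow> nat \<Rightarrow> real \<times> real \<Rightarrow> real" where
  "block b E \<sigma> n y = indicator E y * cos (real n * fst y + \<sigma> * real n powr b * snd y)"

lemma block_measurable [measurable]: "E \<in> sets borel \<Longrightarrow> block b E \<sigma> n \<in> borel_measurable borel"
  unfolding block_def[abs_def]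
  by (rule borel_measurable_times) (auto intro!: borel_measurable_continuous_onI continuous_intros)

text \<open>A point at which the indicator of E is locally constant. \<open>Gp\<close> and
  \<open>Gm\<close> are the indicator along the two branches of the curve, and both equal
  \<open>g\<close> for small t.\<close>

locale block_point =
  fixes b cp cm u \<sigma> :: real and E :: "(real \<times> real) set" and x :: "real \<times> real" and \<delta> :: real
  assumes b: "1 < b" and E: "E \<in> sets borel" "E \<subseteq> usq" and x: "x \<in> usq"
    and \<delta>: "0 < \<delta>" and locally_const: "\<And>y. dist x y < \<delta> \<Longrightarrow> y \<in> E \<longleftrightarrow> x \<in> E"
begin

definition Gp :: "real \<Rightarrow> real" where
  "Gp t = indicator E (fst x - t, snd x - u * (cp * t powr b))"
definition Gm :: "real \<Rightarrow> real" where
  "Gm t = indicator E (fst x + t, snd x - u * (cm * t powr b))"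
definition g :: real where "g = indicator E x"
definition \<theta> :: "nat \<Rightarrow> real" where "\<theta> n = real n * fst x + \<sigma> * real n powr b * snd x"

lemma near: "\<exists>d>0. d \<le> 1 \<and> (\<forall>t. 0 < t \<and> t < d \<longrightarrow> Gp t = g \<and> Gm t = g)"
proof -
  obtain d1 where d1: "0 < d1" "d1 \<le> 1"
    "\<And>t s. 0 < t \<Longrightarrow> t < d1 \<Longrightarrow> \<bar>s\<bar> = 1 \<Longrightarrow> dist x (fst x + s * t, snd x - u * (cp * t powr b)) < \<delta>"
    using curve_stays_close[OF b \<delta>, of x u cp] by blast
  obtain d2 where d2: "0 < d2" "d2 \<le> 1"
    "\<And>t s. 0 < t \<Longrightarrow> t < d2 \<Longrightarrow> \<bar>s\<bar> = 1 \<Longrightarrow> dist x (fst x + s * t, snd x - u * (cm * t powr b)) < \<delta>"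
    using curve_stays_close[OF b \<delta>, of x u cm] by blast
  show ?thesis
  proof (intro exI[of _ "min d1 d2"] conjI allI impI; (elim conjE)?)
    show "Gp t = g" if "0 < t" "t < min d1 d2" for t
      using locally_const[OF d1(3)[of t "- 1"]] that by (simp add: Gp_def g_def indicator_def)
    show "Gm t = g" if "0 < t" "t < min d1 d2" for t
      using locally_const[OF d2(3)[of t 1]] that by (simp add: Gm_def g_def indicator_def)
  qed (use d1 d2 in auto)
qed

lemma far: "Gp t = 0" "Gm t = 0" if "1 \<le> t" for t
  using E x that by (auto simp: Gp_def Gm_def usq_def indicator_def)

lemma curve_diff_block:
  "curve_diff b cp cm u (block b E \<sigma> n) x t =
     Gp t * cos (\<theta> n - real n * t - (real n powr b * (\<sigma> * u * cp)) * t powr b)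
   - Gm t * cos (\<theta> n - (- real n) * t - (real n powr b * (\<sigma> * u * cm)) * t powr b)"
  by (simp add: curve_diff_def block_def Gp_def Gm_def \<theta>_def algebra_simps)

text \<open>The indicator along the curve is frozen at its value \<open>g\<close> at x. The
  singularity 1/t then sits in the first term alone, since by \<open>near\<close> the two
  corrections vanish for small t.\<close>

lemma osc_num:
  "curve_diff b cp cm u (block b E \<sigma> n) x t / t =
     g * osc_diff b (\<theta> n) (real n) (real n powr b * (\<sigma> * u * cp)) (- real n) (real n powr b * (\<sigma> * u * cm)) t
     + (Gp t - g) * (cos (\<theta> n - real n * t - (real n powr b * (\<sigma> * u * cp)) * t powr b) / t)
     - (Gm t - g) * (cos (\<theta> n - (- real n) * t - (real n powr b * (\<sigma> * u * cm)) * t powr b) / t)"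
  unfolding curve_diff_block osc_diff_def
  by (simp add: diff_divide_distrib left_diff_distrib right_diff_distrib)

lemma regular: "pv_regular b cp cm u (block b E \<sigma> n) x"
proof -
  obtain d where d: "0 < d" "d \<le> 1" "\<And>t. 0 < t \<Longrightarrow> t < d \<Longrightarrow> Gp t = g" "\<And>t. 0 < t \<Longrightarrow> t < d \<Longrightarrow> Gm t = g"
    using near by blast
  define a1 b1 b2 where "a1 = real n" and "b1 = real n powr b * (\<sigma> * u * cp)" and "b2 = real n powr b * (\<sigma> * u * cm)"
  define C where "C = \<bar>a1 - - a1\<bar> + \<bar>b1 - b2\<bar> + 2 / d"
  have bd: "\<bar>block b E \<sigma> n y\<bar> \<le> 1" for y by (simp add: block_def indicator_def)
  have "\<bar>curve_diff b cp cm u (block b E \<sigma> n) x t\<bar> \<le> C * t" if t: "0 < t" for t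
  proof (cases "t < d")
    case True
    have "curve_diff b cp cm u (block b E \<sigma> n) x t / t = g * osc_diff b (\<theta> n) a1 b1 (- a1) b2 t"
      unfolding osc_num using d(3,4)[OF t True] by (simp add: a1_def b1_def b2_def)
    also have "\<bar>\<dots>\<bar> \<le> \<bar>osc_diff b (\<theta> n) a1 b1 (- a1) b2 t\<bar>"
      by (simp add: g_def indicator_def)
    also have "\<dots> \<le> \<bar>a1 - - a1\<bar> + \<bar>b1 - b2\<bar> * 1 powr (b - 1)"
      by (rule osc_diff_bounded) (use b t True d in auto)
    also have "\<dots> \<le> C" using d by (simp add: C_def)
    finally show ?thesis using t by (simp add: field_simps)
  next
    case False
    have "\<bar>curve_diff b cp cm u (block b E \<sigma> n) x t\<bar> \<le> 1 + 1"
      unfolding curve_diff_def by (rule order_trans[OF abs_triangle_ineq4 add_mono[OF bd bd]])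
    also have "\<dots> \<le> 2 / d * t" using False d by (simp add: field_simps)
    also have "\<dots> \<le> C * t" using t by (intro mult_right_mono) (auto simp: C_def)
    finally show ?thesis .
  qed
  moreover have "curve_diff b cp cm u (block b E \<sigma> n) x t = 0" if "1 \<le> t" for t
    unfolding curve_diff_block using far[OF that] by simp
  ultimately show ?thesis unfolding pv_regular_def
    using bd E by auto
qed

text \<open>On \<open>{d..<1}\<close> the kernel is bounded by 1/d, and on intervals it tends to 0
  because the linear frequency n alone satisfies the tail condition. Weak convergence then allows an
  arbitrary Borel set G, here the set of times at which the curve lies in E.\<close>

lemma half_tail:
  assumes d: "0 < d" "d \<le> 1" and s: "\<bar>s\<bar> = 1" and G: "G \<in> sets borel"
  shows "(\<lambda>n. LINT t:G|lborel. indicator {d..<1} t *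
     (cos (\<theta> n - (s * real n) * t - (real n powr b * c) * t powr b) / t)) \<longlonglongrightarrow> 0"
proof -
  define k where "k = (\<lambda>n t. indicator {d..<1} t * (cos (\<theta> n - (s * real n) * t - (real n powr b * c) * t powr b) / t))"
  have base: "(\<lambda>n. LINT t:{..a}|lborel. k n t) \<longlonglongrightarrow> 0" for a
  proof (rule tendstoI)
    fix e :: real assume "0 < e"
    then have "0 < e / 2" by simp
    then obtain W where W: "0 < W" and
      tail: "\<forall>\<alpha> \<beta> \<delta> a R. 0 < a \<and> a \<le> R \<and> W \<le> \<bar>\<alpha>\<bar> * a + b * \<bar>\<beta>\<bar> * a powr b \<longrightarrow>
           \<bar>integral {a..R} (\<lambda>t. cos (\<alpha> * t + \<beta> * t powr b + \<delta>) / t)\<bar> \<le> e / 2"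
      by (rule oscillatory_tail_small[OF b])
    define m where "m = max d (min 1 a)"
    have "filterlim (\<lambda>n. real n * d) at_top sequentially"
      using d(1) by (intro filterlim_at_top_mult_tendsto_pos[OF tendsto_const _ filterlim_real_sequentially])
    then have "\<forall>\<^sub>F n in sequentially. W \<le> real n * d" by (simp add: filterlim_at_top)
    then show "\<forall>\<^sub>F n in sequentially. dist (LINT t:{..a}|lborel. k n t) 0 < e"
    proof eventually_elim
      case (elim n)
      let ?h = "\<lambda>t. cos ((- (s * real n)) * t + (- (real n powr b * c)) * t powr b + \<theta> n) / t"
      have [measurable]: "?h \<in> borel_measurable borel" by measurable
      have "(LINT t:{..a}|lborel. k n t) = (LINT t:{d..<1} \<inter> {..a}|lborel. ?h t)"
        unfolding set_lebesgue_integral_def k_def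
        by (intro Bochner_Integration.integral_cong refl) (auto simp: indicator_def algebra_simps)
      also have "\<dots> = (LINT t:{d..m}|lborel. ?h t)"
      proof (rule set_integral_cong_set)
        show "AE t in lborel. (t \<in> {d..m}) = (t \<in> {d..<1} \<inter> {..a})"
          using AE_lborel_singleton[of 1] AE_lborel_singleton[of d] by eventually_elim (auto simp: m_def)
      qed (auto simp: set_borel_measurable_def)
      also have "\<dots> = integral {d..m} ?h"
        using d by (intro set_borel_integral_eq_integral borel_integrable_atLeastAtMost' continuous_intros) auto
      also have "\<bar>\<dots>\<bar> \<le> e / 2"
      proof (rule tail[rule_format], intro conjI)
        have "\<bar>- (s * real n)\<bar> * d = real n * d" using s by (simp add: abs_mult)
        moreover have "0 \<le> b * \<bar>- (real n powr b * c)\<bar> * d powr b" using b by simp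
        ultimately show "W \<le> \<bar>- (s * real n)\<bar> * d + b * \<bar>- (real n powr b * c)\<bar> * d powr b" using elim by linarith
      qed (use d in \<open>auto simp: m_def\<close>)
      finally show ?case using \<open>0 < e\<close> by simp
    qed
  qed
  have "(\<lambda>n. LINT t:G|lborel. k n t) \<longlonglongrightarrow> 0"
  proof (rule weakly_null_on_sets[where w = "\<lambda>t. indicator {d..<1} t * (1 / d)"])
    show "k n \<in> borel_measurable borel" for n unfolding k_def by measurable
    show "integrable lborel (\<lambda>t. indicator {d..<1} t * (1 / d))" using d by (intro integrable_mult_left) simp
    show "\<bar>k n t\<bar> \<le> indicator {d..<1} t * (1 / d)" for n t
      using d by (auto simp: k_def indicator_def intro!: frac_le)
    have "(LINT t|lborel. k n t) = (LINT t:{..1}|lborel. k n t)" for n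
      unfolding set_lebesgue_integral_def k_def
      by (intro Bochner_Integration.integral_cong refl) (auto simp: indicator_def)
    then show "(\<lambda>n. LINT t|lborel. k n t) \<longlonglongrightarrow> 0" using base[of 1] by simp
  qed (use base G in auto)
  then show ?thesis unfolding k_def .
qed

lemma asymptotic:
  "(\<lambda>n. Hint b cp cm u (block b E \<sigma> n) x
      - g * integral {0..real n} (osc_diff b (\<theta> n) 1 (\<sigma> * u * cp) (- 1) (\<sigma> * u * cm))) \<longlonglongrightarrow> 0"
proof -
  obtain d where d: "0 < d" "d \<le> 1" "\<And>t. 0 < t \<Longrightarrow> t < d \<Longrightarrow> Gp t = g" "\<And>t. 0 < t \<Longrightarrow> t < d \<Longrightarrow> Gm t = g"
    using near by blast
  define kp where "kp = (\<lambda>n t. indicator {d..<1} t * (cos (\<theta> n - (1 * real n) * t - (real n powr b * (\<sigma> * u * cp)) * t powr b) / t))"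
  define km where "km = (\<lambda>n t. indicator {d..<1} t * (cos (\<theta> n - ((- 1) * real n) * t - (real n powr b * (\<sigma> * u * cm)) * t powr b) / t))"
  define Ap where "Ap = {t. (fst x - t, snd x - u * (cp * t powr b)) \<in> E}"
  define Am where "Am = {t. (fst x + t, snd x - u * (cm * t powr b)) \<in> E}"
  have Gpi: "Gp = indicator Ap" "Gm = indicator Am"
    by (auto simp: Gp_def Gm_def Ap_def Am_def indicator_def fun_eq_iff)
  have "(\<lambda>t. (fst x - t, snd x - u * (cp * t powr b))) \<in> borel_measurable borel"
       "(\<lambda>t. (fst x + t, snd x - u * (cm * t powr b))) \<in> borel_measurable borel"
    by (intro borel_measurable_Pair; measurable)+
  from this[THEN measurable_sets, OF E(1)] have A: "Ap \<in> sets borel" "Am \<in> sets borel"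
    by (auto simp: Ap_def Am_def vimage_def)
  define Osc where "Osc = (\<lambda>n. osc_diff b (\<theta> n) (real n) (real n powr b * (\<sigma> * u * cp)) (- real n) (real n powr b * (\<sigma> * u * cm)))"
  have iO: "set_integrable lborel {0<..<1} (Osc n)" for n
    unfolding Osc_def
    by (rule set_integrable_bounded[where a = 0 and c = 1, OF borel_measurable_osc_diff _ _ osc_diff_bounded[where R = 1]])
       (use b in auto)
  have km_int: "integrable lborel (k n)" if "k = kp \<or> k = km" for k n
  proof (rule integrableI_bounded_set[where A = "{d..<1}" and B = "1 / d"])
    show "k n \<in> borel_measurable lborel" using that unfolding kp_def km_def by auto
    show "AE t in lborel. t \<in> {d..<1} \<longrightarrow> norm (k n t) \<le> 1 / d"
      using that d(1) by (auto simp: kp_def km_def intro!: AE_I2 frac_le)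
    show "emeasure lborel {d..<1} < \<infinity>" using d by simp
  qed (use that in \<open>auto simp: kp_def km_def\<close>)
  have ik: "integrable lborel (kp n)" "integrable lborel (km n)" for n using km_int by auto
  have iG: "integrable lborel (\<lambda>t. indicator B t * kp n t)" "integrable lborel (\<lambda>t. indicator B t * km n t)" if "B \<in> sets borel" for B n
    using integrable_mult_indicator[of B lborel "kp n"] integrable_mult_indicator[of B lborel "km n"] that ik by auto
  have main: "Hint b cp cm u (block b E \<sigma> n) x = g * integral {0..real n} (osc_diff b (\<theta> n) 1 (\<sigma> * u * cp) (- 1) (\<sigma> * u * cm))
     + ((LINT t:Ap|lborel. kp n t) - g * (LINT t:UNIV|lborel. kp n t))
     - ((LINT t:Am|lborel. km n t) - g * (LINT t:UNIV|lborel. km n t))" if n: "0 < n" for n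
  proof -
    have "Hint b cp cm u (block b E \<sigma> n) x = (LINT t|lborel. g * (indicator {0<..<1} t * Osc n t)
        + (indicator Ap t * kp n t - g * kp n t) - (indicator Am t * km n t - g * km n t))"
      unfolding Hint_def set_lebesgue_integral_def
    proof (intro Bochner_Integration.integral_cong refl)
      fix t :: real
      have "curve_diff b cp cm u (block b E \<sigma> n) x t / t = g * Osc n t + (Gp t - g) * kp n t - (Gm t - g) * km n t"
        if "0 < t" "t < 1"
      proof (cases "t < d")
        case True
        then show ?thesis unfolding osc_num using d(3,4)[of t] that by (simp add: Osc_def)
      next
        case False
        then have "kp n t = cos (\<theta> n - real n * t - (real n powr b * (\<sigma> * u * cp)) * t powr b) / t"
          "km n t = cos (\<theta> n - (- real n) * t - (real n powr b * (\<sigma> * u * cm)) * t powr b) / t"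
          using that by (auto simp: kp_def km_def)
        then show ?thesis unfolding osc_num Osc_def by simp
      qed
      moreover have "kp n t = 0" "km n t = 0" if "\<not> (0 < t \<and> t < 1)" using that d by (auto simp: kp_def km_def)
      moreover have "curve_diff b cp cm u (block b E \<sigma> n) x t = 0" if "1 \<le> t" unfolding curve_diff_block using far[OF that] by simp
      ultimately show "indicator {0<..} t *\<^sub>R (curve_diff b cp cm u (block b E \<sigma> n) x t / t) =
        g * (indicator {0<..<1} t * Osc n t) + (indicator Ap t * kp n t - g * kp n t) - (indicator Am t * km n t - g * km n t)"
        unfolding Gpi by (cases "0 < t \<and> t < 1") (auto simp: left_diff_distrib)
    qed
    also have "\<dots> = g * (LINT t|lborel. indicator {0<..<1} t * Osc n t)
        + ((LINT t|lborel. indicator Ap t * kp n t) - g * (LINT t|lborel. kp n t))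
        - ((LINT t|lborel. indicator Am t * km n t) - g * (LINT t|lborel. km n t))"
      using iO[of n] ik iG A by (simp add: set_integrable_def)
    also have "(LINT t|lborel. indicator {0<..<1} t * Osc n t) = integral {0<..<1} (Osc n)"
      using set_borel_integral_eq_integral(2)[OF iO[of n]] by (simp add: set_lebesgue_integral_def)
    also have "\<dots> = integral {0..1} (Osc n)" by (rule integral_open_interval_real[symmetric])
    also have "\<dots> = integral {0..real n} (osc_diff b (\<theta> n) 1 (\<sigma> * u * cp) (- 1) (\<sigma> * u * cm))"
      using osc_diff_scale[of b "real n" 1 "\<theta> n" 1 "\<sigma> * u * cp" "- 1" "\<sigma> * u * cm"] b n by (simp add: Osc_def)
    finally show ?thesis by (simp add: set_lebesgue_integral_def)
  qed
  have "(\<lambda>n. ((LINT t:Ap|lborel. kp n t) - g * (LINT t:UNIV|lborel. kp n t))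
     - ((LINT t:Am|lborel. km n t) - g * (LINT t:UNIV|lborel. km n t))) \<longlonglongrightarrow> (0 - g * 0) - (0 - g * 0)"
    unfolding kp_def km_def using d A
    by (intro tendsto_diff tendsto_mult tendsto_const half_tail) auto
  then have "(\<lambda>n. ((LINT t:Ap|lborel. kp n t) - g * (LINT t:UNIV|lborel. kp n t))
     - ((LINT t:Am|lborel. km n t) - g * (LINT t:UNIV|lborel. km n t))) \<longlonglongrightarrow> 0" by simp
  then show ?thesis
    by (rule Lim_transform_eventually) (use main in \<open>auto intro!: eventually_sequentiallyI[of 1]\<close>)
qed

end

section \<open>The tree of cosines\<close>

text \<open>The zeros lie on countably many parallel lines, hence in a null set.\<close>

lemma AE_cos_nonzero:
  fixes a c \<psi> :: real
  assumes "a \<noteq> 0"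
  shows "AE x in lborel. cos (a * fst x + c * snd x - \<psi>) \<noteq> 0"
proof -
  have "negligible (\<Union>k::int. {x. (a, c) \<bullet> x = k * pi + pi / 2 + \<psi>})"
    using assms by (intro negligible_countable_Union) (auto simp: zero_prod_def intro!: negligible_hyperplane)
  then have "(\<Union>k::int. {x. (a, c) \<bullet> x = k * pi + pi / 2 + \<psi>}) \<in> null_sets (completion lborel)"
    by (simp add: negligible_iff_null_sets)
  from AE_not_in[OF this] have "AE x in lborel. x \<notin> (\<Union>k::int. {x. (a, c) \<bullet> x = k * pi + pi / 2 + \<psi>})"
    by (simp only: AE_completion_iff)
  then show ?thesis
  proof eventually_elim
    case (elim x)
    show ?case
    proof
      assume "cos (a * fst x + c * snd x - \<psi>) = 0"
      then obtain k :: int where "a * fst x + c * snd x - \<psi> = k * pi + pi / 2"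
        by (auto simp: cos_zero_iff_int2)
      then have "(a, c) \<bullet> x = k * pi + pi / 2 + \<psi>" by (simp add: inner_prod_def algebra_simps)
      with elim show False by blast
    qed
  qed
qed

text \<open>The linear term is kept exactly because its integral against earlier levels will tend to
  0; only the quadratic term contributes to the growth of the moments.\<close>

lemma exp_le_quadratic:
  fixes x :: real
  assumes "\<bar>x\<bar> \<le> 1"
  shows "exp x \<le> 1 + x + x\<^sup>2"
proof (cases "0 \<le> x")
  case True
  then show ?thesis using assms by (intro exp_bound) auto
next
  case False
  have "1 - x \<le> exp (- x)" using exp_ge_add_one_self[of "- x"] by simp
  then have "exp x \<le> 1 / (1 - x)" using False by (simp add: exp_minus field_simps)
  also have "\<dots> \<le> 1 + x + x\<^sup>2"
  proof -
    have "0 \<le> (- x) ^ 3" using False by (intro zero_le_power) simp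
    then have "1 \<le> (1 + x + x\<^sup>2) * (1 - x)" by (simp add: algebra_simps power2_eq_square power3_eq_cube)
    then show ?thesis using False by (simp add: field_simps)
  qed
  finally show ?thesis .
qed

text \<open>Node \<open>i\<close> of level \<open>l\<close> has in-order position \<open>(2i+1) 2\<^sup>L\<^sup>-\<^sup>l\<^sup>-\<^sup>1\<close>; leaves below it use the limit symbol with
  index 0, the others the one with index 1.\<close>
locale cosine_tree =
  fixes b cp cm :: real and L :: nat and va vb :: "nat \<Rightarrow> real" and u sg :: "nat \<Rightarrow> real"
    and \<sigma> :: "nat \<Rightarrow> nat \<Rightarrow> real" and \<epsilon> r \<psi> :: real
  assumes b: "1 < b" and L: "1 \<le> L" and \<epsilon>: "0 < \<epsilon>"
    and r: "r \<noteq> 0" "va 1 - va 0 = r * cos \<psi>" "vb 1 - vb 0 = r * sin \<psi>"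
    and sg: "\<And>k. \<bar>sg k\<bar> = 1"
    and approx: "\<And>l i k. l < L \<Longrightarrow> i < 2 ^ l \<Longrightarrow> k < 2 ^ L \<Longrightarrow>
      \<forall>\<^sub>F n in sequentially. \<forall>\<theta>.
        \<bar>sg k * integral {0..real n} (osc_diff b \<theta> 1 (\<sigma> l i * u k * cp) (- 1) (\<sigma> l i * u k * cm))
          - (let j = if k < (2 * i + 1) * 2 ^ (L - Suc l) then 0 else 1 in va j * cos \<theta> + vb j * sin \<theta>)\<bar> \<le> \<epsilon>"
begin

definition V :: "nat \<Rightarrow> real \<Rightarrow> real" where "V j \<theta> = va j * cos \<theta> + vb j * sin \<theta>"

definition Vmax :: "real \<Rightarrow> real" where "Vmax \<theta> = max (V 0 \<theta>) (V 1 \<theta>)"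

definition side :: "nat \<Rightarrow> nat \<Rightarrow> nat \<Rightarrow> nat" where
  "side l i k = (if k < (2 * i + 1) * 2 ^ (L - Suc l) then 0 else 1)"

definition phase :: "(nat \<Rightarrow> nat) \<Rightarrow> nat \<Rightarrow> nat \<Rightarrow> real \<times> real \<Rightarrow> real" where
  "phase ls l i x = real (ls l) * fst x + \<sigma> l i * real (ls l) powr b * snd x"

text \<open>The node of level l reached by x: node i has the children 2i and 2i+1, and x moves to
  the right child when the value with index 1 is strictly larger. All nodes of a level share the
  frequency \<open>ls l\<close> and differ only in \<sigma>.\<close>

fun code :: "(nat \<Rightarrow> nat) \<Rightarrow> nat \<Rightarrow> real \<times> real \<Rightarrow> nat" where
  "code ls 0 x = 0"
| "code ls (Suc l) x = 2 * code ls l x + (if V 0 (phase ls l (code ls l x) x) < V 1 (phase ls l (code ls l x) x) then 1 else 0)"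

definition \<Theta> :: "(nat \<Rightarrow> nat) \<Rightarrow> nat \<Rightarrow> real \<times> real \<Rightarrow> real" where
  "\<Theta> ls l x = phase ls l (code ls l x) x"

definition S :: "(nat \<Rightarrow> nat) \<Rightarrow> nat \<Rightarrow> real \<times> real \<Rightarrow> real" where
  "S ls l x = (\<Sum>m<l. cos (\<Theta> ls m x))"

definition cell :: "(nat \<Rightarrow> nat) \<Rightarrow> nat \<Rightarrow> nat \<Rightarrow> (real \<times> real) set" where
  "cell ls l i = {x \<in> usq. code ls l x = i}"

text \<open>In polar form the difference is a single cosine. Hence ties occur only on lines, and the
  gain from taking the maximum is governed by |r|.\<close>

lemma V_diff: "V 1 \<theta> - V 0 \<theta> = r * cos (\<theta> - \<psi>)"
proof -
  have "V 1 \<theta> - V 0 \<theta> = (va 1 - va 0) * cos \<theta> + (vb 1 - vb 0) * sin \<theta>"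
    by (simp add: V_def algebra_simps)
  then show ?thesis unfolding r(2,3) by (simp add: cos_diff algebra_simps)
qed

lemma continuous_V [continuous_intros]:
  fixes A :: "'a::t2_space set"
  shows "continuous_on A f \<Longrightarrow> continuous_on A (\<lambda>x. V j (f x))"
  unfolding V_def by (intro continuous_intros)

lemma V_measurable [measurable]: "V j \<in> borel_measurable borel"
  by (intro borel_measurable_continuous_onI continuous_intros)

lemma Vmax_measurable [measurable]: "Vmax \<in> borel_measurable borel"
  unfolding Vmax_def by measurable

lemma V_bound: "\<bar>V j \<theta>\<bar> \<le> \<bar>va j\<bar> + \<bar>vb j\<bar>"
proof -
  have "\<bar>V j \<theta>\<bar> \<le> \<bar>va j\<bar> * \<bar>cos \<theta>\<bar> + \<bar>vb j\<bar> * \<bar>sin \<theta>\<bar>"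
    unfolding V_def abs_mult[symmetric] by (rule abs_triangle_ineq)
  also have "\<dots> \<le> \<bar>va j\<bar> * 1 + \<bar>vb j\<bar> * 1" by (intro add_mono mult_left_mono) auto
  finally show ?thesis by simp
qed

definition vm :: real where "vm = \<bar>va 0\<bar> + \<bar>vb 0\<bar> + \<bar>va 1\<bar> + \<bar>vb 1\<bar>"

lemma Vmax_bound: "\<bar>Vmax \<theta>\<bar> \<le> vm"
proof -
  have "Vmax \<theta> = V 0 \<theta> \<or> Vmax \<theta> = V 1 \<theta>" by (auto simp: Vmax_def max_def)
  then show ?thesis
    using V_bound[of 0 \<theta>] V_bound[of 1 \<theta>] unfolding vm_def by (elim disjE; linarith)
qed

lemma phase_cont [continuous_intros]: "continuous_on A (phase ls l i)"
  unfolding phase_def by (intro continuous_intros)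

lemma phase_measurable [measurable]: "phase ls l i \<in> borel_measurable borel"
  by (intro borel_measurable_continuous_onI continuous_intros)

lemma phase_cong: "ls l = ls' l \<Longrightarrow> phase ls l i = phase ls' l i"
  by (simp add: phase_def fun_eq_iff)

text \<open>The cells of level l are determined by the frequencies of the levels before l. This
  makes a successive choice possible: a new \<open>ls l\<close> leaves the cells of level l as they
  are.\<close>

lemma code_cong: "(\<And>m. m < l \<Longrightarrow> ls m = ls' m) \<Longrightarrow> code ls l x = code ls' l x"
proof (induction l)
  case (Suc l)
  then have "code ls l x = code ls' l x" "phase ls l = phase ls' l"
    by (auto intro: phase_cong)
  then show ?case by simp
qed simp

lemma code_less: "code ls l x < 2 ^ l"
proof (induction l)
  case (Suc l)
  have "code ls (Suc l) x \<le> 2 * code ls l x + 1" by simp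
  with Suc show ?case by (simp only: power_Suc)
qed simp

lemma code_measurable [measurable]: "code ls l \<in> measurable borel (count_space UNIV)"
proof (induction l)
  case (Suc l)
  note [measurable] = Suc
  have "(\<lambda>x. (\<lambda>i x. 2 * i + (if V 0 (phase ls l i x) < V 1 (phase ls l i x) then 1 else 0)) (code ls l x) x) \<in> measurable borel (count_space (UNIV :: nat set))"
    by (rule measurable_compose_countable[OF _ Suc]) measurable
  then show ?case by simp
qed simp

lemma \<Theta>_measurable [measurable]: "\<Theta> ls l \<in> borel_measurable borel"
  unfolding \<Theta>_def[abs_def] by (rule measurable_compose_countable[OF _ code_measurable]) measurable

lemma S_measurable [measurable]: "S ls l \<in> borel_measurable borel"
  unfolding S_def[abs_def] by measurable

lemma cell_sets [measurable]: "cell ls l i \<in> sets borel"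
proof -
  have [measurable]: "usq \<in> sets borel" by (rule usq_props)
  have "{x \<in> space borel. x \<in> usq \<and> code ls l x = i} \<in> sets borel" by measurable
  then show ?thesis by (simp add: cell_def)
qed

lemma S_bound: "\<bar>S ls l x\<bar> \<le> real l"
proof -
  have "\<bar>S ls l x\<bar> \<le> (\<Sum>m<l. 1)"
    unfolding S_def by (rule order_trans[OF sum_abs]) (intro sum_mono, simp)
  then show ?thesis by simp
qed

lemma code_div: "code ls (l + d) x div 2 ^ d = code ls l x"
proof (induction d)
  case (Suc d)
  have "code ls (l + Suc d) x div 2 ^ Suc d = (code ls (Suc (l + d)) x div 2) div 2 ^ d"
    by (simp only: power_Suc add_Suc_right div_mult2_eq)
  also have "code ls (Suc (l + d)) x div 2 = code ls (l + d) x" by simp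
  finally show ?case using Suc by simp
qed simp

text \<open>Dropping the last \<open>L - Suc l\<close> binary digits of the leaf of x gives the
  child that x enters after level l. So the leaf lies before the in-order position of the node
  exactly when x went left, which is when the value with index 0 was not the smaller one.\<close>

lemma V_side_code:
  assumes "l < L"
  shows "V (side l (code ls l x) (code ls L x)) (\<Theta> ls l x) = Vmax (\<Theta> ls l x)"
proof -
  let ?i = "code ls l x" and ?d = "L - Suc l"
  have "code ls L x div 2 ^ ?d = code ls (Suc l) x" using code_div[of ls "Suc l" ?d x] assms by simp
  then have "code ls L x < (2 * ?i + 1) * 2 ^ ?d \<longleftrightarrow> code ls (Suc l) x < 2 * ?i + 1"
    by (metis div_less_iff_less_mult zero_less_numeral zero_less_power)
  also have "\<dots> \<longleftrightarrow> \<not> V 0 (\<Theta> ls l x) < V 1 (\<Theta> ls l x)" by (simp add: \<Theta>_def)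
  finally show ?thesis by (auto simp: side_def Vmax_def max_def)
qed

text \<open>Without ties, no decision on the path of x is borderline. Positive frequencies make the
  coefficient of the first coordinate nonzero, so the tie sets are null.\<close>

lemma AE_split: 
  assumes "\<And>m. m < l \<Longrightarrow> 0 < ls m"
  shows "AE x in lborel. \<forall>m<l. V 0 (\<Theta> ls m x) \<noteq> V 1 (\<Theta> ls m x)"
proof -
  have "AE x in lborel. \<forall>m\<in>{..<l}. \<forall>i. cos (phase ls m i x - \<psi>) \<noteq> 0"
    unfolding phase_def using assms
    by (intro AE_finite_allI AE_all_countable[THEN iffD2] allI AE_cos_nonzero) auto
  then show ?thesis
  proof eventually_elim
    case (elim x)
    show ?case
    proof (intro allI impI)
      fix m assume "m < l"
      then have "cos (\<Theta> ls m x - \<psi>) \<noteq> 0" using elim by (auto simp: \<Theta>_def)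
      then show "V 0 (\<Theta> ls m x) \<noteq> V 1 (\<Theta> ls m x)" using V_diff[of "\<Theta> ls m x"] r(1) by auto
    qed
  qed
qed

text \<open>Each decision on the path of x is a strict inequality between continuous functions and
  so persists nearby. The functions compared at level l depend on the node already reached, hence
  the induction.\<close>

lemma code_locally_const:
  assumes "\<And>m. m < l \<Longrightarrow> V 0 (\<Theta> ls m x) \<noteq> V 1 (\<Theta> ls m x)"
  shows "\<exists>\<delta>>0. \<forall>y. dist x y < \<delta> \<longrightarrow> code ls l y = code ls l x"
  using assms
proof (induction l)
  case (Suc l)
  then obtain \<delta> where \<delta>: "0 < \<delta>" "\<And>y. dist x y < \<delta> \<Longrightarrow> code ls l y = code ls l x" by auto
  let ?D = "\<lambda>y. V 1 (phase ls l (code ls l x) y) - V 0 (phase ls l (code ls l x) y)"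
  have nz: "?D x \<noteq> 0" using Suc.prems[of l] by (simp add: \<Theta>_def)
  have "continuous_on UNIV ?D" by (intro continuous_intros)
  then have "isCont ?D x" using continuous_on_eq_continuous_at[OF open_UNIV] by blast
  then obtain d where d: "0 < d" "\<And>y. dist y x < d \<Longrightarrow> dist (?D y) (?D x) < \<bar>?D x\<bar>"
    unfolding continuous_at_eps_delta using nz by (elim allE[of _ "\<bar>?D x\<bar>"]) auto
  have c: "code ls (Suc l) y = code ls (Suc l) x" if y: "dist x y < min \<delta> d" for y
  proof -
    have "code ls l y = code ls l x" using \<delta>(2) y by simp
    moreover have "\<bar>?D y - ?D x\<bar> < \<bar>?D x\<bar>" using d(2)[of y] y by (simp add: dist_real_def dist_commute)
    then have "?D y > 0 \<longleftrightarrow> ?D x > 0" by (auto simp: abs_if split: if_splits)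
    ultimately show ?thesis by simp
  qed
  have "0 < min \<delta> d" using \<delta>(1) d(1) by simp
  with c show ?case by blast
qed (auto intro: exI[of _ 1])

lemma cell_locally_const:
  assumes "\<And>m. m < l \<Longrightarrow> V 0 (\<Theta> ls m x) \<noteq> V 1 (\<Theta> ls m x)" and x: "x \<in> usq"
  shows "\<exists>\<delta>>0. \<forall>i. \<forall>y. dist x y < \<delta> \<longrightarrow> (y \<in> cell ls l i \<longleftrightarrow> x \<in> cell ls l i)"
proof -
  obtain \<delta> where \<delta>: "0 < \<delta>" "\<And>y. dist x y < \<delta> \<Longrightarrow> code ls l y = code ls l x"
    using code_locally_const[OF assms(1)] by blast
  obtain d where d: "0 < d" "\<And>y. dist y x < d \<Longrightarrow> y \<in> usq"
    using usq_props(1) x unfolding open_dist by blast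
  have "y \<in> cell ls l i \<longleftrightarrow> x \<in> cell ls l i" if "dist x y < min \<delta> d" for i y
    using \<delta>(2)[of y] d(2)[of y] that x by (simp add: cell_def dist_commute)
  moreover have "0 < min \<delta> d" using \<delta>(1) d(1) by simp
  ultimately show ?thesis by blast
qed

end

section \<open>Choosing the frequencies level by level\<close>

context cosine_tree
begin

lemma cell_cong: "(\<And>m. m < l \<Longrightarrow> ls m = ls' m) \<Longrightarrow> cell ls l = cell ls' l"
  using code_cong[of l ls ls'] by (simp add: cell_def fun_eq_iff)

lemma \<Theta>_cong: "(\<And>m. m \<le> l \<Longrightarrow> ls m = ls' m) \<Longrightarrow> \<Theta> ls l = \<Theta> ls' l"
  using code_cong[of l ls ls'] phase_cong[of ls l ls'] by (simp add: \<Theta>_def fun_eq_iff)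

lemma S_cong: "(\<And>m. m < l \<Longrightarrow> ls m = ls' m) \<Longrightarrow> S ls l = S ls' l"
  unfolding S_def by (intro ext sum.cong refl arg_cong[of _ _ cos] fun_cong[OF \<Theta>_cong]) auto

lemma usq_integral_const: "(LINT x|lborel. indicator usq x * c) = (c::real)"
  using usq_props by simp

lemma usq_sum_cells:
  assumes "x \<in> usq"
  shows "(\<Sum>i<2 ^ l. indicator (cell ls l i) x * F i) = (F (code ls l x) :: real)"
proof -
  have "(\<Sum>i<2 ^ l. indicator (cell ls l i) x * F i) = (\<Sum>i<2 ^ l. if i = code ls l x then F i else 0)"
    using assms by (intro sum.cong refl) (auto simp: cell_def indicator_def)
  also have "\<dots> = F (code ls l x)" using code_less[of ls l x] by (simp add: sum.delta)
  finally show ?thesis .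
qed

text \<open>On each of the finitely many cells of level l the phase \<Theta> is linear in x with
  first frequency n, and the cells do not depend on n. The multiple q = 2 is for the second harmonic
  in the lower bound for \<open>Vmax\<close>.\<close>

lemma riemann_lebesgue_code:
  assumes h [measurable]: "h \<in> borel_measurable borel" and hB: "\<And>x. x \<in> usq \<Longrightarrow> \<bar>h x\<bar> \<le> B" and q: "0 < q"
  shows "(\<lambda>n. LINT x|lborel. indicator usq x * (h x * cos (q * \<Theta> (ls(l := n)) l x + \<delta>))) \<longlonglongrightarrow> 0"
proof -
  let ?c = "\<lambda>n i x. cos ((q * real n) * fst x + (q * (\<sigma> l i * real n powr b)) * snd x + \<delta>)"
  let ?g = "\<lambda>n i x. (indicator (cell ls l i) x * h x) * ?c n i x"
  have code_eq: "code (ls(l := n)) l x = code ls l x" for n x by (rule code_cong) simp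
  have eq: "indicator usq x * (h x * cos (q * \<Theta> (ls(l := n)) l x + \<delta>)) = (\<Sum>i<2 ^ l. indicator usq x * ?g n i x)" for n x
  proof (cases "x \<in> usq")
    case True
    have "(\<Sum>i<2 ^ l. ?g n i x) = (\<Sum>i<2 ^ l. indicator (cell ls l i) x * (h x * ?c n i x))"
      by (simp add: ac_simps)
    also have "\<dots> = h x * ?c n (code ls l x) x" by (rule usq_sum_cells[OF True])
    also have "\<dots> = h x * cos (q * \<Theta> (ls(l := n)) l x + \<delta>)"
      by (simp add: \<Theta>_def phase_def code_eq algebra_simps)
    finally show ?thesis using True by simp
  qed simp
  have int: "integrable lborel (\<lambda>x. indicator usq x * ?g n i x)" for n i
  proof (rule integrable_bounded_usq[where B = B])
    have "(\<lambda>x. ?c n i x) \<in> borel_measurable borel"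
      by (intro borel_measurable_continuous_onI continuous_intros)
    then show "?g n i \<in> borel_measurable borel" by measurable
    fix x assume "x \<in> usq"
    from hB[OF this] show "\<bar>?g n i x\<bar> \<le> B"
      by (auto simp: indicator_def abs_mult intro: order_trans[OF mult_left_le])
  qed
  have "(LINT x|lborel. indicator usq x * (h x * cos (q * \<Theta> (ls(l := n)) l x + \<delta>)))
      = (\<Sum>i<2 ^ l. LINT x|lborel. indicator usq x * ?g n i x)" for n
    unfolding eq by (rule Bochner_Integration.integral_sum) (rule int)
  moreover have "(\<lambda>n. \<Sum>i<2 ^ l. LINT x|lborel. indicator usq x * ?g n i x) \<longlonglongrightarrow> (\<Sum>i<(2 ^ l :: nat). 0)"
  proof (intro tendsto_sum riemann_lebesgue_usq[where B = B])
    show "filterlim (\<lambda>n. q * real n) at_top sequentially"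
      using q by (intro filterlim_tendsto_pos_mult_at_top[OF tendsto_const _ filterlim_real_sequentially])
    show "(\<lambda>x. indicator (cell ls l i) x * h x) \<in> borel_measurable borel" for i by measurable
    fix i x assume "x \<in> usq"
    from hB[OF this] show "\<bar>indicator (cell ls l i) x * h x\<bar> \<le> B" by (auto simp: indicator_def)
  qed
  ultimately show ?thesis by simp
qed

text \<open>The maximum is the average plus half of |r| |cos|, and |cos| is at least cos squared.
  This replaces \<open>Vmax\<close> by a trigonometric polynomial with mean
  \<open>\<bar>r\<bar> / 4\<close>, to which the Riemann--Lebesgue lemma applies term by
  term.\<close>

lemma Vmax_lower:
  "\<bar>r\<bar> / 4 + (va 0 + va 1) / 2 * cos \<theta> + (vb 0 + vb 1) / 2 * cos (\<theta> + - (pi / 2)) + \<bar>r\<bar> / 4 * cos (2 * \<theta> + - (2 * \<psi>)) \<le> Vmax \<theta>"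
proof -
  let ?c = "cos (\<theta> - \<psi>)"
  have "Vmax \<theta> = (V 0 \<theta> + V 1 \<theta>) / 2 + \<bar>V 1 \<theta> - V 0 \<theta>\<bar> / 2" by (auto simp: Vmax_def max_def field_simps)
  also have "\<dots> = (V 0 \<theta> + V 1 \<theta>) / 2 + \<bar>r\<bar> * \<bar>?c\<bar> / 2" by (simp only: V_diff abs_mult)
  finally have 1: "Vmax \<theta> = (V 0 \<theta> + V 1 \<theta>) / 2 + \<bar>r\<bar> * \<bar>?c\<bar> / 2" .
  have "?c\<^sup>2 = \<bar>?c\<bar> * \<bar>?c\<bar>" by (simp add: power2_eq_square)
  also have "\<dots> \<le> \<bar>?c\<bar> * 1" by (intro mult_left_mono) auto
  finally have 2: "\<bar>r\<bar> * ?c\<^sup>2 / 2 \<le> \<bar>r\<bar> * \<bar>?c\<bar> / 2" by (simp add: mult_left_mono)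
  have 3: "\<bar>r\<bar> * ?c\<^sup>2 / 2 = \<bar>r\<bar> / 4 + \<bar>r\<bar> / 4 * cos (2 * \<theta> + - (2 * \<psi>))"
  proof -
    have "2 * \<theta> + - (2 * \<psi>) = 2 * (\<theta> - \<psi>)" by simp
    then have "?c\<^sup>2 = (1 + cos (2 * \<theta> + - (2 * \<psi>))) / 2" using cos_double_cos[of "\<theta> - \<psi>"] by simp
    then show ?thesis by (simp only:) (simp add: field_simps)
  qed
  have 4: "cos (\<theta> + - (pi / 2)) = sin \<theta>" by (simp add: cos_diff)
  have 5: "(V 0 \<theta> + V 1 \<theta>) / 2 = (va 0 + va 1) / 2 * cos \<theta> + (vb 0 + vb 1) / 2 * sin \<theta>"
    by (simp add: V_def algebra_simps add_divide_distrib)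
  show ?thesis unfolding 1 4 5 using 2 3 by linarith
qed

lemma eventually_Vmax_integral:
  "\<forall>\<^sub>F n in sequentially. \<bar>r\<bar> / 8 \<le> (LINT x|lborel. indicator usq x * Vmax (\<Theta> (ls(l := n)) l x))"
proof -
  define R where "R = (\<lambda>q \<delta> n. LINT x|lborel. indicator usq x * (1 * cos (q * \<Theta> (ls(l := n)) l x + \<delta>)))"
  have R: "R q \<delta> \<longlonglongrightarrow> 0" if "0 < q" for q \<delta>
    unfolding R_def by (rule riemann_lebesgue_code[where B = 1]) (use that in auto)
  define c1 c2 \<rho> where "c1 = (va 0 + va 1) / 2" and "c2 = (vb 0 + vb 1) / 2" and "\<rho> = \<bar>r\<bar> / 4"
  define k where "k = (\<lambda>n q \<delta> x. indicator usq x * (1 * cos (q * \<Theta> (ls(l := n)) l x + \<delta>)) :: real)"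
  have Rk: "R q \<delta> n = (LINT x|lborel. k n q \<delta> x)" for q \<delta> n by (simp add: R_def k_def)
  have i: "integrable lborel (k n q \<delta>)" for q \<delta> n
    unfolding k_def by (rule integrable_bounded_usq[where B = 1]) auto
  have i0: "integrable lborel (\<lambda>x. indicator usq x * \<rho>)"
    by (rule integrable_bounded_usq[where B = \<rho>]) (auto simp: \<rho>_def)
  have low: "\<rho> + c1 * R 1 0 n + c2 * R 1 (- (pi / 2)) n + \<rho> * R 2 (- (2 * \<psi>)) n
      \<le> (LINT x|lborel. indicator usq x * Vmax (\<Theta> (ls(l := n)) l x))" for n
  proof -
    have "\<rho> + c1 * R 1 0 n + c2 * R 1 (- (pi / 2)) n + \<rho> * R 2 (- (2 * \<psi>)) n
      = (LINT x|lborel. indicator usq x * \<rho> + c1 * k n 1 0 x + c2 * k n 1 (- (pi / 2)) x + \<rho> * k n 2 (- (2 * \<psi>)) x)"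
      unfolding Rk using usq_integral_const[of \<rho>] i i0 by simp
    also have "\<dots> \<le> (LINT x|lborel. indicator usq x * Vmax (\<Theta> (ls(l := n)) l x))"
    proof (rule integral_mono)
      show "integrable lborel (\<lambda>x. indicator usq x * \<rho> + c1 * k n 1 0 x + c2 * k n 1 (- (pi / 2)) x + \<rho> * k n 2 (- (2 * \<psi>)) x)"
        by (intro Bochner_Integration.integrable_add integrable_mult_right i i0)
      show "integrable lborel (\<lambda>x. indicator usq x * Vmax (\<Theta> (ls(l := n)) l x))"
        by (rule integrable_bounded_usq[where B = vm]) (use Vmax_bound in auto)
      fix x
      show "indicator usq x * \<rho> + c1 * k n 1 0 x + c2 * k n 1 (- (pi / 2)) x + \<rho> * k n 2 (- (2 * \<psi>)) x
         \<le> indicator usq x * Vmax (\<Theta> (ls(l := n)) l x)"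
        using Vmax_lower[of "\<Theta> (ls(l := n)) l x"] by (simp add: k_def indicator_def c1_def c2_def \<rho>_def)
    qed
    finally show ?thesis .
  qed
  have "(\<lambda>n. \<rho> + c1 * R 1 0 n + c2 * R 1 (- (pi / 2)) n + \<rho> * R 2 (- (2 * \<psi>)) n)
     \<longlonglongrightarrow> \<rho> + c1 * 0 + c2 * 0 + \<rho> * 0"
    by (intro tendsto_intros R) auto
  \<comment> \<open>The limit is \<open>\<bar>r\<bar> / 4\<close>; half of it is given away to
    obtain a bound valid for all large n.\<close>
  then have "\<forall>\<^sub>F n in sequentially. \<bar>r\<bar> / 8 < \<rho> + c1 * R 1 0 n + c2 * R 1 (- (pi / 2)) n + \<rho> * R 2 (- (2 * \<psi>)) n"
    by (rule order_tendstoD) (use r(1) in \<open>auto simp: \<rho>_def\<close>)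
  then show ?thesis by eventually_elim (use low in \<open>meson less_imp_le order_trans\<close>)
qed

text \<open>Conditioning on the earlier levels is replaced by oscillation: the linear term of
  \<open>exp_le_quadratic\<close> integrates to a quantity tending to 0. One
  \<open>s\<^sup>2\<close> of the factor pays for the quadratic term, the other absorbs this
  vanishing error.\<close>

lemma eventually_exp_moment:
  assumes s: "s \<noteq> 0" "\<bar>s\<bar> \<le> 1"
  shows "\<forall>\<^sub>F n in sequentially. (LINT x|lborel. indicator usq x * exp (s * S (ls(l := n)) (Suc l) x))
     \<le> (1 + 2 * s\<^sup>2) * (LINT x|lborel. indicator usq x * exp (s * S ls l x))"
proof -
  define I where "I = (LINT x|lborel. indicator usq x * exp (s * S ls l x))"
  have sS: "\<bar>s * S ls' m x\<bar> \<le> real m" for ls' m x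
  proof -
    have "\<bar>s * S ls' m x\<bar> \<le> 1 * real m" unfolding abs_mult using s S_bound by (intro mult_mono) auto
    then show ?thesis by simp
  qed
  have eb: "\<bar>exp (s * S ls' m x)\<bar> \<le> exp (real m)" for ls' m x
    using sS[of ls' m x] by (simp add: abs_le_iff)
  have i0: "integrable lborel (\<lambda>x. indicator usq x * exp (s * S ls' m x))" for ls' m
    by (rule integrable_bounded_usq[where B = "exp (real m)"]) (use eb in auto)
  \<comment> \<open>The moment must be strictly positive, since the error \<open>s * R n\<close> is
    to fall below \<open>s\<^sup>2 * I\<close>.\<close>
  have "exp (- real l) = (LINT x|lborel. indicator usq x * exp (- real l))"
    by (rule usq_integral_const[symmetric])
  also have "\<dots> \<le> I" unfolding I_def
  proof (rule integral_mono[OF _ i0])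
    show "integrable lborel (\<lambda>x. indicator usq x * exp (- real l))"
      by (rule integrable_bounded_usq[where B = "exp (- real l)"]) auto
    fix x
    show "indicator usq x * exp (- real l) \<le> indicator usq x * exp (s * S ls l x)"
      using sS[of ls l x] by (intro mult_left_mono) (auto simp: abs_le_iff)
  qed
  finally have I0: "0 < I" using exp_gt_zero[of "- real l"] by linarith
  define R where "R = (\<lambda>n. LINT x|lborel. indicator usq x * (exp (s * S ls l x) * cos (1 * \<Theta> (ls(l := n)) l x + 0)))"
  have R: "R \<longlonglongrightarrow> 0" unfolding R_def
    by (rule riemann_lebesgue_code[where B = "exp (real l)"]) (use eb in auto)
  have iR: "integrable lborel (\<lambda>x. indicator usq x * (exp (s * S ls l x) * cos (1 * \<Theta> (ls(l := n)) l x + 0)))" for n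
  proof (rule integrable_bounded_usq[where B = "exp (real l)"])
    fix x
    have "\<bar>exp (s * S ls l x) * cos (1 * \<Theta> (ls(l := n)) l x + 0)\<bar> \<le> \<bar>exp (s * S ls l x)\<bar> * 1"
      unfolding abs_mult by (intro mult_left_mono) auto
    then show "\<bar>exp (s * S ls l x) * cos (1 * \<Theta> (ls(l := n)) l x + 0)\<bar> \<le> exp (real l)" using eb[of ls l x] by linarith
  qed auto
  have up: "(LINT x|lborel. indicator usq x * exp (s * S (ls(l := n)) (Suc l) x)) \<le> (1 + s\<^sup>2) * I + s * R n" for n
  proof -
    have "(LINT x|lborel. indicator usq x * exp (s * S (ls(l := n)) (Suc l) x))
       \<le> (LINT x|lborel. (1 + s\<^sup>2) * (indicator usq x * exp (s * S ls l x)) + s * (indicator usq x * (exp (s * S ls l x) * cos (1 * \<Theta> (ls(l := n)) l x + 0))))"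
    proof (rule integral_mono[OF i0])
      show "integrable lborel (\<lambda>x. (1 + s\<^sup>2) * (indicator usq x * exp (s * S ls l x)) + s * (indicator usq x * (exp (s * S ls l x) * cos (1 * \<Theta> (ls(l := n)) l x + 0))))"
        by (intro Bochner_Integration.integrable_add integrable_mult_right i0 iR)
      fix x
      let ?C = "cos (\<Theta> (ls(l := n)) l x)"
      have "S (ls(l := n)) l = S ls l" by (rule S_cong) simp
      moreover have "S (ls(l := n)) (Suc l) x = S (ls(l := n)) l x + ?C" by (simp add: S_def)
      ultimately have "exp (s * S (ls(l := n)) (Suc l) x) = exp (s * S ls l x) * exp (s * ?C)"
        by (simp add: distrib_left exp_add)
      also have "\<dots> \<le> exp (s * S ls l x) * (1 + s * ?C + s\<^sup>2)"
      proof (intro mult_left_mono)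
        have a: "\<bar>s * ?C\<bar> \<le> \<bar>s\<bar> * 1" unfolding abs_mult by (intro mult_left_mono) auto
        then have "exp (s * ?C) \<le> 1 + s * ?C + (s * ?C)\<^sup>2" using s by (intro exp_le_quadratic) auto
        moreover have "(s * ?C)\<^sup>2 \<le> s\<^sup>2" using a by (simp add: abs_le_square_iff[symmetric])
        ultimately show "exp (s * ?C) \<le> 1 + s * ?C + s\<^sup>2" by linarith
      qed auto
      finally have "exp (s * S (ls(l := n)) (Suc l) x) \<le> (1 + s\<^sup>2) * exp (s * S ls l x) + s * (exp (s * S ls l x) * ?C)"
        by (simp add: algebra_simps)
      then show "indicator usq x * exp (s * S (ls(l := n)) (Suc l) x)
        \<le> (1 + s\<^sup>2) * (indicator usq x * exp (s * S ls l x)) + s * (indicator usq x * (exp (s * S ls l x) * cos (1 * \<Theta> (ls(l := n)) l x + 0)))"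
        by (simp add: indicator_def)
    qed
    also have "\<dots> = (1 + s\<^sup>2) * I + s * R n"
      using i0[of ls l] iR[of n] by (simp add: I_def R_def)
    finally show ?thesis .
  qed
  have "(\<lambda>n. s * R n) \<longlonglongrightarrow> s * 0" by (intro tendsto_intros R)
  then have "\<forall>\<^sub>F n in sequentially. s * R n < s\<^sup>2 * I"
    by (rule order_tendstoD) (use s I0 in auto)
  then show ?thesis unfolding I_def[symmetric]
  proof eventually_elim
    case (elim n)
    have "(1 + s\<^sup>2) * I + s * R n \<le> (1 + 2 * s\<^sup>2) * I" using elim by (simp add: algebra_simps)
    then show ?case using up[of n] by linarith
  qed
qed

text \<open>The tolerance is \<epsilon> on the cell but only e off it. Summed over all nodes of a
  level, \<epsilon> is paid once, while e is paid up to 2^l times and can be chosen after L is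
  known.\<close>

definition close_at :: "real \<Rightarrow> (nat \<Rightarrow> nat) \<Rightarrow> nat \<Rightarrow> nat \<Rightarrow> nat \<Rightarrow> real \<times> real \<Rightarrow> bool" where
  "close_at e ls l i k x \<longleftrightarrow>
     \<bar>sg k * Hint b cp cm (u k) (block b (cell ls l i) (\<sigma> l i) (ls l)) x
        - indicator (cell ls l i) x * V (side l i k) (phase ls l i x)\<bar> \<le> \<epsilon> * indicator (cell ls l i) x + e"

lemma eventually_close_at:
  assumes x: "x \<in> usq" and nz: "\<And>m. m < l \<Longrightarrow> V 0 (\<Theta> ls m x) \<noteq> V 1 (\<Theta> ls m x)"
    and l: "l < L" and i: "i < 2 ^ l" and k: "k < 2 ^ L" and e: "0 < e"
  shows "\<forall>\<^sub>F n in sequentially. close_at e (ls(l := n)) l i k x"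
proof -
  obtain \<delta> where \<delta>: "0 < \<delta>" "\<And>y. dist x y < \<delta> \<Longrightarrow> y \<in> cell ls l i \<longleftrightarrow> x \<in> cell ls l i"
    using cell_locally_const[OF nz x] by blast
  interpret bp: block_point b cp cm "u k" "\<sigma> l i" "cell ls l i" x \<delta>
    by unfold_locales (use b x \<delta> in \<open>auto simp: cell_def[abs_def] cell_sets[unfolded cell_def]\<close>)
  have "\<forall>\<^sub>F n in sequentially. dist (Hint b cp cm (u k) (block b (cell ls l i) (\<sigma> l i) n) x
      - bp.g * integral {0..real n} (osc_diff b (bp.\<theta> n) 1 (\<sigma> l i * u k * cp) (- 1) (\<sigma> l i * u k * cm))) 0 < e"
    by (rule tendstoD[OF bp.asymptotic e])
  then show ?thesis using approx[OF l i k]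
  proof eventually_elim
    case (elim n)
    define H where "H = Hint b cp cm (u k) (block b (cell ls l i) (\<sigma> l i) n) x"
    define J where "J = integral {0..real n} (osc_diff b (bp.\<theta> n) 1 (\<sigma> l i * u k * cp) (- 1) (\<sigma> l i * u k * cm))"
    have c: "cell (ls(l := n)) l = cell ls l" by (rule cell_cong) simp
    have ph: "phase (ls(l := n)) l i x = bp.\<theta> n" by (simp add: phase_def bp.\<theta>_def)
    have a: "\<bar>H - bp.g * J\<bar> < e" using elim(1) by (simp add: H_def J_def)
    have vb: "\<bar>sg k * J - V (side l i k) (bp.\<theta> n)\<bar> \<le> \<epsilon>"
      using elim(2) by (simp add: J_def V_def side_def Let_def)
    define v where "v = V (side l i k) (bp.\<theta> n)"
    have eq: "sg k * H - bp.g * v = sg k * (H - bp.g * J) + bp.g * (sg k * J - v)"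
      by (simp add: right_diff_distrib)
    have "\<bar>sg k * (H - bp.g * J)\<bar> \<le> e" unfolding abs_mult sg mult_1 using a by (rule less_imp_le)
    moreover have "\<bar>bp.g * (sg k * J - v)\<bar> \<le> \<epsilon> * bp.g"
    proof (cases "x \<in> cell ls l i")
      case True
      then have "bp.g = 1" unfolding bp.g_def by simp
      with vb show ?thesis unfolding v_def by (simp only: mult_1 mult_1_right)
    next
      case False
      then have "bp.g = 0" unfolding bp.g_def by simp
      then show ?thesis by (simp only: mult_zero_left mult_zero_right abs_zero order_refl)
    qed
    ultimately have "\<bar>sg k * H - bp.g * v\<bar> \<le> \<epsilon> * bp.g + e"
      unfolding eq by linarith
    then show ?case
      unfolding close_at_def c ph H_def bp.g_def v_def fun_upd_same .
  qed
qed

text \<open>Pointwise convergence almost everywhere, for the finitely many nodes and leaves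
  concerned, becomes convergence in measure by dominated convergence. An exceptional set replaces
  any uniformity in x.\<close>

lemma eventually_bad_set_small:
  assumes l: "l < L" and pos: "\<And>m. m < l \<Longrightarrow> 0 < ls m" and e: "0 < e" and \<eta>: "0 < \<eta>"
  shows "\<forall>\<^sub>F n in sequentially. \<exists>Z\<in>sets borel. Z \<subseteq> usq \<and> measure lborel Z \<le> \<eta> \<and>
     (\<forall>x\<in>usq - Z. \<forall>i<2 ^ l. \<forall>k<2 ^ L. close_at e (ls(l := n)) l i k x)"
proof -
  have ae: "AE x in lborel. \<forall>m<l. V 0 (\<Theta> ls m x) \<noteq> V 1 (\<Theta> ls m x)"
    by (rule AE_split) (rule pos)
  define Z where "Z = (\<lambda>n. {x \<in> usq. \<exists>i\<in>{..<2 ^ l}. \<exists>k\<in>{..<2 ^ L}. \<not> close_at e (ls(l := n)) l i k x})"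
  have [measurable]: "usq \<in> sets borel" by (rule usq_props)
  have Zs [measurable]: "Z n \<in> sets borel" for n
  proof -
    have [measurable]: "Hint b cp cm (u k) (block b (cell (ls(l := n)) l i) (\<sigma> l i) ((ls(l := n)) l)) \<in> borel_measurable borel" for k i
      by (intro Hint_measurable block_measurable cell_sets)
    have "{x \<in> space borel. x \<in> usq \<and> (\<exists>i\<in>{..<2 ^ l}. \<exists>k\<in>{..<2 ^ L}. \<not> close_at e (ls(l := n)) l i k x)} \<in> sets borel"
      unfolding close_at_def by measurable
    then show ?thesis by (simp add: Z_def)
  qed
  have "(\<lambda>n. LINT x|lborel. indicator (Z n) x) \<longlonglongrightarrow> (LINT x|(lborel :: (real \<times> real) measure). (0::real))"
  proof (rule integral_dominated_convergence[where w = "indicator usq"])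
    show "integrable lborel (indicator usq :: _ \<Rightarrow> real)"
      using integrable_bounded_usq[of "\<lambda>_. 1" 1] by simp
    show "AE x in lborel. norm (indicator (Z n) x :: real) \<le> indicator usq x" for n
      by (auto simp: Z_def indicator_def)
    show "AE x in lborel. (\<lambda>n. indicator (Z n) x :: real) \<longlonglongrightarrow> 0"
      using ae
    proof eventually_elim
      case (elim x)
      show ?case
      proof (cases "x \<in> usq")
        case True
        have "\<forall>\<^sub>F n in sequentially. \<forall>i\<in>{..<2 ^ l}. \<forall>k\<in>{..<2 ^ L}. close_at e (ls(l := n)) l i k x"
          using True elim l e by (intro eventually_ball_finite ballI eventually_close_at) auto
        then have "\<forall>\<^sub>F n in sequentially. indicator (Z n) x = (0 :: real)"
          by eventually_elim (auto simp: Z_def indicator_def)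
        then show ?thesis by (rule tendsto_eventually)
      qed (simp add: Z_def)
    qed
  qed auto
  then have "(\<lambda>n. measure lborel (Z n)) \<longlonglongrightarrow> 0" by simp
  then have "\<forall>\<^sub>F n in sequentially. measure lborel (Z n) < \<eta>" by (rule order_tendstoD) (use \<eta> in auto)
  then show ?thesis
  proof eventually_elim
    case (elim n)
    show ?case
    proof (intro bexI[of _ "Z n"] conjI ballI allI impI)
      show "measure lborel (Z n) \<le> \<eta>" using elim by simp
    qed (auto simp: Z_def Zs[unfolded Z_def])
  qed
qed

text \<open>All that is asked of the frequency of level l, given the earlier ones: operator
  asymptotics off a small set, the mean gain of the maximum, and the growth of the moment of the
  partial sums. Both signs of s occur so that the modulus of the sum is controlled.\<close>

definition good :: "real \<Rightarrow> real \<Rightarrow> real \<Rightarrow> (nat \<Rightarrow> nat) \<Rightarrow> nat \<Rightarrow> bool" where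
  "good e \<eta> s ls l \<longleftrightarrow> 0 < ls l \<and>
     (\<exists>Z\<in>sets borel. Z \<subseteq> usq \<and> measure lborel Z \<le> \<eta> \<and>
        (\<forall>x\<in>usq - Z. \<forall>i<2 ^ l. \<forall>k<2 ^ L. close_at e ls l i k x)) \<and>
     \<bar>r\<bar> / 8 \<le> (LINT x|lborel. indicator usq x * Vmax (\<Theta> ls l x)) \<and>
     (\<forall>s'\<in>{s, - s}. (LINT x|lborel. indicator usq x * exp (s' * S ls (Suc l) x))
        \<le> (1 + 2 * s\<^sup>2) * (LINT x|lborel. indicator usq x * exp (s' * S ls l x)))"

lemma good_cong:
  assumes "\<And>m. m \<le> l \<Longrightarrow> ls m = ls' m"
  shows "good e \<eta> s ls l \<longleftrightarrow> good e \<eta> s ls' l"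
proof -
  have "cell ls l = cell ls' l" "\<Theta> ls l = \<Theta> ls' l" "S ls (Suc l) = S ls' (Suc l)" "S ls l = S ls' l" "phase ls l = phase ls' l" "ls l = ls' l"
    using assms by (auto intro!: cell_cong \<Theta>_cong S_cong phase_cong)
  then show ?thesis unfolding good_def close_at_def by simp
qed

lemma exists_good:
  assumes e: "0 < e" and \<eta>: "0 < \<eta>" and s: "s \<noteq> 0" "\<bar>s\<bar> \<le> 1"
  shows "\<exists>ls. \<forall>m<L. good e \<eta> s ls m"
proof -
  have "\<exists>ls. \<forall>m<l. good e \<eta> s ls m" if "l \<le> L" for l
    using that
  proof (induction l)
    case (Suc l)
    then obtain ls where ls: "\<And>m. m < l \<Longrightarrow> good e \<eta> s ls m" by auto
    then have pos: "\<And>m. m < l \<Longrightarrow> 0 < ls m" by (auto simp: good_def)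
    have Seq: "S (ls(l := n)) l = S ls l" for n by (rule S_cong) simp
    \<comment> \<open>Each clause holds for all large n once the earlier frequencies are fixed, so a
      common n exists. Levels before l do not see the change by \<open>good_cong\<close>.\<close>
    have "\<forall>\<^sub>F n in sequentially. good e \<eta> s (ls(l := n)) l"
      unfolding good_def ball_simps Seq
    proof (intro eventually_conj)
      show "\<forall>\<^sub>F n in sequentially. 0 < (ls(l := n)) l" by (simp add: eventually_gt_at_top)
    qed (use Suc.prems e \<eta> s pos eventually_bad_set_small[of l ls e \<eta>] eventually_Vmax_integral[of ls l]
           eventually_exp_moment[of s ls l] eventually_exp_moment[of "- s" ls l] in auto)
    then obtain n where n: "good e \<eta> s (ls(l := n)) l"
      using eventually_happens' sequentially_bot by blast
    have "good e \<eta> s (ls(l := n)) m" if "m < Suc l" for m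
      using n ls[of m] good_cong[of m ls "ls(l := n)" e \<eta> s] that by (cases "m = l") auto
    then show ?case by blast
  qed simp
  then show ?thesis by blast
qed

end

section \<open>Lower bounds for the maximal operator\<close>

text \<open>The graph of the p-th power lies above its tangent at \<tau>, proved by Young's
  inequality for the ratio y / \<tau>. Integrated over a probability space this is Jensen's
  inequality.\<close>

lemma powr_ge_tangent:
  fixes p \<tau> y :: real
  assumes p: "1 < p" and \<tau>: "0 < \<tau>" and y: "0 \<le> y"
  shows "\<tau> powr p + p * \<tau> powr (p - 1) * (y - \<tau>) \<le> y powr p"
proof -
  have tp: "\<tau> powr (p - 1) * \<tau> = \<tau> powr p" using \<tau> powr_mult_base[of \<tau> "p - 1"] by (simp add: mult.commute)
  show ?thesis
  proof (cases "y = 0")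
    case True
    have "\<tau> powr p \<le> p * \<tau> powr p" using p \<tau> by simp
    then show ?thesis using True tp by (simp add: mult.assoc)
  next
    case False
    define z where "z = y / \<tau>"
    have z: "0 < z" "y = z * \<tau>" using False y \<tau> by (auto simp: z_def)
    have "(z powr p) powr (1 / p) * 1 powr (1 - 1 / p) \<le> 1 / p * z powr p + (1 - 1 / p) * 1"
      by (rule Youngs_inequality_0) (use p z in auto)
    then have "z \<le> 1 / p * z powr p + (1 - 1 / p)" using p z by (simp add: powr_powr)
    then have "p * z \<le> p * (1 / p * z powr p + (1 - 1 / p))" using p by (intro mult_left_mono) auto
    also have "\<dots> = z powr p + (p - 1)" using p by (simp add: field_simps)
    finally have "1 + p * (z - 1) \<le> z powr p" by (simp add: algebra_simps)
    then have "\<tau> powr p * (1 + p * (z - 1)) \<le> \<tau> powr p * z powr p" by (intro mult_left_mono) auto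
    also have "\<dots> = y powr p" using z \<tau> by (simp add: powr_mult)
    also have "\<tau> powr p * (1 + p * (z - 1)) = \<tau> powr p + p * \<tau> powr (p - 1) * (y - \<tau>)"
      unfolding z(2) tp[symmetric] by (simp add: algebra_simps)
    finally show ?thesis .
  qed
qed

text \<open>From z / p \<le> exp (z / p). It converts one exponential moment into a p-th moment for
  every p, with a constant depending on p alone.\<close>

lemma powr_le_exp:
  fixes p z :: real
  assumes p: "0 < p" and z: "0 \<le> z"
  shows "z powr p \<le> p powr p * exp z"
proof -
  have "z / p \<le> exp (z / p)" using exp_ge_add_one_self[of "z / p"] by linarith
  then have "z \<le> p * exp (z / p)" using p by (simp add: field_simps)
  then have "z powr p \<le> (p * exp (z / p)) powr p" using p z by (intro powr_mono2) auto
  also have "\<dots> = p powr p * exp z" using p by (simp add: powr_mult powr_def[of "exp _"])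
  finally show ?thesis .
qed

lemma epowr_mono:
  assumes "x \<le> y" "0 \<le> a"
  shows "epowr x a \<le> epowr y a"
proof (cases "y = \<infinity>")
  case False
  then have "x \<noteq> \<infinity>" "enn2real x \<le> enn2real y"
    using assms by (auto simp: enn2real_mono less_top top.not_eq_extremum)
  then show ?thesis using False assms by (auto simp: epowr_def intro!: ennreal_leI powr_mono2)
qed (simp add: epowr_def)

lemma epowr_ennreal: "0 \<le> x \<Longrightarrow> epowr (ennreal x) a = ennreal (x powr a)"
  by (simp add: epowr_def)

text \<open>Only the first moment of T over G is known. The tangent inequality at \<tau> turns it
  into a p-th moment over the unit square. T may be negative, so its positive part is used, which
  does not decrease the integral.\<close>

lemma HUnorm_lower:
  assumes p: "1 < p" and F: "F \<in> borel_measurable borel" and Fn: "Lpnorm p (\<lambda>x. ennreal \<bar>F x\<bar>) \<le> 1"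
    and G: "G \<in> sets borel" "G \<subseteq> usq" and T [measurable]: "T \<in> borel_measurable borel" and TB: "\<And>x. \<bar>T x\<bar> \<le> B"
    and le: "AE x in lborel. x \<in> G \<longrightarrow> ennreal (T x) \<le> HU b cp cm U F x"
    and \<tau>: "0 < \<tau>" "\<tau> \<le> (LINT x|lborel. indicator G x * T x)"
  shows "ennreal \<tau> \<le> HUnorm b cp cm U p"
proof -
  note [measurable] = G(1)
  define y where "y = (\<lambda>x. indicator G x * max 0 (T x))"
  have [measurable]: "y \<in> borel_measurable borel" unfolding y_def by measurable
  have y0: "0 \<le> y x" for x by (simp add: y_def)
  have yB: "y x \<le> B" for x using TB[of x] by (auto simp: y_def indicator_def)
  have ypB: "\<bar>y x powr p\<bar> \<le> B powr p" for x using y0[of x] yB[of x] p by (simp add: powr_mono2)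
  have yu: "indicator usq x * y x = y x" "indicator usq x * (y x powr p) = y x powr p" for x
    using G by (auto simp: y_def indicator_def)
  have iy: "integrable lborel (\<lambda>x. indicator usq x * y x)"
    by (rule integrable_bounded_usq[where B = B]) (use y0 yB in auto)
  have iyp: "integrable lborel (\<lambda>x. indicator usq x * (y x powr p))"
    by (rule integrable_bounded_usq[where B = "B powr p"]) (use ypB in auto)
  have iT: "integrable lborel (\<lambda>x. indicator G x * T x)"
  proof -
    have "integrable lborel (\<lambda>x. indicator usq x * (indicator G x * T x))"
      by (rule integrable_bounded_usq[where B = "\<bar>B\<bar>"]) (use TB order_trans[OF TB abs_ge_self] in \<open>auto simp: indicator_def\<close>)
    moreover have "indicator usq x * (indicator G x * T x) = indicator G x * T x" for x using G by (auto simp: indicator_def)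
    ultimately show ?thesis by simp
  qed
  have "(LINT x|lborel. indicator G x * T x) \<le> (LINT x|lborel. indicator usq x * y x)"
    by (rule integral_mono[OF iT iy]) (use G in \<open>auto simp: y_def indicator_def\<close>)
  then have \<tau>y: "\<tau> \<le> (LINT x|lborel. indicator usq x * y x)" using \<tau> by simp
  define c where "c = p * \<tau> powr (p - 1)"
  have c0: "0 \<le> c" using p by (simp add: c_def)
  have iu: "integrable lborel (\<lambda>x. indicator usq x * (a::real))" for a
    by (rule integrable_bounded_usq[where B = "\<bar>a\<bar>"]) auto
  have "\<tau> powr p \<le> \<tau> powr p + c * ((LINT x|lborel. indicator usq x * y x) - \<tau>)"
    using c0 \<tau>y by simp
  also have "\<dots> = (LINT x|lborel. indicator usq x * (\<tau> powr p) + c * (indicator usq x * y x - indicator usq x * \<tau>))"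
    using iy iu usq_props(4) by simp
  also have "\<dots> \<le> (LINT x|lborel. indicator usq x * (y x powr p))"
  proof (rule integral_mono[OF _ iyp])
    show "integrable lborel (\<lambda>x. indicator usq x * (\<tau> powr p) + c * (indicator usq x * y x - indicator usq x * \<tau>))"
      by (intro Bochner_Integration.integrable_add integrable_mult_right Bochner_Integration.integrable_diff iy iu)
    fix x
    show "indicator usq x * (\<tau> powr p) + c * (indicator usq x * y x - indicator usq x * \<tau>) \<le> indicator usq x * (y x powr p)"
      using powr_ge_tangent[OF p \<tau>(1) y0[of x]] by (simp add: c_def indicator_def)
  qed
  finally have "ennreal (\<tau> powr p) \<le> ennreal (LINT x|lborel. y x powr p)" by (simp add: yu ennreal_leI)
  also have "\<dots> = (\<integral>\<^sup>+ x. ennreal (y x powr p) \<partial>lborel)"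
    by (rule nn_integral_eq_integral[symmetric]) (use iyp in \<open>auto simp: yu\<close>)
  also have "\<dots> \<le> (\<integral>\<^sup>+ x. epowr (HU b cp cm U F x) p \<partial>lborel)"
  proof (rule nn_integral_mono_AE)
    show "AE x in lborel. ennreal (y x powr p) \<le> epowr (HU b cp cm U F x) p"
      using le
    proof eventually_elim
      case (elim x)
      show ?case
      proof (cases "x \<in> G \<and> 0 \<le> T x")
        case True
        then have "ennreal (y x) \<le> HU b cp cm U F x" using elim by (simp add: y_def)
        from epowr_mono[OF this, of p] show ?thesis using y0[of x] p by (simp add: epowr_ennreal)
      next
        case False
        then have "y x = 0" by (auto simp: y_def indicator_def)
        then show ?thesis by simp
      qed
    qed
  qed
  finally have "epowr (ennreal (\<tau> powr p)) (1 / p) \<le> Lpnorm p (HU b cp cm U F)"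
    unfolding Lpnorm_def using p by (intro epowr_mono) auto
  moreover have "epowr (ennreal (\<tau> powr p)) (1 / p) = ennreal \<tau>"
    using p \<tau> by (simp add: epowr_ennreal powr_powr)
  ultimately have "ennreal \<tau> \<le> Lpnorm p (HU b cp cm U F)" by simp
  then show ?thesis unfolding HUnorm_def
    by (intro SUP_upper2[of F]) (use F Fn in auto)
qed

section \<open>Norm of the tree function and mean of its maximal function\<close>

context cosine_tree
begin

definition nodes :: "(nat \<times> nat) set" where "nodes = (SIGMA l:{..<L}. {..<2 ^ l})"

lemma finite_nodes: "finite nodes" unfolding nodes_def by auto

lemma sum_nodes: "(\<Sum>j\<in>nodes. f (fst j) (snd j)) = (\<Sum>l<L. \<Sum>i<2 ^ l. f l i)"
  unfolding nodes_def by (subst sum.Sigma) (auto simp: case_prod_beta)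

definition tree_block :: "(nat \<Rightarrow> nat) \<Rightarrow> nat \<times> nat \<Rightarrow> real \<times> real \<Rightarrow> real" where
  "tree_block ls j = block b (cell ls (fst j) (snd j)) (\<sigma> (fst j) (snd j)) (ls (fst j))"

definition tree_fun :: "(nat \<Rightarrow> nat) \<Rightarrow> real \<times> real \<Rightarrow> real" where
  "tree_fun ls y = (\<Sum>j\<in>nodes. tree_block ls j y)"

lemma tree_fun_eq: "tree_fun ls x = indicator usq x * S ls L x"
proof -
  have "tree_block ls j x = indicator (cell ls (fst j) (snd j)) x * cos (phase ls (fst j) (snd j) x)" for j
    by (simp add: tree_block_def block_def phase_def)
  then have "tree_fun ls x = (\<Sum>j\<in>nodes. indicator (cell ls (fst j) (snd j)) x * cos (phase ls (fst j) (snd j) x))"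
    unfolding tree_fun_def by (simp only:)
  also have "\<dots> = (\<Sum>l<L. \<Sum>i<2 ^ l. indicator (cell ls l i) x * cos (phase ls l i x))"
    by (rule sum_nodes)
  also have "\<dots> = indicator usq x * S ls L x"
  proof (cases "x \<in> usq")
    case True
    then show ?thesis unfolding usq_sum_cells[OF True] S_def \<Theta>_def by simp
  next
    case False
    then have "indicator (cell ls l i) x = (0 :: real)" for l i by (simp add: cell_def)
    then show ?thesis using False by simp
  qed
  finally show ?thesis .
qed

text \<open>The L factors \<open>1 + 2 * s\<^sup>2\<close> multiply to at most
  \<open>exp (2 * s\<^sup>2 * L)\<close>, and the scale of s makes the exponent 2. This is the
  source of the size sqrt L of the tree function.\<close>

lemma exp_moment_bound:
  assumes good: "\<And>m. m < L \<Longrightarrow> good e \<eta> s ls m" and s: "s' \<in> {s, - s}" and sL: "s\<^sup>2 * real L = 1"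
  shows "(LINT x|lborel. indicator usq x * exp (s' * S ls L x)) \<le> exp 2"
proof -
  have "(LINT x|lborel. indicator usq x * exp (s' * S ls l x)) \<le> (1 + 2 * s\<^sup>2) ^ l" if "l \<le> L" for l
    using that
  proof (induction l)
    case 0
    then show ?case using usq_props(4) by (simp add: S_def)
  next
    case (Suc l)
    have "(LINT x|lborel. indicator usq x * exp (s' * S ls (Suc l) x))
       \<le> (1 + 2 * s\<^sup>2) * (LINT x|lborel. indicator usq x * exp (s' * S ls l x))"
      using good[of l] s Suc.prems by (auto simp: good_def)
    also have "\<dots> \<le> (1 + 2 * s\<^sup>2) * (1 + 2 * s\<^sup>2) ^ l"
      using Suc by (intro mult_left_mono) auto
    finally show ?case by simp
  qed
  from this[OF order_refl] have "(LINT x|lborel. indicator usq x * exp (s' * S ls L x)) \<le> (1 + 2 * s\<^sup>2) ^ L" .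
  also have "\<dots> \<le> exp (2 * s\<^sup>2) ^ L" by (intro power_mono exp_ge_add_one_self) auto
  also have "\<dots> = exp (2 * (s\<^sup>2 * real L))" by (simp add: exp_of_nat_mult[symmetric] ac_simps)
  finally show ?thesis by (simp add: sL)
qed

text \<open>On each level the point lies in a single cell, which costs \<epsilon>. The remaining
  errors \<open>\<epsilon> / 2 ^ L\<close> form a geometric sum over the levels with total at most
  \<epsilon>. The reference values add up to the sum of the maxima because the leaf is the one
  reached by x.\<close>

lemma close_sum:
  assumes x: "x \<in> usq" and close: "\<And>l i k. l < L \<Longrightarrow> i < 2 ^ l \<Longrightarrow> k < 2 ^ L \<Longrightarrow> close_at (\<epsilon> / 2 ^ L) ls l i k x"
  shows "\<bar>sg (code ls L x) * (\<Sum>j\<in>nodes. Hint b cp cm (u (code ls L x)) (tree_block ls j) x) - (\<Sum>l<L. Vmax (\<Theta> ls l x))\<bar> \<le> 2 * real L * \<epsilon>"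
proof -
  let ?k = "code ls L x"
  let ?H = "\<lambda>l i. Hint b cp cm (u ?k) (tree_block ls (l, i)) x"
  let ?V = "\<lambda>l i. indicator (cell ls l i) x * V (side l i ?k) (phase ls l i x)"
  have H: "sg ?k * (\<Sum>j\<in>nodes. Hint b cp cm (u ?k) (tree_block ls j) x) = (\<Sum>l<L. \<Sum>i<2 ^ l. sg ?k * ?H l i)"
    using sum_nodes[of "\<lambda>l i. sg ?k * ?H l i"] by (simp add: sum_distrib_left)
  have Vs: "(\<Sum>l<L. Vmax (\<Theta> ls l x)) = (\<Sum>l<L. \<Sum>i<2 ^ l. ?V l i)"
    by (intro sum.cong refl) (use usq_sum_cells[OF x] V_side_code in \<open>auto simp: \<Theta>_def\<close>)
  have "\<bar>(\<Sum>l<L. \<Sum>i<2 ^ l. sg ?k * ?H l i) - (\<Sum>l<L. \<Sum>i<2 ^ l. ?V l i)\<bar> = \<bar>\<Sum>l<L. \<Sum>i<2 ^ l. (sg ?k * ?H l i - ?V l i)\<bar>"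
    by (simp only: sum_subtractf)
  also have "\<dots> \<le> (\<Sum>l<L. \<Sum>i<2 ^ l. \<bar>sg ?k * ?H l i - ?V l i\<bar>)"
    by (rule order_trans[OF sum_abs]) (intro sum_mono sum_abs)
  also have "\<dots> \<le> (\<Sum>l<L. \<Sum>i<2 ^ l. (indicator (cell ls l i) x * \<epsilon> + \<epsilon> / 2 ^ L))"
    using close[OF _ _ code_less] by (intro sum_mono) (auto simp: close_at_def tree_block_def mult.commute)
  also have "\<dots> = (\<Sum>l<L. \<epsilon> + 2 ^ l * (\<epsilon> / 2 ^ L))"
    by (simp add: sum.distrib usq_sum_cells[OF x])
  also have "\<dots> = real L * \<epsilon> + (\<Sum>l<L. 2 ^ l) * (\<epsilon> / 2 ^ L)" by (simp only: sum.distrib sum_distrib_right) simp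
  also have "\<dots> \<le> real L * \<epsilon> + 2 ^ L * (\<epsilon> / 2 ^ L)"
  proof -
    have "(\<Sum>l<L. 2 ^ l) \<le> (2 ^ L :: real)" by (simp add: sum_gp_strict)
    then show ?thesis using \<epsilon> by (intro add_left_mono mult_right_mono) auto
  qed
  also have "\<dots> \<le> 2 * real L * \<epsilon>" using L \<epsilon> by simp
  finally show ?thesis unfolding H Vs by simp
qed

lemma tree_lower_bound:
  assumes p: "1 < p" and uU: "\<And>k. k < 2 ^ L \<Longrightarrow> u k \<in> U" and \<epsilon>r: "\<epsilon> \<le> \<bar>r\<bar> / 64"
  shows "ennreal (\<bar>r\<bar> / 16 / ((2 * exp 2) powr (1 / p) * p) * sqrt (real L)) \<le> HUnorm b cp cm U p"
proof -
  define c0 where "c0 = \<bar>r\<bar> / 8"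
  define s where "s = 1 / sqrt (real L)"
  \<comment> \<open>There are L exceptional sets of measure at most \<eta>, and the sum of the
    maxima is at most \<open>L * vm\<close>, so removing them costs at most
    \<open>L\<^sup>2 * \<eta> * vm\<close>, at most a quarter of the gain \<open>L * c0\<close>. The
    summand 1 keeps the divisor positive.\<close>
  define \<eta> where "\<eta> = c0 / (4 * real L * (vm + 1))"
  have L0: "0 < real L" using L by simp
  have c0: "0 < c0" using r by (simp add: c0_def)
  have vm0: "0 \<le> vm" by (simp add: vm_def)
  have \<eta>0: "0 < \<eta>" using c0 L0 vm0 by (simp add: \<eta>_def)
  have s: "s \<noteq> 0" "\<bar>s\<bar> \<le> 1" "0 < s" and sL: "s\<^sup>2 * real L = 1" using L by (auto simp: s_def power_divide)
  obtain ls where good: "\<And>m. m < L \<Longrightarrow> good (\<epsilon> / 2 ^ L) \<eta> s ls m"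
    using exists_good[OF _ \<eta>0 s(1,2), of "\<epsilon> / 2 ^ L"] \<epsilon> by auto
  define Q where "Q = (\<lambda>m Z. Z \<in> sets borel \<and> Z \<subseteq> usq \<and> measure lborel Z \<le> \<eta> \<and>
        (\<forall>x\<in>usq - Z. \<forall>i<2 ^ m. \<forall>k<2 ^ L. close_at (\<epsilon> / 2 ^ L) ls m i k x))"
  have "\<exists>Z. Q m Z" if "m < L" for m
    using good[OF that, unfolded good_def Bex_def] unfolding Q_def by (elim conjE)
  then have "\<forall>m\<in>{..<L}. \<exists>Z. Q m Z" by simp
  from bchoice[OF this] obtain Z where Q: "\<And>m. m < L \<Longrightarrow> Q m (Z m)" by auto
  then have Z: "\<And>m. m < L \<Longrightarrow> Z m \<in> sets borel" "\<And>m. m < L \<Longrightarrow> Z m \<subseteq> usq" "\<And>m. m < L \<Longrightarrow> measure lborel (Z m) \<le> \<eta>"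
    by (simp_all add: Q_def)
  have Zc: "close_at (\<epsilon> / 2 ^ L) ls m i k x" if "m < L" "x \<in> usq" "x \<notin> Z m" "i < 2 ^ m" "k < 2 ^ L" for m x i k
    using Q[OF that(1)] that unfolding Q_def by simp
  define ZZ where "ZZ = (\<Union>m<L. Z m)"
  define G where "G = usq - ZZ"
  have [measurable]: "usq \<in> sets borel" by (rule usq_props)
  have ZZ [measurable]: "ZZ \<in> sets borel" unfolding ZZ_def using Z by auto
  have ZZu: "ZZ \<subseteq> usq" using Z by (auto simp: ZZ_def)
  have fin: "emeasure lborel A < \<infinity>" if "A \<subseteq> usq" for A
    using emeasure_mono[OF that, of lborel] usq_props by (simp add: order_le_less_trans)
  have mZZ: "measure lborel ZZ \<le> real L * \<eta>"
  proof -
    have "measure lborel ZZ \<le> (\<Sum>m<L. measure lborel (Z m))"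
      unfolding ZZ_def using Z fin[OF Z(2)] by (intro measure_UNION_le) (auto simp: fmeasurable_def)
    also have "\<dots> \<le> (\<Sum>m<L. \<eta>)" using Z by (intro sum_mono) auto
    finally show ?thesis by simp
  qed

  \<comment> \<open>The p-th moment of the sum is at most \<open>2 * exp 2\<close> times the p-th
    power of \<open>p * sqrt L\<close>; dividing by K therefore brings the norm of the test function
    below 1.\<close>
  define K where "K = (2 * exp 2) powr (1 / p) * p * sqrt (real L)"
  have K: "0 < K" using p L by (simp add: K_def)
  define F where "F = (\<lambda>x. (1 / K) * tree_fun ls x)"
  have F_eq: "F x = (1 / K) * (indicator usq x * S ls L x)" for x by (simp add: F_def tree_fun_eq)
  have Fm [measurable]: "F \<in> borel_measurable borel"
    unfolding F_def tree_fun_eq by measurable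

  have Fn: "Lpnorm p (\<lambda>x. ennreal \<bar>F x\<bar>) \<le> 1"
  proof -
    define c where "c = p powr p * sqrt (real L) powr p / K powr p"
    have c: "0 \<le> c" by (simp add: c_def)
    have Kp: "K powr p = (2 * exp 2) * (p powr p * sqrt (real L) powr p)"
      using p L by (simp add: K_def powr_mult powr_powr)
    have cK: "c * (exp 2 + exp 2) = 1" using p L by (simp add: c_def Kp)
    \<comment> \<open>With z the modulus of \<open>s * S\<close>, exp z is one of the two
      exponentials with signs s and -s, hence at most their sum.\<close>
    have pt: "\<bar>F x\<bar> powr p \<le> c * (indicator usq x * exp (s * S ls L x) + indicator usq x * exp (- s * S ls L x))" for x
    proof (cases "x \<in> usq")
      case True
      define z where "z = s * \<bar>S ls L x\<bar>"
      have z: "0 \<le> z" using s by (simp add: z_def)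
      have "\<bar>F x\<bar> = (sqrt (real L) * z) / K" using True K L by (simp add: F_eq z_def s_def abs_mult)
      then have "\<bar>F x\<bar> powr p = sqrt (real L) powr p / K powr p * z powr p"
        using K z by (simp add: powr_divide powr_mult)
      also have "\<dots> \<le> sqrt (real L) powr p / K powr p * (p powr p * exp z)"
        using powr_le_exp[of p z] p z by (intro mult_left_mono) auto
      also have "\<dots> = c * exp z" by (simp add: c_def)
      also have "\<dots> \<le> c * (exp (s * S ls L x) + exp (- s * S ls L x))"
        using c by (intro mult_left_mono) (auto simp: z_def abs_if)
      finally show ?thesis using True by simp
    qed (simp add: F_eq c)
    have i: "integrable lborel (\<lambda>x. indicator usq x * exp (t * S ls L x))" if "\<bar>t\<bar> \<le> 1" for t
    proof (rule integrable_bounded_usq[where B = "exp (real L)"])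
      fix x
      have "\<bar>t * S ls L x\<bar> \<le> 1 * real L" unfolding abs_mult using that S_bound by (intro mult_mono) auto
      then show "\<bar>exp (t * S ls L x)\<bar> \<le> exp (real L)" by (simp add: abs_le_iff)
    qed auto
    have ii: "integrable lborel (\<lambda>x. c * (indicator usq x * exp (s * S ls L x) + indicator usq x * exp (- s * S ls L x)))"
      by (intro integrable_mult_right Bochner_Integration.integrable_add i) (use s in auto)
    have "(\<integral>\<^sup>+ x. epowr (ennreal \<bar>F x\<bar>) p \<partial>lborel) = (\<integral>\<^sup>+ x. ennreal (\<bar>F x\<bar> powr p) \<partial>lborel)"
      by (simp add: epowr_ennreal)
    also have "\<dots> \<le> (\<integral>\<^sup>+ x. ennreal (c * (indicator usq x * exp (s * S ls L x) + indicator usq x * exp (- s * S ls L x))) \<partial>lborel)"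
      by (intro nn_integral_mono ennreal_leI pt)
    also have "\<dots> = ennreal (LINT x|lborel. c * (indicator usq x * exp (s * S ls L x) + indicator usq x * exp (- s * S ls L x)))"
      by (rule nn_integral_eq_integral[OF ii]) (use c in \<open>auto intro!: AE_I2 mult_nonneg_nonneg add_nonneg_nonneg\<close>)
    also have "\<dots> \<le> ennreal 1"
    proof (rule ennreal_leI)
      have "(LINT x|lborel. c * (indicator usq x * exp (s * S ls L x) + indicator usq x * exp (- s * S ls L x)))
        = c * ((LINT x|lborel. indicator usq x * exp (s * S ls L x)) + (LINT x|lborel. indicator usq x * exp (- s * S ls L x)))"
        using i[of s] i[of "- s"] s by simp
      also have "\<dots> \<le> c * (exp 2 + exp 2)"
        using exp_moment_bound[OF good _ sL, of s] exp_moment_bound[OF good _ sL, of "- s"] c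
        by (intro mult_left_mono add_mono) auto
      finally show "(LINT x|lborel. c * (indicator usq x * exp (s * S ls L x) + indicator usq x * exp (- s * S ls L x))) \<le> 1"
        using cK by simp
    qed
    finally have "(\<integral>\<^sup>+ x. epowr (ennreal \<bar>F x\<bar>) p \<partial>lborel) \<le> ennreal 1" .
    from epowr_mono[OF this, of "1 / p"] show ?thesis
      unfolding Lpnorm_def using p epowr_ennreal[of 1 "1 / p"] by simp
  qed

  \<comment> \<open>Up to the factor 1/K, a pointwise lower bound for the maximal function off the
    exceptional set; the subtracted term is the error from \<open>close_sum\<close>.\<close>
  define T where "T = (\<lambda>x. (\<Sum>l<L. Vmax (\<Theta> ls l x)) - 2 * real L * \<epsilon>)"
  have Tm [measurable]: "T \<in> borel_measurable borel" unfolding T_def by measurable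
  have sumV: "\<bar>\<Sum>l<L. Vmax (\<Theta> ls l x)\<bar> \<le> real L * vm" for x
  proof -
    have "\<bar>\<Sum>l<L. Vmax (\<Theta> ls l x)\<bar> \<le> (\<Sum>l<L. vm)"
      by (rule order_trans[OF sum_abs]) (intro sum_mono Vmax_bound)
    then show ?thesis by simp
  qed
  have L\<epsilon>: "0 \<le> 2 * real L * \<epsilon>" using L0 \<epsilon> by simp
  have TB: "\<bar>T x\<bar> \<le> real L * vm + 2 * real L * \<epsilon>" for x
    using sumV[of x] L\<epsilon> unfolding T_def by linarith
  have pos: "0 < ls m" if "m < L" for m using good[OF that] by (simp add: good_def)
  have ae: "AE x in lborel. \<forall>m<L. V 0 (\<Theta> ls m x) \<noteq> V 1 (\<Theta> ls m x)"
    by (rule AE_split) (rule pos)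
  have le: "AE x in lborel. x \<in> G \<longrightarrow> ennreal (T x / K) \<le> HU b cp cm U F x"
    using ae
  proof eventually_elim
    case (elim x)
    show ?case
    proof
      assume xG: "x \<in> G"
      then have x: "x \<in> usq" by (simp add: G_def)
      define k where "k = code ls L x"
      have k: "k < 2 ^ L" using code_less by (simp add: k_def)
      have reg: "pv_regular b cp cm (u k) (tree_block ls j) x" if "j \<in> nodes" for j
      proof -
        have j: "fst j < L" using that by (auto simp: nodes_def)
        have "V 0 (\<Theta> ls m x) \<noteq> V 1 (\<Theta> ls m x)" if "m < fst j" for m using elim j that by auto
        from cell_locally_const[OF this x] obtain \<delta> where \<delta>: "0 < \<delta>"
          "\<And>y. dist x y < \<delta> \<Longrightarrow> y \<in> cell ls (fst j) (snd j) \<longleftrightarrow> x \<in> cell ls (fst j) (snd j)" by blast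
        interpret bp: block_point b cp cm "u k" "\<sigma> (fst j) (snd j)" "cell ls (fst j) (snd j)" x \<delta>
          by unfold_locales (use b x \<delta> in \<open>auto simp: cell_def[abs_def] cell_sets[unfolded cell_def]\<close>)
        show ?thesis unfolding tree_block_def by (rule bp.regular)
      qed
      have "pv_regular b cp cm (u k) (tree_fun ls) x"
        using pv_regular_sum[OF finite_nodes reg] by (simp add: tree_fun_def[abs_def])
      then have "Hpv b cp cm (u k) F x = Hint b cp cm (u k) F x"
        unfolding F_def by (intro Hpv_eq_Hint pv_regular_cmult)
      also have "\<dots> = (1 / K) * Hint b cp cm (u k) (tree_fun ls) x" unfolding F_def by (rule Hint_cmult)
      also have "Hint b cp cm (u k) (tree_fun ls) x = (\<Sum>j\<in>nodes. Hint b cp cm (u k) (tree_block ls j) x)"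
        using Hint_sum[OF reg, of nodes] by (simp add: tree_fun_def[abs_def])
      finally have Hk: "Hpv b cp cm (u k) F x = (1 / K) * (\<Sum>j\<in>nodes. Hint b cp cm (u k) (tree_block ls j) x)" .
      have "\<bar>sg k * (\<Sum>j\<in>nodes. Hint b cp cm (u k) (tree_block ls j) x) - (\<Sum>l<L. Vmax (\<Theta> ls l x))\<bar> \<le> 2 * real L * \<epsilon>"
        unfolding k_def
      proof (rule close_sum[OF x])
        fix l i k' :: nat assume "l < L" "i < 2 ^ l" "k' < 2 ^ L"
        then show "close_at (\<epsilon> / 2 ^ L) ls l i k' x" using xG Zc[of l x i k'] by (auto simp: G_def ZZ_def)
      qed
      then have "T x \<le> sg k * (\<Sum>j\<in>nodes. Hint b cp cm (u k) (tree_block ls j) x)" unfolding T_def by linarith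
      \<comment> \<open>The modulus in the maximal function absorbs the sign attached to the
        leaf.\<close>
      also have "\<dots> \<le> \<bar>sg k\<bar> * \<bar>\<Sum>j\<in>nodes. Hint b cp cm (u k) (tree_block ls j) x\<bar>" by (simp add: abs_mult[symmetric])
      also have "\<dots> = \<bar>\<Sum>j\<in>nodes. Hint b cp cm (u k) (tree_block ls j) x\<bar>" by (simp only: sg mult_1)
      finally have "T x / K \<le> \<bar>\<Sum>j\<in>nodes. Hint b cp cm (u k) (tree_block ls j) x\<bar> / K"
        using K by (intro divide_right_mono) auto
      also have "\<dots> = \<bar>Hpv b cp cm (u k) F x\<bar>" unfolding Hk using K by (simp add: abs_mult)
      finally have "ennreal (T x / K) \<le> ennreal \<bar>Hpv b cp cm (u k) F x\<bar>" by (rule ennreal_leI)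
      also have "\<dots> \<le> HU b cp cm U F x" unfolding HU_def by (rule SUP_upper) (rule uU[OF k])
      finally show "ennreal (T x / K) \<le> HU b cp cm U F x" .
    qed
  qed

  have iV: "integrable lborel (\<lambda>x. indicator usq x * Vmax (\<Theta> ls l x))" for l
    by (rule integrable_bounded_usq[where B = vm]) (use Vmax_bound in auto)
  have iu: "integrable lborel (\<lambda>x. indicator usq x * (a::real))" for a
    by (rule integrable_bounded_usq[where B = "\<bar>a\<bar>"]) auto
  have iT: "integrable lborel (\<lambda>x. indicator usq x * T x)"
    by (rule integrable_bounded_usq[OF Tm TB])
  have iZ: "integrable lborel (\<lambda>x. indicator ZZ x * (real L * vm))"
    using fin[OF ZZu] by (intro integrable_mult_left) simp
  have "real L * c0 - 2 * real L * \<epsilon> \<le> (\<Sum>l<L. LINT x|lborel. indicator usq x * Vmax (\<Theta> ls l x)) - 2 * real L * \<epsilon>"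
  proof -
    have "(\<Sum>l<L. c0) \<le> (\<Sum>l<L. LINT x|lborel. indicator usq x * Vmax (\<Theta> ls l x))"
      using good by (intro sum_mono) (auto simp: good_def c0_def)
    then show ?thesis by simp
  qed
  also have "\<dots> = (LINT x|lborel. (\<Sum>l<L. indicator usq x * Vmax (\<Theta> ls l x)) - indicator usq x * (2 * real L * \<epsilon>))"
    by (subst Bochner_Integration.integral_diff[OF Bochner_Integration.integrable_sum[OF iV] iu])
       (simp only: Bochner_Integration.integral_sum[OF iV] usq_integral_const)
  also have "\<dots> = (LINT x|lborel. indicator usq x * T x)"
    by (simp only: T_def right_diff_distrib sum_distrib_left)
  finally have I1: "real L * c0 - 2 * real L * \<epsilon> \<le> (LINT x|lborel. indicator usq x * T x)" .
  have "(LINT x|lborel. indicator usq x * T x - indicator ZZ x * (real L * vm)) \<le> (LINT x|lborel. indicator G x * T x)"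
  proof (rule integral_mono)
    show "integrable lborel (\<lambda>x. indicator usq x * T x - indicator ZZ x * (real L * vm))"
      by (intro Bochner_Integration.integrable_diff iT iZ)
    have "integrable lborel (\<lambda>x. indicator usq x * (indicator G x * T x))"
    proof (rule integrable_bounded_usq)
      show "(\<lambda>x. indicator G x * T x) \<in> borel_measurable borel" unfolding G_def by measurable
      show "\<bar>indicator G x * T x\<bar> \<le> real L * vm + 2 * real L * \<epsilon>" for x
        using TB[of x] by (auto simp: indicator_def)
    qed
    moreover have "indicator usq x * (indicator G x * T x) = indicator G x * T x" for x
      by (simp add: G_def indicator_def)
    ultimately show "integrable lborel (\<lambda>x. indicator G x * T x)" by simp
    fix x
    have "T x \<le> real L * vm" using sumV[of x] L\<epsilon> unfolding T_def by linarith
    then show "indicator usq x * T x - indicator ZZ x * (real L * vm) \<le> indicator G x * T x"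
      using ZZu by (auto simp: G_def indicator_def)
  qed
  also have "(LINT x|lborel. indicator usq x * T x - indicator ZZ x * (real L * vm)) = (LINT x|lborel. indicator usq x * T x) - measure lborel ZZ * (real L * vm)"
    using iT iZ by simp
  finally have I2: "(LINT x|lborel. indicator usq x * T x) - measure lborel ZZ * (real L * vm) \<le> (LINT x|lborel. indicator G x * T x)" .
  have "measure lborel ZZ * (real L * vm) \<le> (real L * \<eta>) * (real L * vm)"
    using mZZ L0 vm0 by (intro mult_right_mono) auto
  also have "\<dots> = real L * (c0 / 4 * (vm / (vm + 1)))" using L0 vm0 by (simp add: \<eta>_def)
  also have "\<dots> \<le> real L * (c0 / 4 * 1)" using L0 c0 vm0 by (intro mult_left_mono) auto
  finally have I3: "measure lborel ZZ * (real L * vm) \<le> real L * c0 / 4" by simp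
  \<comment> \<open>Balance of the losses: out of \<open>L * c0\<close>, the approximation costs at
    most a quarter because \<epsilon> is at most \<open>c0 / 8\<close>, and the exceptional set
    another quarter. Half remains.\<close>
  have "real L * \<epsilon> \<le> real L * (c0 / 8)" using \<epsilon>r L0 by (intro mult_left_mono) (auto simp: c0_def)
  then have I4: "real L * c0 / 2 \<le> (LINT x|lborel. indicator G x * T x)" using I1 I2 I3 by linarith
  have "ennreal (real L * c0 / 2 / K) \<le> HUnorm b cp cm U p"
  proof (rule HUnorm_lower[OF p Fm Fn _ _ _ _ le])
    show "G \<in> sets borel" unfolding G_def by measurable
    show "\<bar>T x / K\<bar> \<le> (real L * vm + 2 * real L * \<epsilon>) / K" for x using TB[of x] K by (simp add: divide_right_mono)
    show "0 < real L * c0 / 2 / K" using L0 c0 K by simp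
    have "real L * c0 / 2 / K \<le> (LINT x|lborel. indicator G x * T x) / K" using I4 K by (intro divide_right_mono) auto
    also have "\<dots> = (LINT x|lborel. indicator G x * (T x / K))" by (simp add: times_divide_eq_right)
    finally show "real L * c0 / 2 / K \<le> (LINT x|lborel. indicator G x * (T x / K))" .
  qed (auto simp: G_def)
  \<comment> \<open>The gain is of order L and the normalisation K of order sqrt L, so their
    quotient is of order sqrt L.\<close>
  moreover have "real L * c0 / 2 / K = \<bar>r\<bar> / 16 / ((2 * exp 2) powr (1 / p) * p) * sqrt (real L)"
  proof -
    have "real L = sqrt (real L) * sqrt (real L)" by simp
    then show ?thesis using L0 p unfolding K_def c0_def by (simp add: field_simps)
  qed
  ultimately show ?thesis by simp
qed

end

section \<open>Separated points of U and the final count\<close>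

lemma spaced_subsequence:
  fixes D :: "int set"
  assumes D: "finite D" and q: "1 \<le> q" and N: "q * N \<le> card D"
  shows "\<exists>f :: nat \<Rightarrow> int. (\<forall>k<N. f k \<in> D) \<and> (\<forall>k. Suc k < N \<longrightarrow> f k + int q \<le> f (Suc k))"
proof -
  define xs where "xs = sorted_list_of_set D"
  have len: "length xs = card D" and set: "set xs = D" using D by (auto simp: xs_def)
  have srt: "sorted_wrt (<) xs" unfolding xs_def by (rule strict_sorted_list_of_set)
  have step: "xs ! i + int j \<le> xs ! (i + j)" if "i + j < length xs" for i j
    using that
  proof (induction j)
    case (Suc j)
    have "xs ! (i + j) < xs ! (i + Suc j)" using sorted_wrt_nth_less[OF srt] Suc.prems by simp
    then show ?case using Suc by simp
  qed simp
  have idx: "q * k < length xs" if "k < N" for k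
  proof -
    have "q * k < q * N" using that q by simp
    then show ?thesis using N len by linarith
  qed
  have "xs ! (q * k) \<in> D" if "k < N" for k using idx[OF that] set nth_mem by blast
  moreover have "xs ! (q * k) + int q \<le> xs ! (q * Suc k)" if "Suc k < N" for k
    using step[of "q * k" q] idx[OF that] by (simp add: add.commute)
  ultimately show ?thesis by (intro exI[of _ "\<lambda>k. xs ! (q * k)"]) blast
qed

text \<open>Scales that are q apart give points whose ratio is at least \<open>2 ^ (q - 1)\<close>:
  one factor 2 is lost because a point may lie anywhere in its dyadic interval.\<close>

lemma dyadic_spaced_points:
  assumes D: "finite D" "D \<subseteq> dyadic_scales U" and q: "1 \<le> q" and N: "q * N \<le> card D"
  shows "\<exists>u :: nat \<Rightarrow> real. (\<forall>k<N. u k \<in> U \<and> 0 < u k) \<and> (\<forall>k. Suc k < N \<longrightarrow> 2 ^ (q - 1) * u k \<le> u (Suc k))"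
proof -
  obtain f :: "nat \<Rightarrow> int" where f: "\<And>k. k < N \<Longrightarrow> f k \<in> D" "\<And>k. Suc k < N \<Longrightarrow> f k + int q \<le> f (Suc k)"
    using spaced_subsequence[OF D(1) q N] by blast
  have "\<forall>k\<in>{..<N}. \<exists>v. v \<in> U \<and> 2 powr f k \<le> v \<and> v \<le> 2 powr (f k + 1)"
  proof
    fix k assume "k \<in> {..<N}"
    then have "f k \<in> dyadic_scales U" using f(1) D(2) by auto
    then show "\<exists>v. v \<in> U \<and> 2 powr f k \<le> v \<and> v \<le> 2 powr (f k + 1)"
      by (auto simp: dyadic_scales_def)
  qed
  from bchoice[OF this] obtain u where u: "\<And>k. k < N \<Longrightarrow> u k \<in> U" "\<And>k. k < N \<Longrightarrow> 2 powr f k \<le> u k"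
    "\<And>k. k < N \<Longrightarrow> u k \<le> 2 powr (f k + 1)" by auto
  have "0 < u k" if "k < N" for k using u(2)[OF that] by (smt (verit) powr_gt_zero)
  moreover have "2 ^ (q - 1) * u k \<le> u (Suc k)" if k: "Suc k < N" for k
  proof -
    have "2 ^ (q - 1) * u k \<le> 2 ^ (q - 1) * 2 powr (f k + 1)" using u(3)[of k] k by (intro mult_left_mono) auto
    also have "\<dots> = 2 powr (real (q - 1) + (f k + 1))" by (simp add: powr_add powr_realpow)
    also have "\<dots> \<le> 2 powr (f (Suc k))"
    proof (rule powr_mono)
      have "real_of_int (f k + int q) \<le> real_of_int (f (Suc k))" using f(2)[OF k] by (simp only: of_int_le_iff)
      then show "real (q - 1) + (f k + 1) \<le> f (Suc k)" using q by (simp add: of_nat_diff)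
    qed simp
    also have "\<dots> \<le> u (Suc k)" using u(2)[OF k] .
    finally show ?thesis .
  qed
  ultimately show ?thesis using u(1) by blast
qed

lemma geometric_growth_mono:
  fixes u :: "nat \<Rightarrow> real"
  assumes M: "1 \<le> M" and pos: "\<And>k. k < N \<Longrightarrow> 0 < u k" and step: "\<And>k. Suc k < N \<Longrightarrow> M * u k \<le> u (Suc k)"
  shows "i \<le> j \<Longrightarrow> j < N \<Longrightarrow> u i \<le> u j" "i < j \<Longrightarrow> j < N \<Longrightarrow> M * u i \<le> u j"
proof -
  have mono: "u i \<le> u j" if "i \<le> j" "j < N" for i j
    using that
  proof (induction j rule: dec_induct)
    case (step j)
    have "u j \<le> M * u j" using M pos[of j] step by simp
    then show ?case using step assms(3)[of j] by simp
  qed simp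
  then show "i \<le> j \<Longrightarrow> j < N \<Longrightarrow> u i \<le> u j" .
  assume ij: "i < j" "j < N"
  then have "M * u i \<le> u (Suc i)" using step[of i] by simp
  also have "\<dots> \<le> u j" using ij mono[of "Suc i" j] by simp
  finally show "M * u i \<le> u j" .
qed

lemma eventually_at_top_nat:
  "(\<forall>\<^sub>F R in at_top. P (R :: real)) \<Longrightarrow> \<forall>\<^sub>F n in sequentially. P (real n)"
  using filterlim_real_sequentially unfolding filterlim_iff by blast

theorem theorem8p1:
  fixes b cp cm p :: real
  assumes "b > 1" and "cp \<noteq> 0" and "cm \<noteq> 0" and "1 < p"
  shows "\<exists>c > 0. \<forall>U. U \<noteq> {} \<and> U \<subseteq> {0<..} \<longrightarrow>
           (finite (dyadic_scales U) \<longrightarrow>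
              ennreal (c * sqrt (ln (1 + real (card (dyadic_scales U))))) \<le> HUnorm b cp cm U p) \<and>
           (infinite (dyadic_scales U) \<longrightarrow> HUnorm b cp cm U p = \<infinity>)"
proof -
  note b = \<open>b > 1\<close> and p = \<open>1 < p\<close>
  define Cp where "Cp = (2 * exp 2) powr (1 / p) * p"
  have Cp: "0 < Cp" using p by (simp add: Cp_def)
  define J where "J = (\<lambda>\<kappa> n \<theta>. integral {0..real n} (osc_diff b \<theta> 1 (\<kappa> * cp) (- 1) (\<kappa> * cm)))"
  obtain A\<^sub>1 A\<^sub>2 where A2: "\<bar>A\<^sub>2\<bar> \<le> pi / b" and Alim: "\<And>\<epsilon>. 0 < \<epsilon> \<Longrightarrow> \<exists>\<kappa>\<^sub>1>0. \<forall>\<kappa>\<ge>\<kappa>\<^sub>1.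
     (\<forall>\<^sub>F R in at_top. \<forall>\<theta>. \<bar>integral {0..R} (osc_diff b \<theta> 1 (\<kappa> * cp) (- 1) (\<kappa> * cm)) - (A\<^sub>1 * cos \<theta> + A\<^sub>2 * sin \<theta>)\<bar> \<le> \<epsilon>)"
    using osc_diff_large_limit[OF assms(1-3)] by blast
  \<comment> \<open>Polar form of the gap between the two limit symbols. The second pair
    \<open>r2\<close>, \<open>\<psi>2\<close> is the gap between \<open>pi * sin \<theta>\<close>
    and its negative, for the case of few scales.\<close>
  obtain r1 \<psi>1 where r1: "A\<^sub>1 = r1 * cos \<psi>1" "A\<^sub>2 - pi = r1 * sin \<psi>1" using polar_Ex by blast
  obtain r2 \<psi>2 where r2: "0 = r2 * cos \<psi>2" "- pi - pi = r2 * sin \<psi>2" using polar_Ex by blast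
  \<comment> \<open>This is where b > 1 separates the symbols: their sine coefficients cannot
    agree.\<close>
  have "pi / b < pi" using b by (simp add: divide_less_eq)
  then have "A\<^sub>2 - pi \<noteq> 0" using A2 by linarith
  then have r1nz: "r1 \<noteq> 0" using r1 by auto
  have "- pi - pi < 0" by simp
  then have r2nz: "r2 \<noteq> 0" using r2(2) by (metis less_irrefl mult_zero_left)
  define \<epsilon> where "\<epsilon> = min \<bar>r1\<bar> \<bar>r2\<bar> / 64"
  have \<epsilon>: "0 < \<epsilon>" "\<epsilon> \<le> \<bar>r1\<bar> / 64" "\<epsilon> \<le> \<bar>r2\<bar> / 64" using r1nz r2nz by (auto simp: \<epsilon>_def)
  obtain \<kappa>\<^sub>0 where \<kappa>0: "0 < \<kappa>\<^sub>0" and s0: "\<forall>\<kappa>. 0 \<le> \<kappa> \<and> \<kappa> \<le> \<kappa>\<^sub>0 \<longrightarrow>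
     (\<forall>\<^sub>F R in at_top. \<forall>\<theta>. \<bar>integral {0..R} (osc_diff b \<theta> 1 (\<kappa> * cp) (- 1) (\<kappa> * cm)) - pi * sin \<theta>\<bar> \<le> \<epsilon>)"
    using osc_diff_small_limit[OF b \<epsilon>(1), of cp cm] by blast
  have small: "\<forall>\<^sub>F n in sequentially. \<forall>\<theta>. \<bar>J \<kappa> n \<theta> - pi * sin \<theta>\<bar> \<le> \<epsilon>" if "0 \<le> \<kappa>" "\<kappa> \<le> \<kappa>\<^sub>0" for \<kappa>
    unfolding J_def by (rule eventually_at_top_nat) (use s0 that in blast)
  obtain \<kappa>\<^sub>1' where \<kappa>1': "0 < \<kappa>\<^sub>1'" and l0: "\<forall>\<kappa>\<ge>\<kappa>\<^sub>1'.
     (\<forall>\<^sub>F R in at_top. \<forall>\<theta>. \<bar>integral {0..R} (osc_diff b \<theta> 1 (\<kappa> * cp) (- 1) (\<kappa> * cm)) - (A\<^sub>1 * cos \<theta> + A\<^sub>2 * sin \<theta>)\<bar> \<le> \<epsilon>)"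
    using Alim[OF \<epsilon>(1)] by blast
  have large': "\<forall>\<^sub>F n in sequentially. \<forall>\<theta>. \<bar>J \<kappa> n \<theta> - (A\<^sub>1 * cos \<theta> + A\<^sub>2 * sin \<theta>)\<bar> \<le> \<epsilon>" if "\<kappa>\<^sub>1' \<le> \<kappa>" for \<kappa>
    unfolding J_def by (rule eventually_at_top_nat) (use l0 that in blast)
  define \<kappa>\<^sub>1 where "\<kappa>\<^sub>1 = max \<kappa>\<^sub>0 \<kappa>\<^sub>1'"
  have \<kappa>1: "0 < \<kappa>\<^sub>1" "\<kappa>\<^sub>0 \<le> \<kappa>\<^sub>1" and large: "\<And>\<kappa>. \<kappa>\<^sub>1 \<le> \<kappa> \<Longrightarrow> \<forall>\<^sub>F n in sequentially. \<forall>\<theta>. \<bar>J \<kappa> n \<theta> - (A\<^sub>1 * cos \<theta> + A\<^sub>2 * sin \<theta>)\<bar> \<le> \<epsilon>"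
    using \<kappa>0 large' by (auto simp: \<kappa>\<^sub>1_def)
  \<comment> \<open>One step between consecutive leaves multiplies u by at least
    \<open>2 ^ (q - 1)\<close>, enough to pass from the regime of large \<open>\<sigma> * u\<close>
    to that of small \<open>\<sigma> * u\<close>. As q depends only on b, \<open>cp\<close> and
    \<open>cm\<close>, the thinning costs a constant factor in the number of scales.\<close>
  obtain q where q: "1 \<le> q" "\<kappa>\<^sub>1 / \<kappa>\<^sub>0 \<le> 2 ^ (q - 1)"
  proof -
    obtain m where "\<kappa>\<^sub>1 / \<kappa>\<^sub>0 < 2 ^ m" using real_arch_pow[of 2 "\<kappa>\<^sub>1 / \<kappa>\<^sub>0"] by auto
    then show ?thesis by (intro that[of "Suc m"]) auto
  qed
  define d1 d2 where "d1 = \<bar>r1\<bar> / 16 / Cp" and "d2 = \<bar>r2\<bar> / 16 / Cp"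
  have d: "0 < d1" "0 < d2" using r1nz r2nz Cp by (auto simp: d1_def d2_def)

  \<comment> \<open>A tree of depth one with the same v at both leaves, the second taken with sign
    -1. Its symbols are \<open>pi * sin \<theta>\<close> and the negative of it, which gives a
    positive bound independent of U.\<close>
  have single: "ennreal d2 \<le> HUnorm b cp cm U p" if U: "U \<noteq> {}" "U \<subseteq> {0<..}" for U
  proof -
    obtain v where v: "v \<in> U" "0 < v" using U by auto
    interpret tr: cosine_tree b cp cm 1 "\<lambda>_. 0" "\<lambda>j. if j = 0 then pi else - pi" "\<lambda>_. v" "\<lambda>k. if k = 0 then 1 else - 1"
      "\<lambda>_ _. \<kappa>\<^sub>0 / v" \<epsilon> r2 \<psi>2
    proof
      fix l i k :: nat assume lik: "l < 1" "i < 2 ^ l" "k < 2 ^ 1"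
      have \<kappa>: "\<kappa>\<^sub>0 / v * v = \<kappa>\<^sub>0" using v by simp
      have "\<forall>\<^sub>F n in sequentially. \<forall>\<theta>. \<bar>J \<kappa>\<^sub>0 n \<theta> - pi * sin \<theta>\<bar> \<le> \<epsilon>" using small[of \<kappa>\<^sub>0] \<kappa>0 by simp
      then show "\<forall>\<^sub>F n in sequentially. \<forall>\<theta>.
        \<bar>(if k = 0 then 1 else - 1) * integral {0..real n} (osc_diff b \<theta> 1 (\<kappa>\<^sub>0 / v * v * cp) (- 1) (\<kappa>\<^sub>0 / v * v * cm))
          - (let j = if k < (2 * i + 1) * 2 ^ (1 - Suc l) then 0 else 1
             in 0 * cos \<theta> + (if j = (0::nat) then pi else - pi) * sin \<theta>)\<bar> \<le> \<epsilon>"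
        unfolding \<kappa>
      proof eventually_elim
        case (elim n)
        show ?case
        proof
          fix \<theta>
          have "\<bar>J \<kappa>\<^sub>0 n \<theta> - pi * sin \<theta>\<bar> \<le> \<epsilon>" using elim by blast
          then show "\<bar>(if k = 0 then 1 else - 1) * integral {0..real n} (osc_diff b \<theta> 1 (\<kappa>\<^sub>0 * cp) (- 1) (\<kappa>\<^sub>0 * cm))
            - (let j = if k < (2 * i + 1) * 2 ^ (1 - Suc l) then 0 else 1
             in 0 * cos \<theta> + (if j = (0::nat) then pi else - pi) * sin \<theta>)\<bar> \<le> \<epsilon>"
            using lik unfolding J_def Let_def by (cases "k = 0") (auto simp: abs_if split: if_splits)
        qed
      qed
    qed (use b \<epsilon> r2 r2nz in auto)
    show ?thesis using tr.tree_lower_bound[OF p _ \<epsilon>(3), of U] v by (simp add: d2_def Cp_def)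
  qed

  \<comment> \<open>Stated for a finite subset D of the scales, so that it applies both to a finite
    set of scales and to arbitrarily large pieces of an infinite one.\<close>
  have many: "ennreal (d1 * sqrt (real L)) \<le> HUnorm b cp cm U p"
    if D: "finite D" "D \<subseteq> dyadic_scales U" and L: "1 \<le> L" and card: "q * 2 ^ L \<le> card D" for U D L
  proof -
    obtain u where u: "\<And>k. k < 2 ^ L \<Longrightarrow> u k \<in> U" "\<And>k. k < 2 ^ L \<Longrightarrow> 0 < u k"
      and ustep: "\<And>k. Suc k < 2 ^ L \<Longrightarrow> 2 ^ (q - 1) * u k \<le> u (Suc k)"
      using dyadic_spaced_points[OF D q(1) card] by blast
    have M: "(1::real) \<le> 2 ^ (q - 1)" by simp
    define c where "c = (\<lambda>l i :: nat. (2 * i + 1) * (2::nat) ^ (L - Suc l))"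
    \<comment> \<open>The index \<open>c l i\<close> is the smallest leaf to the right of the node,
      and there \<open>\<sigma> * u\<close> equals \<open>\<kappa>\<^sub>1\<close>. Larger leaves
      give larger values. A leaf on the left is at least one step below, so by the choice of q it
      gives at most \<open>\<kappa>\<^sub>0\<close>.\<close>
    define \<sigma> where "\<sigma> = (\<lambda>l i. \<kappa>\<^sub>1 / u (c l i))"
    interpret tr: cosine_tree b cp cm L "\<lambda>j. if j = 0 then 0 else A\<^sub>1" "\<lambda>j. if j = 0 then pi else A\<^sub>2" u "\<lambda>_. 1" \<sigma> \<epsilon> r1 \<psi>1
    proof
      fix l i k :: nat assume lik: "l < L" "i < 2 ^ l" "k < 2 ^ L"
      have cL: "c l i < 2 ^ L"
      proof -
        have "c l i < 2 ^ Suc l * 2 ^ (L - Suc l)" unfolding c_def using lik by (intro mult_strict_right_mono) auto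
        also have "\<dots> = 2 ^ L" using lik by (simp only: power_add[symmetric]) simp
        finally show ?thesis .
      qed
      have uc: "0 < u (c l i)" using u(2)[OF cL] .
      have \<sigma>: "\<sigma> l i * u k = \<kappa>\<^sub>1 * u k / u (c l i)" by (simp add: \<sigma>_def)
      have "\<forall>\<^sub>F n in sequentially. \<forall>\<theta>. \<bar>J (\<sigma> l i * u k) n \<theta> - (if k < c l i then pi * sin \<theta> else A\<^sub>1 * cos \<theta> + A\<^sub>2 * sin \<theta>)\<bar> \<le> \<epsilon>"
      proof (cases "k < c l i")
        case True
        have "(\<kappa>\<^sub>1 / \<kappa>\<^sub>0) * u k \<le> 2 ^ (q - 1) * u k" using q(2) u(2)[OF lik(3)] by (intro mult_right_mono) auto
        also have "\<dots> \<le> u (c l i)" by (rule geometric_growth_mono(2)[of _ "2 ^ L" u, OF M u(2) ustep True cL])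
        finally have "\<sigma> l i * u k \<le> \<kappa>\<^sub>0" unfolding \<sigma> using uc \<kappa>0 by (simp add: field_simps)
        moreover have "0 \<le> \<sigma> l i * u k" unfolding \<sigma> using uc \<kappa>1 u(2)[OF lik(3)] by simp
        ultimately show ?thesis using small True by simp
      next
        case False
        have "u (c l i) \<le> u k" by (rule geometric_growth_mono(1)[of _ "2 ^ L" u, OF M u(2) ustep _ lik(3)]) (use False in auto)
        then have "\<kappa>\<^sub>1 \<le> \<sigma> l i * u k" unfolding \<sigma> using uc \<kappa>1 by (simp add: field_simps)
        then show ?thesis using large False by simp
      qed
      then show "\<forall>\<^sub>F n in sequentially. \<forall>\<theta>.
        \<bar>1 * integral {0..real n} (osc_diff b \<theta> 1 (\<sigma> l i * u k * cp) (- 1) (\<sigma> l i * u k * cm))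
          - (let j = if k < (2 * i + 1) * 2 ^ (L - Suc l) then 0 else 1
             in (if j = (0::nat) then 0 else A\<^sub>1) * cos \<theta> + (if j = 0 then pi else A\<^sub>2) * sin \<theta>)\<bar> \<le> \<epsilon>"
        unfolding J_def Let_def c_def by (cases "k < (2 * i + 1) * 2 ^ (L - Suc l)") simp_all
    qed (use b \<epsilon> r1 r1nz L in auto)
    show ?thesis using tr.tree_lower_bound[OF p u(1) \<epsilon>(2)] by (simp add: d1_def Cp_def)
  qed

  \<comment> \<open>With n scales and the largest admissible depth L one has
    \<open>1 + n \<le> 4 * q * 2 ^ L\<close>, so the logarithm is at most \<open>Kq * L\<close>. The
    same constant bounds the logarithm when n is below \<open>2 * q\<close>.\<close>
  define Kq where "Kq = ln (4 * real q) + 1"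
  have Kq: "1 \<le> Kq" using q by (simp add: Kq_def)
  define c where "c = min d1 d2 / sqrt Kq"
  have c: "0 < c" using d Kq by (simp add: c_def)
  have "ennreal (c * sqrt (ln (1 + real (card (dyadic_scales U))))) \<le> HUnorm b cp cm U p"
    if U: "U \<noteq> {}" "U \<subseteq> {0<..}" and fin: "finite (dyadic_scales U)" for U
  proof -
    define n where "n = card (dyadic_scales U)"
    have key: "c * sqrt (ln (1 + real n)) \<le> d * sqrt M" if "ln (1 + real n) \<le> Kq * M" "min d1 d2 \<le> d" "0 \<le> M" for d M
    proof -
      have "c * sqrt (ln (1 + real n)) \<le> c * sqrt (Kq * M)" using c that by (intro mult_left_mono) auto
      also have "\<dots> = min d1 d2 * sqrt M" using Kq by (simp add: c_def real_sqrt_mult)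
      also have "\<dots> \<le> d * sqrt M" using that by (intro mult_right_mono) auto
      finally show ?thesis .
    qed
    show ?thesis
    \<comment> \<open>From \<open>2 * q\<close> scales on, \<open>n div q\<close> is at least 2 and
      a tree of depth at least 1 exists; below that the bound from a single point is enough.\<close>
    proof (cases "n < 2 * q")
      case True
      have "ln (1 + real n) \<le> ln (4 * real q)" using True q by (subst ln_le_cancel_iff) auto
      then have "c * sqrt (ln (1 + real n)) \<le> d2 * sqrt 1" by (intro key) (auto simp: Kq_def)
      then have "c * sqrt (ln (1 + real n)) \<le> d2" by simp
      from order_trans[OF ennreal_leI[OF this] single[OF U]] show ?thesis by (simp only: n_def)
    next
      case False
      have nq: "2 \<le> n div q" using False q by (simp add: less_eq_div_iff_mult_less_eq)
      then obtain L where L: "2 ^ L \<le> n div q" "n div q < 2 ^ (L + 1)"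
        using ex_power_ivl1[of 2 "n div q"] by auto
      have L1: "1 \<le> L" using L(2) nq by (cases L) auto
      have "q * 2 ^ L \<le> q * (n div q)" using L(1) by simp
      also have "\<dots> \<le> n" by simp
      finally have big: "ennreal (d1 * sqrt (real L)) \<le> HUnorm b cp cm U p"
        using many[OF fin subset_refl L1] by (simp add: n_def)
      have "c * sqrt (ln (1 + real n)) \<le> d1 * sqrt (real L)"
      proof (rule key)
        have "n < q * (n div q + 1)" using q dividend_less_times_div[of q n] by simp
        also have "\<dots> \<le> q * 2 ^ (L + 1)" using L(2) by (intro mult_left_mono) auto
        finally have "1 + n \<le> q * 2 ^ (L + 1)" by simp
        then have "real (1 + n) \<le> real (q * 2 ^ (L + 1))" by (simp only: of_nat_le_iff)
        then have "ln (1 + real n) \<le> ln ((4 * real q) * 2 ^ L)" using q by (subst ln_le_cancel_iff) auto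
        also have "\<dots> = ln (4 * real q) + real L * ln 2" using q by (simp add: ln_mult ln_realpow)
        also have "\<dots> \<le> ln (4 * real q) * real L + real L * 1"
          using L1 q ln_2_less_1 by (intro add_mono mult_left_mono) (auto simp: mult_le_cancel_left1)
        also have "\<dots> = Kq * real L" by (simp add: Kq_def algebra_simps)
        finally show "ln (1 + real n) \<le> Kq * real L" .
      qed auto
      from order_trans[OF ennreal_leI[OF this] big] show ?thesis by (simp only: n_def)
    qed
  qed
  moreover have "HUnorm b cp cm U p = \<infinity>" if inf: "infinite (dyadic_scales U)" for U
  proof (rule ccontr)
    assume "HUnorm b cp cm U p \<noteq> \<infinity>"
    then obtain y where y: "0 \<le> y" "HUnorm b cp cm U p = ennreal y"
      by (metis ennreal_cases infinity_ennreal_def)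
    \<comment> \<open>The bound \<open>d1 * sqrt L\<close> exceeds y for this L. The added 1 also
      guarantees a depth of at least 1.\<close>
    obtain L :: nat where L: "(y / d1)\<^sup>2 + 1 < real L" using reals_Archimedean2 by blast
    have L1: "1 \<le> L" using L by (smt (verit) of_nat_1 of_nat_le_iff zero_le_power2)
    obtain D where D: "D \<subseteq> dyadic_scales U" "finite D" "card D = q * 2 ^ L"
      using infinite_arbitrarily_large[OF inf] by blast
    have "ennreal (d1 * sqrt (real L)) \<le> ennreal y" using many[OF D(2,1) L1] D(3) y by simp
    then have "d1 * sqrt (real L) \<le> y" using y by simp
    then have "sqrt (real L) \<le> y / d1" using d by (simp add: field_simps)
    then have "(sqrt (real L))\<^sup>2 \<le> (y / d1)\<^sup>2" by (intro power_mono) auto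
    then show False using L by simp
  qed
  ultimately show ?thesis using c by blast
qed

end
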